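(* (Lichnerowicz inequality) Let $(X,d,\nu)$ be a weak $\mathrm{CD}(K,N)$ space with $K>0$ and $N\in(1,\infty)$. Then for any Lipschitz function $f:\mathrm{supp}\,\nu\to\mathbb R$ with $\int_Xf\,d\nu=0$ one has $$\int_Xf^2\,d\nu\le\frac{N-1}{NK}\int_X|\nabla^-f|^2\,d\nu.$$
   Context: Spaces. An irreversible metric on $X$ is $d:X\times X\to[0,\infty)$ with $d(x,y)=0$ iff $x=y$ and the triangle inequality (no symmetry). Topology: generated by forward balls $B^+_x(r)=\{y:d(x,y)<r\}$. $\lambda_d(A)=\inf\{\lambda\ge1:d(x,y)\le\lambda d(y,x)\ \forall x,y\in A\}$. $(X,d)$ is a forward metric space if for some point $\star$ and some nondecreasing $\Theta:[0,\infty)\to[1,\infty)$ one has $\lambda_d(\overline{B^+_\star(r)})\le\Theta(r)$ for all $r>0$. It is forward boundedly compact if all closed forward balls are compact. It is a forward geodesic space if any $x,y$ are joined by a constant-speed minimal geodesic, i.e. continuous $\gamma:[0,1]\to X$ from $x$ to $y$ with $d(\gamma(s),\gamma(t))=(t-s)d(x,y)$ for $0\le s\le t\le1$; $\Gamma(X)$ is the set of these curves. "-measure space" means equipped with a nonnegative locally finite Borel measure. Gradients. $f$ is Lipschitz if for some $C>0$, $f(y)-f(x)\le C\,d(x,y)$ for all $x,y$. $|\nabla^-f|(x)=\limsup_{y\to x}\frac{[f(y)-f(x)]_-}{d(x,y)}$, $[a]_-=\max\{-a,0\}$ ($x$ non-isolated). Optimal transport. $e_t(\gamma)=\gamma(t)$.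 An optimal transference plan from $\mu_0$ to $\mu_1$ (w.r.t. $d^2$) is a coupling $\pi$ of $(\mu_0,\mu_1)$ minimizing $\int d(x,y)^2d\pi(x,y)$. A dynamical optimal transference plan is a probability measure $\Pi$ on $\Gamma(X)$ with $(e_0,e_1)_\sharp\Pi$ optimal; $\mu_t=(e_t)_\sharp\Pi$ is a displacement interpolation, associated with $\pi=(e_0,e_1)_\sharp\Pi$. Functionals. $DC_N$ is the set of continuous convex $U:[0,\infty)\to\mathbb R$, $C^2$ on $(0,\infty)$, $U(0)=0$, such that with $p(r)=rU'(r)-U(r)$ the function $r\mapsto p(r)/r^{1-1/N}$ is nondecreasing. Put $U'(\infty)=\lim_{r\to\infty}U(r)/r$. For compactly supported $\mu=\rho\nu+\mu_s$ (Lebesgue decomposition w.r.t. $\nu$), $U_\nu(\mu)=\int_XU(\rho)\,d\nu+U'(\infty)\mu_s[X]$, and for measurable $\beta:X\times X\to(0,\infty]$ and $\pi\in P(X\times X)$ with first marginal $\mu$, disintegrated as $\pi(dx\,dy)=\mu(dx)\pi(dy|x)$, $$U^\beta_{\pi,\nu}(\mu)=\int_{X\times X}U\Big(\frac{\rho(x)}{\beta(x,y)}\Big)\beta(x,y)\,\pi(dy|x)\,\nu(dx)+U'(\infty)\mu_s[X],$$ with the conventions $U(0)/0=U'(0)$, $U(\infty)/\infty=U'(\infty)$. Coefficients ($K>0$, $N\in(1,\infty)$). $\mathfrak s_{K,N}(r)=\sqrt{\tfrac{N-1}{K}}\sin\big(r\sqrt{\tfrac{K}{N-1}}\big)$. For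 $t\in(0,1]$: $\beta^{(K,N)}_t(x,y)=\infty$ if $d(x,y)\ge\pi\sqrt{(N-1)/K}$, and otherwise $\beta^{(K,N)}_t(x,y)=\big(\frac{\mathfrak s_{K,N}(t\,d(x,y))}{t\,\mathfrak s_{K,N}(d(x,y))}\big)^{N-1}$ (equal to $1$ if $x=y$); $\beta^{(K,N)}_0=1$. $\breve\beta(x,y)=\beta(y,x)$ and $\breve\pi$ is the image of $\pi$ under $(x,y)\mapsto(y,x)$. If $\sup_{x,y}d(x,y)=\pi\sqrt{(N-1)/K}$, then $U^{\beta^{(K,N)}_t}_{\pi,\nu}$ and $U^{\breve\beta^{(K,N)}_t}_{\breve\pi,\nu}$ are defined as the limits as $N'\downarrow N$ of the same expressions with $N'$. Weak $\mathrm{CD}(K,N)$. A forward boundedly compact, $\sigma$-finite forward geodesic-measure space $(X,d,\nu)$ is a weak $\mathrm{CD}(K,N)$ space if for any two compactly supported probability measures $\mu_0,\mu_1$ with $\mathrm{supp}\,\mu_i\subset\mathrm{supp}\,\nu$ there are a displacement interpolation $(\mu_t)_{0\le t\le1}$ and an associated optimal transference plan $\pi$ from $\mu_0$ to $\mu_1$ such that for all $U\in DC_N$ and $t\in[0,1]$: $U_\nu(\mu_t)\le(1-t)\,U^{\beta^{(K,N)}_{1-t}}_{\pi,\nu}(\mu_0)+t\,U^{\breve\beta^{(K,N)}_t}_{\breve\pi,\nu}(\mu_1)$. *)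

theory Defs
  imports "HOL-Probability.Probability"
begin

text \<open>The space is the whole type \<open>'a\<close>.  As \<open>d\<close> need not be symmetric, the type class of metric
  spaces does not apply, and topology and Borel sets are derived from \<open>d\<close> explicitly.\<close>

definition irreversible_metric :: "('a \<Rightarrow> 'a \<Rightarrow> real) \<Rightarrow> bool" where
  "irreversible_metric d \<longleftrightarrow>
     (\<forall>x y. 0 \<le> d x y) \<and> (\<forall>x y. d x y = 0 \<longleftrightarrow> x = y) \<and> (\<forall>x y z. d x z \<le> d x y + d y z)"

definition fwd_ball :: "('a \<Rightarrow> 'a \<Rightarrow> real) \<Rightarrow> 'a \<Rightarrow> real \<Rightarrow> 'a set" where
  "fwd_ball d x r = {y. d x y < r}"

definition fwd_topology :: "('a \<Rightarrow> 'a \<Rightarrow> real) \<Rightarrow> 'a topology" where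
  "fwd_topology d = topology_generated_by {fwd_ball d x r | x r. True}"

definition fwd_cball :: "('a \<Rightarrow> 'a \<Rightarrow> real) \<Rightarrow> 'a \<Rightarrow> real \<Rightarrow> 'a set" where
  "fwd_cball d x r = fwd_topology d closure_of fwd_ball d x r"

definition fwd_borel :: "('a \<Rightarrow> 'a \<Rightarrow> real) \<Rightarrow> 'a measure" where
  "fwd_borel d = sigma UNIV {U. openin (fwd_topology d) U}"

text \<open>Extended-real valued, so that the infimum over an empty set of constants is \<open>\<infinity>\<close>.\<close>

definition reversibility :: "('a \<Rightarrow> 'a \<Rightarrow> real) \<Rightarrow> 'a set \<Rightarrow> ereal" where
  "reversibility d A = Inf {ereal l | l. 1 \<le> l \<and> (\<forall>x\<in>A. \<forall>y\<in>A. d x y \<le> l * d y x)}"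

definition forward_metric_space :: "('a \<Rightarrow> 'a \<Rightarrow> real) \<Rightarrow> bool" where
  "forward_metric_space d \<longleftrightarrow> irreversible_metric d \<and>
     (\<exists>p \<Theta>. mono_on {0..} \<Theta> \<and> (\<forall>r\<ge>0. 1 \<le> \<Theta> r) \<and>
        (\<forall>r>0. reversibility d (fwd_cball d p r) \<le> ereal (\<Theta> r)))"

definition forward_boundedly_compact :: "('a \<Rightarrow> 'a \<Rightarrow> real) \<Rightarrow> bool" where
  "forward_boundedly_compact d \<longleftrightarrow> (\<forall>x r. compactin (fwd_topology d) (fwd_cball d x r))"

text \<open>Curves are functions on \<open>[0, 1]\<close>, made \<open>undefined\<close> outside so that equality of curves is
  equality of functions.\<close>

definition geodesics :: "('a \<Rightarrow> 'a \<Rightarrow> real) \<Rightarrow> (real \<Rightarrow> 'a) set" where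
  "geodesics d = {\<gamma> \<in> extensional {0..1}.
     continuous_map (top_of_set {0..1}) (fwd_topology d) \<gamma> \<and>
     (\<forall>s t. 0 \<le> s \<and> s \<le> t \<and> t \<le> 1 \<longrightarrow> d (\<gamma> s) (\<gamma> t) = (t - s) * d (\<gamma> 0) (\<gamma> 1))}"

definition forward_geodesic_space :: "('a \<Rightarrow> 'a \<Rightarrow> real) \<Rightarrow> bool" where
  "forward_geodesic_space d \<longleftrightarrow> forward_metric_space d \<and>
     (\<forall>x y. \<exists>\<gamma>\<in>geodesics d. \<gamma> 0 = x \<and> \<gamma> 1 = y)"

definition locally_finite_borel_measure :: "('a \<Rightarrow> 'a \<Rightarrow> real) \<Rightarrow> 'a measure \<Rightarrow> bool" where
  "locally_finite_borel_measure d \<nu> \<longleftrightarrow> sets \<nu> = sets (fwd_borel d) \<and>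
     (\<forall>x. \<exists>U. openin (fwd_topology d) U \<and> x \<in> U \<and> emeasure \<nu> U < \<infinity>)"

definition msupp :: "('a \<Rightarrow> 'a \<Rightarrow> real) \<Rightarrow> 'a measure \<Rightarrow> 'a set" where
  "msupp d \<mu> = {x. \<forall>U. openin (fwd_topology d) U \<and> x \<in> U \<longrightarrow> 0 < emeasure \<mu> U}"

text \<open>For a function defined on a subset \<open>S\<close> only, values outside \<open>S\<close> are ignored.\<close>

definition fwd_Lipschitz_on :: "('a \<Rightarrow> 'a \<Rightarrow> real) \<Rightarrow> 'a set \<Rightarrow> ('a \<Rightarrow> real) \<Rightarrow> bool" where
  "fwd_Lipschitz_on d S f \<longleftrightarrow> (\<exists>C>0. \<forall>x\<in>S. \<forall>y\<in>S. f y - f x \<le> C * d x y)"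

text \<open>The filter excludes \<open>x\<close> itself; at a point isolated in \<open>S\<close> it is trivial and the
  (\<open>ennreal\<close>-valued) upper limit is \<open>0\<close>.\<close>

definition descending_slope :: "('a \<Rightarrow> 'a \<Rightarrow> real) \<Rightarrow> 'a set \<Rightarrow> ('a \<Rightarrow> real) \<Rightarrow> 'a \<Rightarrow> ennreal" where
  "descending_slope d S f x =
     Limsup (atin_within (fwd_topology d) x S) (\<lambda>y. ennreal (max (- (f y - f x)) 0 / d x y))"

text \<open>The spaces concerned are second countable, so the product of the Borel \<open>\<sigma>\<close>-algebras is the
  Borel \<open>\<sigma>\<close>-algebra of the product.\<close>

definition coupling :: "('a \<times> 'a) measure \<Rightarrow> 'a measure \<Rightarrow> 'a measure \<Rightarrow> bool" where
  "coupling \<pi> \<mu>0 \<mu>1 \<longleftrightarrow> sets \<pi> = sets (\<mu>0 \<Otimes>\<^sub>M \<mu>1) \<and> distr \<pi> \<mu>0 fst = \<mu>0 \<and> distr \<pi> \<mu>1 snd = \<mu>1"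

definition optimal_plan ::
    "('a \<Rightarrow> 'a \<Rightarrow> real) \<Rightarrow> ('a \<times> 'a) measure \<Rightarrow> 'a measure \<Rightarrow> 'a measure \<Rightarrow> bool" where
  "optimal_plan d \<pi> \<mu>0 \<mu>1 \<longleftrightarrow> coupling \<pi> \<mu>0 \<mu>1 \<and>
     (\<forall>\<pi>'. coupling \<pi>' \<mu>0 \<mu>1 \<longrightarrow>
        (\<integral>\<^sup>+(x, y). ennreal ((d x y)\<^sup>2) \<partial>\<pi>) \<le> (\<integral>\<^sup>+(x, y). ennreal ((d x y)\<^sup>2) \<partial>\<pi>'))"

text \<open>The \<open>\<sigma>\<close>-algebra on the set of geodesics is the one generated by the evaluation maps, which is
  the Borel \<open>\<sigma>\<close>-algebra of uniform convergence when the space is forward boundedly compact.\<close>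

definition geodesic_algebra :: "('a \<Rightarrow> 'a \<Rightarrow> real) \<Rightarrow> (real \<Rightarrow> 'a) measure" where
  "geodesic_algebra d = restrict_space (Pi\<^sub>M {0..1} (\<lambda>_. fwd_borel d)) (geodesics d)"

definition eval_at :: "('a \<Rightarrow> 'a \<Rightarrow> real) \<Rightarrow> (real \<Rightarrow> 'a) measure \<Rightarrow> real \<Rightarrow> 'a measure" where
  "eval_at d P t = distr P (fwd_borel d) (\<lambda>\<gamma>. \<gamma> t)"

definition endpoint_plan :: "('a \<Rightarrow> 'a \<Rightarrow> real) \<Rightarrow> (real \<Rightarrow> 'a) measure \<Rightarrow> ('a \<times> 'a) measure" where
  "endpoint_plan d P = distr P (fwd_borel d \<Otimes>\<^sub>M fwd_borel d) (\<lambda>\<gamma>. (\<gamma> 0, \<gamma> 1))"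

definition dynamical_optimal_plan :: "('a \<Rightarrow> 'a \<Rightarrow> real) \<Rightarrow> (real \<Rightarrow> 'a) measure \<Rightarrow> bool" where
  "dynamical_optimal_plan d P \<longleftrightarrow> prob_space P \<and> sets P = sets (geodesic_algebra d) \<and>
     optimal_plan d (endpoint_plan d P) (eval_at d P 0) (eval_at d P 1)"

definition displacement_interpolation ::
    "('a \<Rightarrow> 'a \<Rightarrow> real) \<Rightarrow> (real \<Rightarrow> 'a measure) \<Rightarrow> ('a \<times> 'a) measure \<Rightarrow> bool" where
  "displacement_interpolation d \<mu> \<pi> \<longleftrightarrow>
     (\<exists>P. dynamical_optimal_plan d P \<and> (\<forall>t\<in>{0..1}. \<mu> t = eval_at d P t) \<and> \<pi> = endpoint_plan d P)"

definition pressure :: "(real \<Rightarrow> real) \<Rightarrow> real \<Rightarrow> real" where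
  "pressure U r = r * deriv U r - U r"

definition DC :: "real \<Rightarrow> (real \<Rightarrow> real) set" where
  "DC N = {U. continuous_on {0..} U \<and> convex_on {0..} U \<and> U 0 = 0 \<and>
     (\<exists>U''. (\<forall>r>0. (U has_real_derivative deriv U r) (at r) \<and>
                  (deriv U has_real_derivative U'' r) (at r)) \<and>
            continuous_on {0<..} U'') \<and>
     mono_on {0<..} (\<lambda>r. pressure U r / r powr (1 - 1 / N))}"

text \<open>By convexity \<open>U r / r\<close> is nondecreasing, so both limits exist, in \<open>(-\<infinity>, \<infinity>]\<close> and
  \<open>[-\<infinity>, \<infinity>)\<close> respectively.\<close>

definition slope_infinity :: "(real \<Rightarrow> real) \<Rightarrow> ereal" where
  "slope_infinity U = Lim at_top (\<lambda>r. ereal (U r / r))"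

definition slope_zero :: "(real \<Rightarrow> real) \<Rightarrow> ereal" where
  "slope_zero U = Lim (at_right 0) (\<lambda>r. ereal (U r / r))"

definition lebesgue_decomposition ::
    "'a measure \<Rightarrow> 'a measure \<Rightarrow> ('a \<Rightarrow> real) \<Rightarrow> 'a measure \<Rightarrow> bool" where
  "lebesgue_decomposition \<nu> \<mu> \<rho> \<mu>s \<longleftrightarrow>
     \<rho> \<in> borel_measurable \<nu> \<and> (\<forall>x. 0 \<le> \<rho> x) \<and> sets \<mu>s = sets \<nu> \<and>
     (\<exists>A\<in>sets \<nu>. emeasure \<nu> A = 0 \<and> emeasure \<mu>s (space \<nu> - A) = 0) \<and>
     (\<forall>A\<in>sets \<nu>. emeasure \<mu> A = emeasure (density \<nu> (\<lambda>x. ennreal (\<rho> x))) A + emeasure \<mu>s A)"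

text \<open>The choices below are harmless: for \<open>\<sigma>\<close>-finite \<open>\<nu>\<close> and finite \<open>\<mu>\<close> the singular part is unique
  and the density is unique \<open>\<nu>\<close>-almost everywhere.\<close>

definition ac_density :: "'a measure \<Rightarrow> 'a measure \<Rightarrow> 'a \<Rightarrow> real" where
  "ac_density \<nu> \<mu> = (SOME \<rho>. \<exists>\<mu>s. lebesgue_decomposition \<nu> \<mu> \<rho> \<mu>s)"

definition singular_part :: "'a measure \<Rightarrow> 'a measure \<Rightarrow> 'a measure" where
  "singular_part \<nu> \<mu> = (SOME \<mu>s. \<exists>\<rho>. lebesgue_decomposition \<nu> \<mu> \<rho> \<mu>s)"

text \<open>In the two functionals below a divergent positive part gives \<open>\<infinity>\<close> even against a divergent
  negative part (\<open>\<infinity> - \<infinity> = \<infinity>\<close> in \<open>ereal\<close>); also \<open>\<infinity> * 0 = 0\<close>, so the singular term vanishes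
  for absolutely continuous \<open>\<mu>\<close>.\<close>

definition U_functional :: "(real \<Rightarrow> real) \<Rightarrow> 'a measure \<Rightarrow> 'a measure \<Rightarrow> ereal" where
  "U_functional U \<nu> \<mu> =
     (let \<rho> = ac_density \<nu> \<mu> in
        enn2ereal (\<integral>\<^sup>+x. ennreal (U (\<rho> x)) \<partial>\<nu>) - enn2ereal (\<integral>\<^sup>+x. ennreal (- U (\<rho> x)) \<partial>\<nu>))
     + slope_infinity U * enn2ereal (emeasure (singular_part \<nu> \<mu>) (space \<nu>))"

text \<open>\<open>U (r / b) * b\<close> for \<open>b \<in> (0, \<infinity>]\<close>; the value at \<open>b = \<infinity>\<close> is \<open>r * U'(0)\<close>, from the convention
  \<open>U(0) / 0 = U'(0)\<close>.  The convention for \<open>U(\<infinity>) / \<infinity>\<close> is not needed, as the density is real valued.\<close>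

definition distorted :: "(real \<Rightarrow> real) \<Rightarrow> real \<Rightarrow> ereal \<Rightarrow> ereal" where
  "distorted U r b =
     (if b = \<infinity> then ereal r * slope_zero U else ereal (U (r / real_of_ereal b) * real_of_ereal b))"

text \<open>A kernel \<open>\<kappa>\<close> with \<open>\<pi>(dx dy) = \<mu>(dx) \<kappa> x (dy)\<close>.  It is unique \<open>\<mu>\<close>-almost everywhere; in
  \<open>U_beta\<close> the points where it is arbitrary are those with \<open>\<rho> x = 0\<close>, where the integrand is \<open>0\<close>.\<close>

definition disintegration :: "('a \<times> 'a) measure \<Rightarrow> 'a measure \<Rightarrow> 'a \<Rightarrow> 'a measure" where
  "disintegration \<pi> \<mu> = (SOME \<kappa>. \<kappa> \<in> \<mu> \<rightarrow>\<^sub>M prob_algebra \<mu> \<and>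
     (\<forall>A\<in>sets (\<mu> \<Otimes>\<^sub>M \<mu>). emeasure \<pi> A = (\<integral>\<^sup>+x. emeasure (\<kappa> x) (Pair x -` A) \<partial>\<mu>)))"

definition U_beta ::
    "(real \<Rightarrow> real) \<Rightarrow> ('a \<Rightarrow> 'a \<Rightarrow> ereal) \<Rightarrow> ('a \<times> 'a) measure \<Rightarrow> 'a measure \<Rightarrow> 'a measure \<Rightarrow> ereal" where
  "U_beta U \<beta> \<pi> \<nu> \<mu> =
     (let \<rho> = ac_density \<nu> \<mu>; \<kappa> = disintegration \<pi> \<mu> in
        enn2ereal (\<integral>\<^sup>+x. (\<integral>\<^sup>+y. e2ennreal (distorted U (\<rho> x) (\<beta> x y)) \<partial>\<kappa> x) \<partial>\<nu>)
      - enn2ereal (\<integral>\<^sup>+x. (\<integral>\<^sup>+y. e2ennreal (- distorted U (\<rho> x) (\<beta> x y)) \<partial>\<kappa> x) \<partial>\<nu>))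
     + slope_infinity U * enn2ereal (emeasure (singular_part \<nu> \<mu>) (space \<nu>))"

definition diam_bound :: "real \<Rightarrow> real \<Rightarrow> real" where
  "diam_bound K N = pi * sqrt ((N - 1) / K)"

definition sKN :: "real \<Rightarrow> real \<Rightarrow> real \<Rightarrow> real" where
  "sKN K N r = sqrt ((N - 1) / K) * sin (r * sqrt (K / (N - 1)))"

definition beta_KN :: "('a \<Rightarrow> 'a \<Rightarrow> real) \<Rightarrow> real \<Rightarrow> real \<Rightarrow> real \<Rightarrow> 'a \<Rightarrow> 'a \<Rightarrow> ereal" where
  "beta_KN d K N t x y =
     (if t = 0 then 1
      else if d x y \<ge> diam_bound K N then \<infinity>
      else if x = y then 1
      else ereal ((sKN K N (t * d x y) / (t * sKN K N (d x y))) powr (N - 1)))"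

text \<open>\<open>\<beta>\<close> is a family of coefficients indexed by the dimension parameter; in the borderline case the
  functional at \<open>N\<close> is the limit of those at \<open>N' > N\<close>.\<close>

definition U_beta_KN :: "('a \<Rightarrow> 'a \<Rightarrow> real) \<Rightarrow> real \<Rightarrow> real \<Rightarrow> (real \<Rightarrow> real) \<Rightarrow>
    (real \<Rightarrow> 'a \<Rightarrow> 'a \<Rightarrow> ereal) \<Rightarrow> ('a \<times> 'a) measure \<Rightarrow> 'a measure \<Rightarrow> 'a measure \<Rightarrow> ereal" where
  "U_beta_KN d K N U \<beta> \<pi> \<nu> \<mu> =
     (if (SUP (x, y)\<in>UNIV. ereal (d x y)) = ereal (diam_bound K N)
      then Lim (at_right N) (\<lambda>N'. U_beta U (\<beta> N') \<pi> \<nu> \<mu>)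
      else U_beta U (\<beta> N) \<pi> \<nu> \<mu>)"

definition admissible_marginal :: "('a \<Rightarrow> 'a \<Rightarrow> real) \<Rightarrow> 'a measure \<Rightarrow> 'a measure \<Rightarrow> bool" where
  "admissible_marginal d \<nu> \<mu> \<longleftrightarrow> prob_space \<mu> \<and> sets \<mu> = sets (fwd_borel d) \<and>
     compactin (fwd_topology d) (msupp d \<mu>) \<and> msupp d \<mu> \<subseteq> msupp d \<nu>"

text \<open>Meant for \<open>K > 0\<close> and \<open>N > 1\<close>.\<close>

definition weak_CD :: "('a \<Rightarrow> 'a \<Rightarrow> real) \<Rightarrow> 'a measure \<Rightarrow> real \<Rightarrow> real \<Rightarrow> bool" where
  "weak_CD d \<nu> K N \<longleftrightarrow>
     forward_geodesic_space d \<and> forward_boundedly_compact d \<and>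
     locally_finite_borel_measure d \<nu> \<and> sigma_finite_measure \<nu> \<and>
     (\<forall>\<mu>0 \<mu>1. admissible_marginal d \<nu> \<mu>0 \<and> admissible_marginal d \<nu> \<mu>1 \<longrightarrow>
        (\<exists>\<mu> \<pi>. displacement_interpolation d \<mu> \<pi> \<and> \<mu> 0 = \<mu>0 \<and> \<mu> 1 = \<mu>1 \<and>
           (\<forall>U\<in>DC N. \<forall>t\<in>{0..1}.
              U_functional U \<nu> (\<mu> t) \<le>
                ereal (1 - t) * U_beta_KN d K N U (\<lambda>N'. beta_KN d K N' (1 - t)) \<pi> \<nu> \<mu>0
              + ereal t * U_beta_KN d K N U (\<lambda>N' x y. beta_KN d K N' t y x)
                  (distr \<pi> (fwd_borel d \<Otimes>\<^sub>M fwd_borel d) prod.swap) \<nu> \<mu>1)))"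

end

theory Submission
  imports Defs "HOL-Real_Asymp.Real_Asymp"
begin

text \<open>Write \<open>p = 1 - 1 / N\<close> and let \<open>m\<close> be the mass of \<open>S = supp \<nu>\<close>, finite by Bonnet-Myers.  Transport
  \<open>\<mu>\<^sub>0 = w \<nu> / m\<close> with \<open>w = 1 + \<epsilon> f\<close> to \<open>\<mu>\<^sub>1 = \<nu> / m\<close> and apply the curvature-dimension inequality to
  \<open>U(r) = - r\<^sup>p\<close>.  On the right, \<open>\<beta>\<^sub>t\<close> to the power \<open>1 / N\<close> is at least \<open>1 + K d\<^sup>2 (1 - t\<^sup>2) / (6 N)\<close>, also
  where it is infinite and also for every larger dimension parameter, so no limit has to be computed
  in the borderline case.  On the left, \<open>U\<close> lies above its tangent at the density of \<open>\<mu>\<^sub>0\<close>; this needs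
  \<open>\<mu>\<^sub>t\<close> to be absolutely continuous, which is the inequality for \<open>U(r) = r\<^sup>2\<close>.  The difference quotient
  in \<open>t\<close> of \<open>w(\<gamma>\<^sub>t)\<close> to the power \<open>- 1 / N\<close> is bounded by the descending slope of \<open>f\<close> times
  \<open>d(\<gamma>\<^sub>0, \<gamma>\<^sub>1)\<close>.  As \<open>t\<close> tends to 0 the terms quadratic in \<open>d(\<gamma>\<^sub>0, \<gamma>\<^sub>1)\<close> absorb that distance by
  AM-GM, and the terms of order \<open>\<epsilon>\<^sup>2\<close> are the claim.\<close>

section \<open>Distortion coefficients\<close>

text \<open>The sharp constant arises as follows. As t tends to 0, the factors (1 - t) (1 - (1 -
  t)^2) / t and 1 - t^2 tend to 2 and 1, so for small \<epsilon> the quadratic terms amount to 3 K /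
  (6 N) = K / (2 N) times the mean squared distance. The first order in \<epsilon> drops out because
  f has mean zero; the second order compares p / (2 N) times the integral of f^2 with (p / N)^2 / (4
  K / (2 N)) times the integral of the squared slope. The quotient is p / K = (N - 1) / (N K).

  Two obstacles shape the rest. The distorted functional is defined through a chosen density and a
  chosen kernel, so Lebesgue decompositions and disintegrations must be shown to exist before
  anything can be computed; as the distance is asymmetric, this passes through the symmetrised
  metric and a Borel coding of points by real numbers. Moreover the slope is a pointwise limit
  without uniformity, so the limits in t and \<epsilon> are taken with difference quotients at a
  fixed scale, and the scale is refined only at the end.\<close>

definition sine_ratio :: "real \<Rightarrow> real \<Rightarrow> real" where
  "sine_ratio t \<theta> = sin (t * \<theta>) / (t * sin \<theta>)"

text \<open>Euler's product for the sine, taken at the angles t \<theta> and \<theta> and divided.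
  It reduces every bound on the ratio to a bound on a single factor in u = (\<theta> / (k
  pi))^2.\<close>

lemma prod_tendsto_sine_ratio:
  assumes "0 < t" "0 < \<theta>" "\<theta> < pi"
  shows "(\<lambda>n. \<Prod>k=1..n. (1 - t\<^sup>2 * ((\<theta> / pi)\<^sup>2 / real k ^ 2)) / (1 - (\<theta> / pi)\<^sup>2 / real k ^ 2))
           \<longlonglongrightarrow> sine_ratio t \<theta>"
proof -
  have s: "sin \<theta> > 0" using assms by (simp add: sin_gt_zero)
  define x where "x = \<theta> / pi"
  have x: "x \<noteq> 0" "pi * x = \<theta>" using assms by (simp_all add: x_def)
  have sq: "(t * x)\<^sup>2 / (real k)\<^sup>2 = t\<^sup>2 * (x\<^sup>2 / (real k)\<^sup>2)" for k
    by (simp add: power_mult_distrib)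
  have eq: "(sin (pi * (t * x)) / (pi * (t * x))) / (sin (pi * x) / (pi * x)) = sine_ratio t \<theta>"
    using assms x s unfolding sine_ratio_def mult.left_commute[of pi] x(2) by (simp add: field_simps)
  have "(\<lambda>n. (\<Prod>k=1..n. 1 - (t * x)^2 / real k ^2) / (\<Prod>k=1..n. 1 - x^2 / real k ^2))
    \<longlonglongrightarrow> (sin (pi * (t * x)) / (pi * (t * x))) / (sin (pi * x) / (pi * x))"
    by (intro tendsto_divide sin_product_formula_real') (use assms x s in simp_all)
  then show ?thesis unfolding eq sq prod_dividef x_def[symmetric] .
qed

text \<open>Put v = (1 - t^2) u. Then (1 - v) (1 - t^2 u) exceeds 1 - u by v t^2 u \<ge> 0, so the
  reciprocal of the factor is at most 1 - v, hence at most exp (- v).\<close>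

lemma sine_factor_ge_exp:
  fixes t u :: real
  assumes "0 < t" "t < 1" "0 \<le> u" "u < 1"
  shows "exp ((1 - t\<^sup>2) * u) \<le> (1 - t\<^sup>2 * u) / (1 - u)"
proof -
  have t2: "t\<^sup>2 < 1" using assms by (simp add: abs_square_less_1)
  have pos: "0 < 1 - t\<^sup>2 * u" 
    using assms t2 by (smt (verit) mult_left_le_one_le zero_le_power2)
  let ?v = "(1 - t\<^sup>2) * u"
  have "1 - ?v \<le> exp (- ?v)" using exp_ge_add_one_self[of "- ?v"] by simp
  moreover have "(1 - u) / (1 - t\<^sup>2 * u) \<le> 1 - ?v"
  proof -
    have "(1 - ?v) * (1 - t\<^sup>2 * u) - (1 - u) = ?v * (t\<^sup>2 * u)" by (simp add: algebra_simps)
    also have "\<dots> \<ge> 0" using assms t2 by simp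
    finally show ?thesis using pos by (simp add: divide_le_eq)
  qed
  ultimately have "(1 - u) / (1 - t\<^sup>2 * u) \<le> exp (- ?v)" by linarith
  then have "1 - u \<le> exp (- ?v) * (1 - t\<^sup>2 * u)" using pos by (simp add: divide_le_eq)
  then have "(1 - u) * exp ?v \<le> exp (- ?v) * (1 - t\<^sup>2 * u) * exp ?v"
    by (intro mult_right_mono) auto
  also have "\<dots> = 1 - t\<^sup>2 * u" by (simp add: exp_minus)
  finally show ?thesis using assms by (simp add: le_divide_eq mult.commute)
qed

text \<open>The logarithm of the factor is convex in \<open>u\<close> and vanishes at \<open>0\<close>.\<close>

lemma sine_factor_le_powr:
  fixes t u l :: real
  assumes "0 < t" "t < 1" "0 \<le> u" "u < 1" "0 < l" "l \<le> 1"
  shows "(1 - t\<^sup>2 * (l * u)) / (1 - l * u) \<le> ((1 - t\<^sup>2 * u) / (1 - u)) powr l"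
proof -
  have t2: "t\<^sup>2 < 1" "0 < t\<^sup>2" using assms by (simp_all add: abs_square_less_1)
  have pos: "0 < 1 - t\<^sup>2 * v" if "0 \<le> v" "v < 1" for v
    using that t2 by (smt (verit) mult_left_le_one_le)
  define h where "h v = ln (1 - t\<^sup>2 * v) - ln (1 - v)" for v
  \<comment> \<open>The second derivative of \<open>h\<close> is the difference of the squares of
    \<open>1 / (1 - v)\<close> and \<open>t\<^sup>2 / (1 - t\<^sup>2 * v)\<close>, and the first of
    these is the larger.\<close>
  have conv: "convex_on {0..<1} h"
  proof (rule f''_ge0_imp_convex)
    show "convex {0..<1::real}" by simp
    fix v :: real assume v: "v \<in> {0..<1}"
    show "(h has_real_derivative (1 / (1 - v) - t\<^sup>2 / (1 - t\<^sup>2 * v))) (at v)"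
    proof -
      have "((\<lambda>v. ln (1 - t\<^sup>2 * v)) has_real_derivative (- t\<^sup>2) / (1 - t\<^sup>2 * v)) (at v)"
        by (rule derivative_eq_intros refl pos v | use v pos[of v] in force)+
      moreover have "((\<lambda>v. ln (1 - v)) has_real_derivative (- 1) / (1 - v)) (at v)"
        by (rule derivative_eq_intros refl | use v in force)+
      ultimately show ?thesis unfolding h_def by (rule DERIV_cong[OF DERIV_diff]) simp
    qed
    show "((\<lambda>v. 1 / (1 - v) - t\<^sup>2 / (1 - t\<^sup>2 * v)) has_real_derivative
        ((1 / (1 - v))\<^sup>2 - (t\<^sup>2 / (1 - t\<^sup>2 * v))\<^sup>2)) (at v)"
    proof -
      have "((\<lambda>v. t\<^sup>2 / (1 - t\<^sup>2 * v)) has_real_derivative (t\<^sup>2 / (1 - t\<^sup>2 * v))\<^sup>2) (at v)"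
        by (rule derivative_eq_intros refl | use v pos[of v] in \<open>force simp: power2_eq_square\<close>)+
      moreover have "((\<lambda>v. 1 / (1 - v)) has_real_derivative (1 / (1 - v))\<^sup>2) (at v)"
        by (rule derivative_eq_intros refl | use v in \<open>force simp: power2_eq_square\<close>)+
      ultimately show ?thesis by (intro DERIV_diff)
    qed
    have "t\<^sup>2 / (1 - t\<^sup>2 * v) \<le> 1 / (1 - v)"
      using v pos[of v] t2 by (simp add: field_simps)
    then show "0 \<le> (1 / (1 - v))\<^sup>2 - (t\<^sup>2 / (1 - t\<^sup>2 * v))\<^sup>2"
      using v pos[of v] by (simp add: power_mono)
  qed
  have "h ((1 - l) *\<^sub>R 0 + l *\<^sub>R u) \<le> (1 - l) * h 0 + l * h u"
    using assms by (intro convex_onD[OF conv]) auto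
  then have "h (l * u) \<le> l * h u" by (simp add: h_def)
  moreover have lu: "0 \<le> l * u" "l * u < 1" using assms
    by (auto, smt (verit) mult_left_le_one_le)
  have "exp (h (l * u)) = (1 - t\<^sup>2 * (l * u)) / (1 - l * u)"
    unfolding h_def using lu pos[OF lu] by (simp add: exp_diff)
  moreover have "exp (l * h u) = ((1 - t\<^sup>2 * u) / (1 - u)) powr l"
    using pos[of u] assms by (simp add: h_def powr_def ln_div)
  ultimately show ?thesis by (metis exp_le_cancel_iff)
qed

lemma sine_arg_bounds:
  assumes "0 < \<theta>" "\<theta> < pi" "1 \<le> k"
  shows "0 \<le> (\<theta> / pi)\<^sup>2 / real k ^ 2" "(\<theta> / pi)\<^sup>2 / real k ^ 2 < 1"
proof -
  have "pi * 1 \<le> pi * real k" using assms by (intro mult_left_mono) auto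
  then have "\<theta> < pi * real k" using assms by linarith
  then have "(\<theta> / (pi * real k)) < 1" "0 \<le> \<theta> / (pi * real k)" using assms by (auto simp: field_simps)
  then have "(\<theta> / (pi * real k))^2 < 1" unfolding abs_square_less_1 by linarith
  then show "(\<theta> / pi)\<^sup>2 / real k ^ 2 < 1" by (simp add: power_divide power_mult_distrib)
qed simp

text \<open>The factor bounds multiply to the exponential of (1 - t^2) (\<theta> / pi)^2 times a
  partial sum of 1 / k^2. The Basel sum pi^2 / 6 is the origin of the 6 in all later
  constants.\<close>

lemma sine_ratio_ge_exp:
  assumes "0 < t" "t < 1" "0 < \<theta>" "\<theta> < pi"
  shows "exp ((1 - t\<^sup>2) * \<theta>\<^sup>2 / 6) \<le> sine_ratio t \<theta>"
proof (rule LIMSEQ_le[OF _ prod_tendsto_sine_ratio[OF assms(1,3,4)]])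
  have "(\<lambda>n. \<Sum>k<n. 1 / (real k + 1)\<^sup>2) \<longlonglongrightarrow> pi\<^sup>2 / 6"
    using inverse_squares_sums by (simp add: sums_def add.commute)
  then have "(\<lambda>n. (1 - t\<^sup>2) * ((\<theta> / pi)\<^sup>2 * (\<Sum>k<n. 1 / (real k + 1)\<^sup>2)))
      \<longlonglongrightarrow> (1 - t\<^sup>2) * ((\<theta> / pi)\<^sup>2 * (pi\<^sup>2 / 6))" by (intro tendsto_intros)
  also have "(\<lambda>n. (1 - t\<^sup>2) * ((\<theta> / pi)\<^sup>2 * (\<Sum>k<n. 1 / (real k + 1)\<^sup>2)))
     = (\<lambda>n. \<Sum>k=1..n. (1 - t\<^sup>2) * ((\<theta> / pi)\<^sup>2 / real k ^ 2))"
    unfolding sum_distrib_left One_nat_def sum.atLeast1_atMost_eq by (simp add: add.commute)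
  also have "(1 - t\<^sup>2) * ((\<theta> / pi)\<^sup>2 * (pi\<^sup>2 / 6)) = (1 - t\<^sup>2) * \<theta>\<^sup>2 / 6" by (simp add: field_simps)
  finally show "(\<lambda>n. exp (\<Sum>k=1..n. (1 - t\<^sup>2) * ((\<theta> / pi)\<^sup>2 / real k ^ 2)))
      \<longlonglongrightarrow> exp ((1 - t\<^sup>2) * \<theta>\<^sup>2 / 6)" by (rule tendsto_exp)
  have "exp (\<Sum>k=1..n. (1 - t\<^sup>2) * ((\<theta> / pi)\<^sup>2 / real k ^ 2))
      \<le> (\<Prod>k=1..n. (1 - t\<^sup>2 * ((\<theta> / pi)\<^sup>2 / real k ^ 2)) / (1 - (\<theta> / pi)\<^sup>2 / real k ^ 2))" for n
    unfolding exp_sum[OF finite_atLeastAtMost]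
    using assms sine_arg_bounds[OF assms(3,4)] by (intro prod_mono conjI sine_factor_ge_exp) auto
  then show "\<exists>N. \<forall>n\<ge>N. exp (\<Sum>k=1..n. (1 - t\<^sup>2) * ((\<theta> / pi)\<^sup>2 / real k ^ 2))
      \<le> (\<Prod>k=1..n. (1 - t\<^sup>2 * ((\<theta> / pi)\<^sup>2 / real k ^ 2)) / (1 - (\<theta> / pi)\<^sup>2 / real k ^ 2))"
    by (intro exI allI impI)
qed

text \<open>Scaling the angle by sqrt l scales every u = (\<theta> / (k pi))^2 by l, so the estimate
  holds factor by factor. With l = (N - 1) / (N' - 1) it compares the coefficients of two dimension
  parameters.\<close>

lemma sine_ratio_sqrt_le_powr:
  assumes "0 < t" "t < 1" "0 < \<theta>" "\<theta> < pi" "0 < l" "l \<le> 1"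
  shows "sine_ratio t (sqrt l * \<theta>) \<le> sine_ratio t \<theta> powr l"
proof -
  have sl: "0 < sqrt l" "sqrt l \<le> 1" using assms by auto
  have th: "0 < sqrt l * \<theta>" "sqrt l * \<theta> < pi"
    using assms sl by (auto intro: le_less_trans[OF mult_left_le_one_le])
  let ?u = "\<lambda>k. (\<theta> / pi)\<^sup>2 / real k ^ 2"
  note ub = sine_arg_bounds[OF assms(3,4)]
  have eq: "(sqrt l * \<theta> / pi)\<^sup>2 / real k ^ 2 = l * ?u k" for k
    using assms by (simp add: power_mult_distrib power_divide)
  have fpos: "0 < (1 - t\<^sup>2 * ?u k) / (1 - ?u k)" if "1 \<le> k" for k
    using sine_factor_ge_exp[OF assms(1,2) ub[OF that]] by (smt (verit) exp_gt_zero)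
  have l1: "(\<lambda>n. \<Prod>k=1..n. (1 - t\<^sup>2 * (l * ?u k)) / (1 - l * ?u k)) \<longlonglongrightarrow> sine_ratio t (sqrt l * \<theta>)"
    using prod_tendsto_sine_ratio[OF assms(1) th] unfolding eq .
  have "sine_ratio t \<theta> > 0" using sine_ratio_ge_exp[OF assms(1-4)] by (smt (verit) exp_gt_zero)
  then have l2: "(\<lambda>n. (\<Prod>k=1..n. (1 - t\<^sup>2 * ?u k) / (1 - ?u k)) powr l) \<longlonglongrightarrow> sine_ratio t \<theta> powr l"
    by (intro tendsto_powr[OF prod_tendsto_sine_ratio[OF assms(1,3,4)]]) auto
  have "(\<Prod>k=1..n. (1 - t\<^sup>2 * (l * ?u k)) / (1 - l * ?u k))
      \<le> (\<Prod>k=1..n. (1 - t\<^sup>2 * ?u k) / (1 - ?u k)) powr l" for n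
  proof -
    have "0 \<le> (1 - t\<^sup>2 * (l * ?u k)) / (1 - l * ?u k)" if "1 \<le> k" for k
    proof -
      have "exp ((1 - t\<^sup>2) * (l * ?u k)) \<le> (1 - t\<^sup>2 * (l * ?u k)) / (1 - l * ?u k)"
        using sine_arg_bounds[OF th that] unfolding eq by (intro sine_factor_ge_exp assms) auto
      then show ?thesis by (smt (verit) exp_gt_zero)
    qed
    then have "(\<Prod>k=1..n. (1 - t\<^sup>2 * (l * ?u k)) / (1 - l * ?u k))
        \<le> (\<Prod>k=1..n. ((1 - t\<^sup>2 * ?u k) / (1 - ?u k)) powr l)"
      using ub assms by (intro prod_mono conjI sine_factor_le_powr) auto
    also have "\<dots> = (\<Prod>k=1..n. (1 - t\<^sup>2 * ?u k) / (1 - ?u k)) powr l"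
      by (rule prod_powr_distrib[symmetric])
    finally show ?thesis .
  qed
  then show ?thesis using LIMSEQ_le[OF l1 l2] by blast
qed

text \<open>Curvature and dimension enter only through the angle d sqrt (K / (N - 1)), which is
  below pi exactly when d is below the diameter bound, and through the exponent.\<close>

lemma beta_KN_eq_sine_ratio:
  assumes "0 < K" "1 < N" "0 < t" "0 < d x y" "x \<noteq> y" "d x y < diam_bound K N"
  shows "beta_KN d K N t x y = ereal (sine_ratio t (d x y * sqrt (K / (N - 1))) powr (N - 1))"
proof -
  define c where "c = sqrt ((N - 1) / K)"
  define q where "q = sqrt (K / (N - 1))"
  have "c \<noteq> 0" using assms by (simp add: c_def)
  then have "c * sin (t * d x y * q) / (t * (c * sin (d x y * q))) = sine_ratio t (d x y * q)"
    by (simp add: sine_ratio_def mult.assoc)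
  moreover have "beta_KN d K N t x y = ereal ((sKN K N (t * d x y) / (t * sKN K N (d x y))) powr (N - 1))"
    using assms by (simp add: beta_KN_def)
  ultimately show ?thesis unfolding sKN_def c_def q_def by simp
qed

lemma diam_bound_iff:
  assumes "0 < K" "1 < N"
  shows "r < diam_bound K N \<longleftrightarrow> r * sqrt (K / (N - 1)) < pi"
  using assms by (simp add: diam_bound_def real_sqrt_divide field_simps)

text \<open>The exponent N - 1 cancels the N - 1 in the denominator of the squared angle, so N does
  not occur in the bound. This is what allows it to be applied to all N' \<ge> N at once.\<close>

lemma beta_KN_lower_bound:
  assumes "irreversible_metric d" "0 < K" "1 < N" "0 < t" "t < 1" "beta_KN d K N t x y \<noteq> \<infinity>"
  obtains b where "beta_KN d K N t x y = ereal b" "exp (K * (d x y)\<^sup>2 * (1 - t\<^sup>2) / 6) \<le> b"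
proof (cases "x = y")
  case True
  then have "d x y = 0" using assms(1) by (simp add: irreversible_metric_def)
  moreover have "0 < diam_bound K N" using assms by (simp add: diam_bound_def)
  ultimately show ?thesis using True assms that[of 1] by (simp add: beta_KN_def one_ereal_def)
next
  case False
  then have d: "0 < d x y" using assms(1) unfolding irreversible_metric_def by (metis less_eq_real_def)
  have lt: "d x y < diam_bound K N" using assms(4,6) by (auto simp: beta_KN_def split: if_splits)
  let ?th = "d x y * sqrt (K / (N - 1))"
  have th: "0 < ?th" "?th < pi" using d lt assms by (auto simp: diam_bound_iff)
  have "exp (K * (d x y)\<^sup>2 * (1 - t\<^sup>2) / 6) = exp ((1 - t\<^sup>2) * ?th\<^sup>2 / 6) powr (N - 1)"
    unfolding exp_powr_real power_mult_distrib using assms by (simp add: divide_simps)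
  also have "\<dots> \<le> sine_ratio t ?th powr (N - 1)"
    using assms by (intro powr_mono2 sine_ratio_ge_exp th) auto
  finally show ?thesis using beta_KN_eq_sine_ratio[of K N t d x y, OF assms(2-4) d False lt] that by blast
qed

text \<open>Passing to N' scales the angle by sqrt l with l = (N - 1) / (N' - 1), and raising to N'
  - 1 turns the power l into N - 1. The monotonicity in the dimension is what makes the limit in the
  borderline case exist.\<close>

lemma beta_KN_antimono:
  assumes "irreversible_metric d" "0 < K" "1 < N" "N \<le> N'" "0 < t" "t < 1" "d x y < diam_bound K N"
  shows "beta_KN d K N' t x y \<le> beta_KN d K N t x y"
proof (cases "x = y")
  case True
  then have "d x y = 0" using assms(1) by (simp add: irreversible_metric_def)
  moreover have "0 < diam_bound K N" "0 < diam_bound K N'" using assms by (simp_all add: diam_bound_def)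
  ultimately show ?thesis using True assms by (simp add: beta_KN_def)
next
  case False
  then have d: "0 < d x y" using assms(1) unfolding irreversible_metric_def by (metis less_eq_real_def)
  let ?th = "d x y * sqrt (K / (N - 1))" and ?l = "(N - 1) / (N' - 1)"
  have th: "0 < ?th" "?th < pi" using d assms by (auto simp: diam_bound_iff)
  have l: "0 < ?l" "?l \<le> 1" using assms by auto
  have eq: "d x y * sqrt (K / (N' - 1)) = sqrt ?l * ?th"
    using assms by (simp add: real_sqrt_divide)
  have "sqrt ?l * ?th \<le> ?th" using th l by (intro mult_left_le_one_le) auto
  then have lt': "d x y < diam_bound K N'" using assms th unfolding diam_bound_iff[OF assms(2) less_le_trans[OF assms(3,4)]] eq by linarith
  have "0 \<le> sine_ratio t (sqrt ?l * ?th)"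
    using sine_ratio_ge_exp[of t "sqrt ?l * ?th"] assms th l \<open>sqrt ?l * ?th \<le> ?th\<close>
    by (smt (verit) exp_gt_zero mult_pos_pos real_sqrt_gt_zero)
  then have "sine_ratio t (sqrt ?l * ?th) powr (N' - 1) \<le> (sine_ratio t ?th powr ?l) powr (N' - 1)"
    using assms l th by (intro powr_mono2 sine_ratio_sqrt_le_powr) auto
  also have "\<dots> = sine_ratio t ?th powr (N - 1)" using assms by (simp add: powr_powr)
  finally show ?thesis
    using beta_KN_eq_sine_ratio[of K N t d x y, OF assms(2,3,5) d False assms(7)]
      beta_KN_eq_sine_ratio[of K N' t d x y, OF assms(2) _ assms(5) d False lt'] assms eq by simp
qed

section \<open>Disintegration over the real line\<close>

text \<open>The hypothesis is tested on the set where g < f; the finite integral of g makes the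
  subtraction legitimate.\<close>

lemma AE_le_of_set_nn_integral_le:
  fixes f g :: "'a \<Rightarrow> ennreal"
  assumes [measurable]: "f \<in> borel_measurable M" "g \<in> borel_measurable M"
    and fin: "(\<integral>\<^sup>+x. g x \<partial>M) \<noteq> \<infinity>"
    and le: "\<And>A. A \<in> sets M \<Longrightarrow> (\<integral>\<^sup>+x\<in>A. f x \<partial>M) \<le> (\<integral>\<^sup>+x\<in>A. g x \<partial>M)"
  shows "AE x in M. f x \<le> g x"
proof -
  define B where "B = {x \<in> space M. g x < f x}"
  have [measurable]: "B \<in> sets M" unfolding B_def by measurable
  have "(\<integral>\<^sup>+x\<in>B. g x \<partial>M) \<le> (\<integral>\<^sup>+x. g x \<partial>M)" by (intro nn_integral_mono) (auto simp: indicator_def)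
  then have finB: "(\<integral>\<^sup>+x\<in>B. g x \<partial>M) \<noteq> \<infinity>" using fin by (auto simp: top_unique)
  have "(\<integral>\<^sup>+x. f x * indicator B x - g x * indicator B x \<partial>M)
      = (\<integral>\<^sup>+x\<in>B. f x \<partial>M) - (\<integral>\<^sup>+x\<in>B. g x \<partial>M)"
    using finB by (intro nn_integral_diff) (auto simp: B_def indicator_def)
  also have "\<dots> = 0" using le[of B] finB by (simp add: diff_eq_0_iff_ennreal less_top)
  finally have "AE x in M. f x * indicator B x - g x * indicator B x = 0"
    by (subst (asm) nn_integral_0_iff_AE) auto
  then show ?thesis
  proof (rule AE_mp, intro AE_I2 impI)
    fix x assume x: "x \<in> space M" "f x * indicator B x - g x * indicator B x = 0"
    show "f x \<le> g x"
    proof (rule ccontr)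
      assume "\<not> f x \<le> g x"
      then have "x \<in> B" using x by (simp add: B_def)
      then show False using x(2) \<open>\<not> f x \<le> g x\<close> by (simp add: diff_eq_0_iff_ennreal)
    qed
  qed
qed

lemma ennreal_enn2real_le_1: "x \<le> 1 \<Longrightarrow> ennreal (enn2real x) = x"
  by (metis ennreal_enn2real ennreal_one_less_top order_le_less_trans)

text \<open>Meant for c = 1 - e with arbitrary e > 0, so c may be negative. Then
  \<open>ennreal c\<close> is 0, which explains the \<open>max 0 c\<close>.\<close>

lemma contraction_imp_zero:
  assumes "ennreal m \<le> ennreal c * ennreal m" "0 \<le> m" "c < 1"
  shows "m = 0"
proof (rule ccontr)
  assume "m \<noteq> 0"
  then have m: "0 < m" using assms by simp
  have "ennreal c * ennreal m = ennreal (max 0 c * m)"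
    using assms by (cases "0 \<le> c") (auto simp: max_def ennreal_mult ennreal_neg)
  then have "m \<le> max 0 c * m" using assms(1) m by (simp add: ennreal_le_iff)
  also have "\<dots> < 1 * m" using m assms by (intro mult_strict_right_mono) auto
  finally show False by simp
qed

section \<open>Distribution functions from their values at rational points\<close>

definition dyadic_above :: "nat \<Rightarrow> real \<Rightarrow> real" where
  "dyadic_above n r = (of_int \<lfloor>r * 2 ^ n\<rfloor> + 1) / 2 ^ n"

lemma dyadic_above_Rats: "dyadic_above n r \<in> \<rat>"
  by (simp add: dyadic_above_def)

text \<open>Strictness matters at points r that are themselves dyadic: values along this sequence
  then converge to the right limit at r and never sample r itself.\<close>

lemma dyadic_above_gt: "r < dyadic_above n r"
  unfolding dyadic_above_def by (simp add: less_divide_eq floor_less_iff)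

lemma dyadic_above_le: "dyadic_above n r \<le> r + (1 / 2) ^ n"
proof -
  have "of_int \<lfloor>r * 2 ^ n\<rfloor> + 1 \<le> r * 2 ^ n + 1" by simp
  then have "dyadic_above n r \<le> (r * 2 ^ n + 1) / 2 ^ n"
    unfolding dyadic_above_def by (intro divide_right_mono) auto
  also have "\<dots> = r + (1 / 2) ^ n" by (simp add: field_simps power_divide)
  finally show ?thesis .
qed

lemma dyadic_above_Suc_le: "dyadic_above (Suc n) r \<le> dyadic_above n r"
proof -
  have "r * 2 ^ Suc n < 2 * of_int \<lfloor>r * 2 ^ n\<rfloor> + 2"
    using floor_correct[of "r * 2 ^ n"] power_Suc[of "2::real" n] by (simp add: algebra_simps)
  then have "\<lfloor>r * 2 ^ Suc n\<rfloor> < 2 * \<lfloor>r * 2 ^ n\<rfloor> + 2"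
    by (simp add: floor_less_iff)
  then have "real_of_int (\<lfloor>r * 2 ^ Suc n\<rfloor> + 1) \<le> of_int (2 * (\<lfloor>r * 2 ^ n\<rfloor> + 1))"
    unfolding of_int_le_iff by simp
  then have "of_int \<lfloor>r * 2 ^ Suc n\<rfloor> + 1 \<le> 2 * (of_int \<lfloor>r * 2 ^ n\<rfloor> + 1 :: real)"
    by (simp only: of_int_add of_int_mult of_int_1 of_int_numeral)
  then have "(of_int \<lfloor>r * 2 ^ Suc n\<rfloor> + 1) / 2 ^ Suc n \<le> 2 * (of_int \<lfloor>r * 2 ^ n\<rfloor> + 1 :: real) / 2 ^ Suc n"
    by (intro divide_right_mono) auto
  moreover have "2 * y / 2 ^ Suc n = y / 2 ^ n" for y :: real by simp
  ultimately show ?thesis unfolding dyadic_above_def by metis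
qed

lemma decseq_dyadic_above: "decseq (\<lambda>n. dyadic_above n r)"
  by (intro decseq_SucI dyadic_above_Suc_le)

lemma dyadic_above_eventually_less:
  assumes "r < s" shows "\<exists>n. dyadic_above n r \<le> s"
proof -
  obtain n where "(1 / 2) ^ n < s - r" using real_arch_pow_inv[of "s - r" "1/2"] assms by auto
  then show ?thesis using dyadic_above_le[of n r] by (intro exI[of _ n]) linarith
qed

lemma INT_atMost_dyadic_above: "(\<Inter>n. {..dyadic_above n r}) = {..r}"
proof (intro equalityI subsetI)
  fix x assume x: "x \<in> (\<Inter>n. {..dyadic_above n r})"
  show "x \<in> {..r}"
  proof (rule ccontr)
    assume "x \<notin> {..r}"
    then have "r < (r + x) / 2" "(r + x) / 2 < x" by auto
    then obtain n where "dyadic_above n r \<le> (r + x) / 2" using dyadic_above_eventually_less by blast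
    moreover have "x \<le> dyadic_above n r" using x by blast
    ultimately show False using \<open>(r + x) / 2 < x\<close> by linarith
  qed
qed (use less_imp_le[OF dyadic_above_gt] in \<open>auto intro: order_trans\<close>)

text \<open>For F nondecreasing on the rationals this is the right limit at r; only values of F at
  dyadic rationals enter.\<close>

definition right_envelope :: "(real \<Rightarrow> real) \<Rightarrow> real \<Rightarrow> real" where
  "right_envelope F r = (INF n. F (dyadic_above n r))"

text \<open>Every clause ranges over countably many parameters. Hence it holds almost everywhere for
  a family of functions as soon as each instance does, and the points where it holds form a
  measurable set.\<close>

definition rational_cdf :: "(real \<Rightarrow> real) \<Rightarrow> bool" where
  "rational_cdf F \<longleftrightarrow> (\<forall>q\<in>\<rat>. 0 \<le> F q \<and> F q \<le> 1) \<and> (\<forall>q\<in>\<rat>. \<forall>q'\<in>\<rat>. q \<le> q' \<longrightarrow> F q \<le> F q') \<and>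
     (\<forall>e\<in>\<rat>. 0 < e \<longrightarrow> (\<exists>n::nat. F (- real n) < e)) \<and> (\<forall>e\<in>\<rat>. 0 < e \<longrightarrow> (\<exists>n::nat. 1 - e < F (real n)))"

text \<open>These are the hypotheses under which \<open>interval_measure\<close> yields a
  probability measure with the given distribution function; convergence along the dyadics is added
  because it gives measurability in a parameter.\<close>

lemma right_envelope_props:
  assumes F: "rational_cdf F"
  shows "mono (right_envelope F)" "continuous (at_right a) (right_envelope F)"
    "(right_envelope F \<longlongrightarrow> 0) at_bot" "(right_envelope F \<longlongrightarrow> 1) at_top"
    "0 \<le> right_envelope F a"  "(\<lambda>n. F (dyadic_above n a)) \<longlonglongrightarrow> right_envelope F a"
proof -
  have F01: "0 \<le> F q" "F q \<le> 1" if "q \<in> \<rat>" for q using F that by (auto simp: rational_cdf_def)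
  have Fm: "F q \<le> F q'" if "q \<in> \<rat>" "q' \<in> \<rat>" "q \<le> q'" for q q' using F that by (auto simp: rational_cdf_def)
  have bb: "bdd_below (range (\<lambda>n. F (dyadic_above n r)))" for r
    by (intro bdd_belowI2[of _ 0] F01 dyadic_above_Rats)
  have upper: "right_envelope F r \<le> F q" if "q \<in> \<rat>" "r < q" for r q
  proof -
    obtain n where "dyadic_above n r \<le> q" using dyadic_above_eventually_less \<open>r < q\<close> by blast
    then have "F (dyadic_above n r) \<le> F q" using that by (intro Fm dyadic_above_Rats) auto
    then show ?thesis unfolding right_envelope_def by (intro cINF_lower2[OF bb, of n]) auto
  qed
  have lower: "c \<le> right_envelope F r" if "\<And>n. c \<le> F (dyadic_above n r)" for r c
    unfolding right_envelope_def by (intro cINF_greatest that) auto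
  have lowerq: "F q \<le> right_envelope F r" if "q \<in> \<rat>" "q \<le> r" for r q
    using that dyadic_above_gt[of r] by (intro lower Fm dyadic_above_Rats) (auto intro: order_trans less_imp_le)
  show nn: "0 \<le> right_envelope F a" for a by (intro lower F01 dyadic_above_Rats)
  have le1: "right_envelope F r \<le> 1" for r
    using upper[OF dyadic_above_Rats dyadic_above_gt[of r 0]] F01(2)[OF dyadic_above_Rats[of 0 r]] by linarith
  show mono: "mono (right_envelope F)"
  proof (rule monoI, cases)
    fix x y :: real assume "x \<le> y"
    then show "right_envelope F x \<le> right_envelope F y"
      using dyadic_above_gt[of y] by (intro lower upper dyadic_above_Rats) (auto intro: le_less_trans)
  qed auto
  have close: "\<exists>q\<in>\<rat>. r < q \<and> F q < right_envelope F r + e" if "e > 0" for r e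
  proof -
    have "(INF n. F (dyadic_above n r)) < right_envelope F r + e" using that by (simp add: right_envelope_def)
    then obtain n where "F (dyadic_above n r) < right_envelope F r + e"
      using bb by (subst (asm) cINF_less_iff) auto
    then show ?thesis using dyadic_above_Rats dyadic_above_gt by blast
  qed
  show "continuous (at_right a) (right_envelope F)"
    unfolding continuous_within
  proof (rule order_tendstoI)
    fix c assume "c < right_envelope F a"
    then show "\<forall>\<^sub>F x in at_right a. c < right_envelope F x"
      using monoD[OF mono, of a] by (auto simp: eventually_at_filter intro!: always_eventually intro: less_le_trans)
  next
    fix c assume "right_envelope F a < c"
    then obtain q where q: "q \<in> \<rat>" "a < q" "F q < c" using close[of "c - right_envelope F a" a] by auto
    then show "\<forall>\<^sub>F x in at_right a. right_envelope F x < c"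
      unfolding eventually_at_right_field using upper[OF q(1)] by (intro exI[of _ q]) (auto intro: le_less_trans)
  qed
  show "(right_envelope F \<longlongrightarrow> 0) at_bot"
  proof (rule order_tendstoI)
    fix c :: real assume "0 < c"
    then obtain e where e: "e \<in> \<rat>" "0 < e" "e < c" using Rats_dense_in_real by blast
    then obtain n where "F (- real n) < e" using F unfolding rational_cdf_def by blast
    then show "\<forall>\<^sub>F x in at_bot. right_envelope F x < c"
      unfolding eventually_at_bot_dense using upper[of "- real n"] e
      by (intro exI[of _ "- real n"]) (auto intro: le_less_trans less_trans)
  qed (use nn in \<open>auto intro!: always_eventually intro: less_le_trans\<close>)
  show "(right_envelope F \<longlongrightarrow> 1) at_top"
  proof (rule order_tendstoI)
    fix c :: real assume "c < 1"
    then obtain e where e: "e \<in> \<rat>" "0 < e" "e < 1 - c" using Rats_dense_in_real[of 0 "1 - c"] by auto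
    then obtain n where "1 - e < F (real n)" using F unfolding rational_cdf_def by blast
    then have "c < F (real n)" using e by linarith
    then show "\<forall>\<^sub>F x in at_top. c < right_envelope F x"
      unfolding eventually_at_top_linorder using lowerq[of "real n"]
      by (intro exI[of _ "real n"]) (auto intro: less_le_trans)
  qed (use le1 in \<open>auto intro!: always_eventually intro: le_less_trans\<close>)
  have "decseq (\<lambda>n. F (dyadic_above n a))"
    by (intro decseq_SucI Fm dyadic_above_Rats dyadic_above_Suc_le)
  then show "(\<lambda>n. F (dyadic_above n a)) \<longlonglongrightarrow> right_envelope F a"
    unfolding right_envelope_def by (intro LIMSEQ_decseq_INF bb)
qed

text \<open>The conditional distribution functions are Radon-Nikodym derivatives, corrected on a null set
  and made right continuous along dyadic rationals.\<close>

lemma real_disintegration: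
  fixes M :: "('a \<times> real) measure" and \<mu> :: "'a measure"
  assumes \<mu>: "prob_space \<mu>" and sM: "sets M = sets (\<mu> \<Otimes>\<^sub>M borel)" and marg: "distr M \<mu> fst = \<mu>"
  shows "\<exists>\<kappa>\<in>\<mu> \<rightarrow>\<^sub>M prob_algebra borel. \<forall>A\<in>sets (\<mu> \<Otimes>\<^sub>M borel).
     emeasure M A = (\<integral>\<^sup>+x. emeasure (\<kappa> x) (Pair x -` A) \<partial>\<mu>)"
proof -
  interpret \<mu>: prob_space \<mu> by fact
  note sM[measurable_cong]
  have spM: "space M = space \<mu> \<times> UNIV" using sets_eq_imp_space_eq[OF sM] by (simp add: space_pair_measure)
  have fstM[measurable]: "fst \<in> M \<rightarrow>\<^sub>M \<mu>" and sndM[measurable]: "snd \<in> borel_measurable M"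
    by (simp_all add: measurable_cong_sets[OF sM refl])
  have M_rect: "emeasure M (A \<times> UNIV) = emeasure \<mu> A" if "A \<in> sets \<mu>" for A
  proof -
    have "emeasure \<mu> A = emeasure (distr M \<mu> fst) A" by (simp add: marg)
    also have "\<dots> = emeasure M (fst -` A \<inter> space M)" using that by (simp add: emeasure_distr)
    also have "fst -` A \<inter> space M = A \<times> UNIV" using sets.sets_into_space[OF that] spM by auto
    finally show ?thesis by simp
  qed
  interpret M: prob_space M
    using M_rect[of "space \<mu>"] by (intro prob_spaceI) (simp add: spM \<mu>.emeasure_space_1)
  \<comment> \<open>\<open>R r\<close> sends A to the mass of A \<times> {..r} and is dominated by
    \<mu>; its density \<open>f r\<close> is a version of the conditional distribution function at
    r.\<close>
  define R where "R r = distr (density M (\<lambda>z. indicator {..r} (snd z))) \<mu> fst" for r :: real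
  have R: "emeasure (R r) A = emeasure M (A \<times> {..r})" if A[measurable]: "A \<in> sets \<mu>" for r A
  proof -
    have "emeasure (R r) A = (\<integral>\<^sup>+z. indicator {..r} (snd z) * indicator (fst -` A \<inter> space M) z \<partial>M)"
      unfolding R_def by (simp add: emeasure_distr emeasure_density)
    also have "\<dots> = (\<integral>\<^sup>+z. indicator (A \<times> {..r}) z \<partial>M)"
      by (intro nn_integral_cong) (auto simp: indicator_def)
    also have "\<dots> = emeasure M (A \<times> {..r})"
      using A by (intro nn_integral_indicator) (auto simp: sM)
    finally show ?thesis .
  qed
  have [measurable]: "A \<times> {..r} \<in> sets M" if "A \<in> sets \<mu>" for A and r :: real using that by (auto simp: sM)
  have sR: "sets (R r) = sets \<mu>" for r by (simp add: R_def)
  have R_le: "emeasure (R r) A \<le> emeasure \<mu> A" if "A \<in> sets \<mu>" for r A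
    using that unfolding R[OF that] M_rect[OF that, symmetric] by (intro emeasure_mono) (auto simp: sM)
  define f where "f r = RN_deriv \<mu> (R r)" for r
  have [measurable]: "f r \<in> borel_measurable \<mu>" for r unfolding f_def by simp
  have ac: "absolutely_continuous \<mu> (R r)" for r
    unfolding absolutely_continuous_def
    by (auto simp: null_sets_def sR) (metis R_le le_zero_eq)
  have f: "(\<integral>\<^sup>+x\<in>A. f r x \<partial>\<mu>) = emeasure M (A \<times> {..r})" if "A \<in> sets \<mu>" for A r
    using that \<mu>.density_RN_deriv[OF ac sR, of r] unfolding f_def R[OF that, symmetric]
    by (simp add: emeasure_density[symmetric])
  have f_space: "(\<integral>\<^sup>+x. f r x \<partial>\<mu>) = emeasure M (space \<mu> \<times> {..r})" for r
    unfolding f[OF sets.top, symmetric] by (intro nn_integral_cong) auto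
  have f_fin: "(\<integral>\<^sup>+x. f r x \<partial>\<mu>) \<noteq> \<infinity>" for r unfolding f_space by simp
  have f1: "AE x in \<mu>. f r x \<le> 1" for r
  proof (rule AE_le_of_set_nn_integral_le)
    fix A assume A: "A \<in> sets \<mu>"
    show "(\<integral>\<^sup>+x\<in>A. f r x \<partial>\<mu>) \<le> (\<integral>\<^sup>+x\<in>A. 1 \<partial>\<mu>)"
      unfolding f[OF A] using R_le[OF A, of r] R[OF A, of r] A by simp
  qed (auto simp: \<mu>.emeasure_space_1)
  have fm: "AE x in \<mu>. f r x \<le> f s x" if "r \<le> s" for r s
  proof (rule AE_le_of_set_nn_integral_le)
    fix A assume A: "A \<in> sets \<mu>"
    show "(\<integral>\<^sup>+x\<in>A. f r x \<partial>\<mu>) \<le> (\<integral>\<^sup>+x\<in>A. f s x \<partial>\<mu>)"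
      unfolding f[OF A] using A that by (intro emeasure_mono) auto
  qed (use f_fin in auto)
  define F where "F x r = enn2real (f r x)" for x r
  have [measurable]: "(\<lambda>x. F x r) \<in> borel_measurable \<mu>" for r unfolding F_def by measurable
  have aeq: "AE x in \<mu>. \<forall>q\<in>\<rat>. f q x \<le> 1 \<and> (\<forall>q'\<in>\<rat>. q \<le> q' \<longrightarrow> f q x \<le> f q' x)"
  proof (intro AE_ball_countable[THEN iffD2] ballI countable_rat AE_conjI f1)
    fix q q' :: real
    show "AE x in \<mu>. q \<le> q' \<longrightarrow> f q x \<le> f q' x" using fm[of q q'] by (cases "q \<le> q'") auto
  qed
  \<comment> \<open>On the set where the values at all - n stay above e, Markov's inequality bounds
    e times its mass by the mass of a strip that shrinks to the empty set.\<close>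
  have aebot: "AE x in \<mu>. \<exists>n::nat. F x (- real n) < e" if e: "0 < e" for e
  proof -
    let ?B = "{x \<in> space \<mu>. \<forall>n::nat. e \<le> F x (- real n)}"
    have [measurable]: "?B \<in> sets \<mu>" by measurable
    have "ennreal e * emeasure \<mu> ?B \<le> emeasure M (space \<mu> \<times> {..- real n})" for n
    proof -
      have "ennreal e * emeasure \<mu> ?B = (\<integral>\<^sup>+x. ennreal e * indicator ?B x \<partial>\<mu>)"
        by (simp add: nn_integral_cmult_indicator)
      also have "\<dots> \<le> (\<integral>\<^sup>+x. f (- real n) x \<partial>\<mu>)"
      proof (rule nn_integral_mono_AE, use f1[of "- real n"] in eventually_elim)
        case (elim x)
        then have "ennreal (F x (- real n)) = f (- real n) x" by (simp add: F_def ennreal_enn2real_le_1)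
        then show ?case using ennreal_leI[of e "F x (- real n)"] by (auto simp: indicator_def)
      qed
      finally show ?thesis unfolding f_space .
    qed
    moreover have "(\<lambda>n. emeasure M (space \<mu> \<times> {..- real n})) \<longlonglongrightarrow> emeasure M (\<Inter>n. space \<mu> \<times> {..- real n})"
      by (intro Lim_emeasure_decseq) (auto simp: decseq_def)
    moreover have "(\<Inter>n. space \<mu> \<times> {..- real n}) = {}"
    proof -
      have "\<exists>n. \<not> y \<le> - real n" for y :: real unfolding not_le by (metis minus_less_iff reals_Archimedean2)
      then show ?thesis by auto
    qed
    ultimately have "ennreal e * emeasure \<mu> ?B \<le> 0"
      by (intro tendsto_lowerbound[of _ _ sequentially]) auto
    then have "emeasure \<mu> ?B = 0" using e by auto
    then have "?B \<in> null_sets \<mu>" by (simp add: null_sets_def)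
    from AE_not_in[OF this] show ?thesis by (auto simp: not_le)
  qed
  \<comment> \<open>On \<open>?B\<close> the values at all n are at most 1 - e. Letting n grow shows
    that the mass of \<open>?B\<close> is at most 1 - e times itself.\<close>
  have aetop: "AE x in \<mu>. \<exists>n::nat. 1 - e < F x (real n)" if e: "0 < e" for e
  proof -
    let ?B = "{x \<in> space \<mu>. \<forall>n::nat. F x (real n) \<le> 1 - e}"
    have [measurable]: "?B \<in> sets \<mu>" by measurable
    have "emeasure M (?B \<times> {..real n}) \<le> ennreal (1 - e) * emeasure \<mu> ?B" for n
    proof -
      have "emeasure M (?B \<times> {..real n}) = (\<integral>\<^sup>+x\<in>?B. f (real n) x \<partial>\<mu>)" by (simp add: f)
      also have "\<dots> \<le> (\<integral>\<^sup>+x. ennreal (1 - e) * indicator ?B x \<partial>\<mu>)"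
      proof (rule nn_integral_mono_AE, use f1[of "real n"] in eventually_elim)
        case (elim x)
        then have "ennreal (F x (real n)) = f (real n) x" by (simp add: F_def ennreal_enn2real_le_1)
        then show ?case using ennreal_leI[of "F x (real n)" "1 - e"] by (auto simp: indicator_def)
      qed
      also have "\<dots> = ennreal (1 - e) * emeasure \<mu> ?B" by (simp add: nn_integral_cmult_indicator)
      finally show ?thesis .
    qed
    moreover have "(\<lambda>n. emeasure M (?B \<times> {..real n})) \<longlonglongrightarrow> emeasure M (\<Union>n. ?B \<times> {..real n})"
      by (intro Lim_emeasure_incseq) (auto simp: incseq_def)
    moreover have "(\<Union>n. ?B \<times> {..real n}) = ?B \<times> UNIV"
      using real_arch_simple by (auto simp del: not_all)
    ultimately have "emeasure \<mu> ?B \<le> ennreal (1 - e) * emeasure \<mu> ?B"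
      unfolding M_rect[OF \<open>?B \<in> sets \<mu>\<close>, symmetric] by (intro tendsto_upperbound[of _ _ sequentially]) auto
    then have "measure \<mu> ?B = 0"
      unfolding \<mu>.emeasure_eq_measure using e by (intro contraction_imp_zero[of _ "1 - e"]) auto
    then have "?B \<in> null_sets \<mu>" by (simp add: null_sets_def \<mu>.emeasure_eq_measure)
    from AE_not_in[OF this] show ?thesis by (auto simp: not_le)
  qed
  have good: "AE x in \<mu>. rational_cdf (F x)"
  proof -
    have "AE x in \<mu>. \<forall>e\<in>\<rat>. 0 < e \<longrightarrow> (\<exists>n::nat. F x (- real n) < e)"
      by (intro AE_ball_countable[THEN iffD2] ballI countable_rat) (use aebot in auto)
    moreover have "AE x in \<mu>. \<forall>e\<in>\<rat>. 0 < e \<longrightarrow> (\<exists>n::nat. 1 - e < F x (real n))"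
      by (intro AE_ball_countable[THEN iffD2] ballI countable_rat) (use aetop in auto)
    ultimately show ?thesis using aeq
    proof eventually_elim
      case (elim x)
      have "F x q \<le> 1" if "q \<in> \<rat>" for q
        using elim(3) that enn2real_mono[of "f q x" 1] by (auto simp: F_def)
      moreover have "F x q \<le> F x q'" if "q \<in> \<rat>" "q' \<in> \<rat>" "q \<le> q'" for q q'
        unfolding F_def using elim(3) that by (intro enn2real_mono) (auto simp: less_top[symmetric] top_unique)
      ultimately show ?case using elim(1,2) unfolding rational_cdf_def by (auto simp: F_def)
    qed
  qed
  \<comment> \<open>On the exceptional null set the unit mass at 0 is used. The strict inequality in
    0 < r is corrected by the right envelope, which takes the value 1 at 0.\<close>
  define G where "G x = (if rational_cdf (F x) then F x else (\<lambda>r. if 0 < r then 1 else 0))" for x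
  have goodM[measurable]: "Measurable.pred \<mu> (\<lambda>x. rational_cdf (F x))"
  proof -
    have ball: "Measurable.pred \<mu> (\<lambda>x. \<forall>q\<in>\<rat>. P q x)" if "\<And>q :: real. q \<in> \<rat> \<Longrightarrow> Measurable.pred \<mu> (P q)" for P
    proof -
      have "(\<forall>q\<in>\<rat>. P q x) \<longleftrightarrow> (\<forall>q. P (of_rat q) x)" for x by (auto simp: Rats_def)
      then show ?thesis using that by simp
    qed
    show ?thesis unfolding rational_cdf_def by (intro pred_intros_logic(3) ball; measurable)
  qed
  have GM[measurable]: "(\<lambda>x. G x r) \<in> borel_measurable \<mu>" for r
    unfolding G_def if_distribR by measurable
  have Gcdf: "rational_cdf (G x)" for x
  proof (cases "rational_cdf (F x)")
    case False
    have "rational_cdf (\<lambda>r. if 0 < r then 1 else 0)"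
      unfolding rational_cdf_def by (auto intro: exI[of _ 1])
    then show ?thesis using False by (simp add: G_def)
  qed (simp add: G_def)
  define \<kappa> where "\<kappa> x = interval_measure (right_envelope (G x))" for x
  note env = right_envelope_props[OF Gcdf]
  have prob: "prob_space (\<kappa> x)" for x
    unfolding \<kappa>_def using real_distribution_interval_measure[OF monoD[OF env(1)] env(2-4)]
    by (simp add: real_distribution_def)
  have \<kappa>Iic: "emeasure (\<kappa> x) {..r} = ennreal (right_envelope (G x) r)" for x r
    unfolding \<kappa>_def by (intro emeasure_interval_measure_Iic monoD[OF env(1)] env)
  have envM: "(\<lambda>x. right_envelope (G x) r) \<in> borel_measurable \<mu>" for r
    by (rule borel_measurable_LIMSEQ_real[OF env(6)]) measurable
  have gen: "sets (borel :: real measure) = sigma_sets UNIV (range (\<lambda>r. {..r}))"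
    by (subst borel_eq_atMost) simp
  have \<kappa>M[measurable]: "\<kappa> \<in> \<mu> \<rightarrow>\<^sub>M prob_algebra borel"
  proof (rule measurable_prob_algebra_generated[OF gen])
    show "Int_stable (range (\<lambda>r::real. {..r}))"
      by (auto simp: Int_stable_def Int_atMost)
    show "(\<lambda>a. emeasure (\<kappa> a) A) \<in> borel_measurable \<mu>" if "A \<in> range (\<lambda>r. {..r})" for A
      using that envM by (auto simp: \<kappa>Iic)
    show "sets (\<kappa> a) = sets borel" for a by (simp add: \<kappa>_def)
  qed (use prob in auto)
  have \<kappa>S[measurable]: "\<kappa> \<in> \<mu> \<rightarrow>\<^sub>M subprob_algebra borel" by (intro measurable_prob_algebraD \<kappa>M)
  define M' where "M' = bind \<mu> (\<lambda>x. distr (\<kappa> x) (\<mu> \<Otimes>\<^sub>M borel) (\<lambda>y. (x, y)))"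
  have kM: "(\<lambda>x. distr (\<kappa> x) (\<mu> \<Otimes>\<^sub>M borel) (\<lambda>y. (x, y))) \<in> \<mu> \<rightarrow>\<^sub>M subprob_algebra (\<mu> \<Otimes>\<^sub>M borel)"
    by (rule measurable_distr2[OF _ \<kappa>S]) simp
  have M': "emeasure M' A = (\<integral>\<^sup>+x. emeasure (\<kappa> x) (Pair x -` A) \<partial>\<mu>)"
    if A: "A \<in> sets (\<mu> \<Otimes>\<^sub>M borel)" for A
  proof -
    have "emeasure M' A = (\<integral>\<^sup>+x. emeasure (distr (\<kappa> x) (\<mu> \<Otimes>\<^sub>M borel) (\<lambda>y. (x, y))) A \<partial>\<mu>)"
      unfolding M'_def by (rule emeasure_bind[OF \<mu>.not_empty kM A])
    also have "\<dots> = (\<integral>\<^sup>+x. emeasure (\<kappa> x) (Pair x -` A) \<partial>\<mu>)"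
    proof (intro nn_integral_cong)
      fix x assume x: "x \<in> space \<mu>"
      have "(\<lambda>y. (x, y)) \<in> \<kappa> x \<rightarrow>\<^sub>M \<mu> \<Otimes>\<^sub>M borel"
        using x by (simp add: \<kappa>_def measurable_cong_sets[OF sets_interval_measure refl])
      then show "emeasure (distr (\<kappa> x) (\<mu> \<Otimes>\<^sub>M borel) (\<lambda>y. (x, y))) A = emeasure (\<kappa> x) (Pair x -` A)"
        using A by (simp add: emeasure_distr \<kappa>_def)
    qed
    finally show ?thesis .
  qed
  \<comment> \<open>The measures agree on the generating rectangles A \<times> {..r}: continuity
    from above of \<open>M\<close> and dominated convergence of \<open>G\<close> run along the same
    dyadic sequence above r.\<close>
  have "M = M'"
  proof (rule measure_eqI_generator_eq)
    let ?E = "{a \<times> b | a b. a \<in> sets \<mu> \<and> b \<in> range (\<lambda>r::real. {..r})}"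
    show "Int_stable ?E"
    proof (rule Int_stableI)
      fix a b assume "a \<in> ?E" "b \<in> ?E"
      then obtain A r B s where "a = A \<times> {..r}" "b = B \<times> {..s}" "A \<in> sets \<mu>" "B \<in> sets \<mu>" by auto
      then have "a \<inter> b = (A \<inter> B) \<times> {..min r s}" "A \<inter> B \<in> sets \<mu>" by auto
      then show "a \<inter> b \<in> ?E" by blast
    qed
    show "?E \<subseteq> Pow (space \<mu> \<times> UNIV)" using sets.sets_into_space by blast
    have "sets (\<mu> \<Otimes>\<^sub>M borel) = sets (sigma (space \<mu> \<times> space borel) ?E)"
    proof (rule sets_pair_eq[of _ _ "{space \<mu>}" _ _ "range (\<lambda>n::nat. {..real n})"])
      show "sets \<mu> = sigma_sets (space \<mu>) (sets \<mu>)" by (simp add: sets.sigma_sets_eq)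
      show "\<Union> (range (\<lambda>n::nat. {..real n})) = space borel" using real_arch_simple by auto
    qed (use gen sets.space_closed in auto)
    then have eq: "sets (\<mu> \<Otimes>\<^sub>M borel) = sigma_sets (space \<mu> \<times> UNIV) ?E"
      using \<open>?E \<subseteq> Pow (space \<mu> \<times> UNIV)\<close> by simp
    show "sets M = sigma_sets (space \<mu> \<times> UNIV) ?E" using sM eq by simp
    have "sets M' = sets (\<mu> \<Otimes>\<^sub>M borel)" unfolding M'_def using \<mu>.not_empty by (simp add: sets_bind[OF _ \<mu>.not_empty])
    then show "sets M' = sigma_sets (space \<mu> \<times> UNIV) ?E" using eq by simp
    show "range (\<lambda>n::nat. space \<mu> \<times> {..real n}) \<subseteq> ?E" by auto
    show "(\<Union>n::nat. space \<mu> \<times> {..real n}) = space \<mu> \<times> UNIV" using real_arch_simple by auto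
    show "emeasure M (space \<mu> \<times> {..real n}) \<noteq> \<infinity>" for n by simp
    fix X assume "X \<in> ?E"
    then obtain A r where X: "X = A \<times> {..r}" and A[measurable]: "A \<in> sets \<mu>" by auto
    have "emeasure M' X = (\<integral>\<^sup>+x. emeasure (\<kappa> x) (Pair x -` (A \<times> {..r})) \<partial>\<mu>)"
      unfolding X by (rule M') simp
    also have "\<dots> = (\<integral>\<^sup>+x\<in>A. ennreal (right_envelope (G x) r) \<partial>\<mu>)"
      by (intro nn_integral_cong) (auto simp: indicator_def \<kappa>Iic)
    finally have X': "emeasure M' X = (\<integral>\<^sup>+x\<in>A. ennreal (right_envelope (G x) r) \<partial>\<mu>)" .
    have "(\<lambda>n. \<integral>\<^sup>+x. ennreal (G x (dyadic_above n r)) * indicator A x \<partial>\<mu>)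
       \<longlonglongrightarrow> (\<integral>\<^sup>+x. ennreal (right_envelope (G x) r) * indicator A x \<partial>\<mu>)"
    proof (rule nn_integral_dominated_convergence[where w = "\<lambda>_. 1"])
      show "AE x in \<mu>. (\<lambda>n. ennreal (G x (dyadic_above n r)) * indicator A x)
          \<longlonglongrightarrow> ennreal (right_envelope (G x) r) * indicator A x"
        by (intro AE_I2 tendsto_mult_ennreal tendsto_ennrealI env tendsto_const) (auto simp: indicator_def)
      show "AE x in \<mu>. ennreal (G x (dyadic_above n r)) * indicator A x \<le> 1" for n
        using Gcdf dyadic_above_Rats by (auto simp: rational_cdf_def indicator_def ennreal_le_1)
    qed (use envM in \<open>auto simp: \<mu>.emeasure_space_1\<close>)
    moreover have "(\<integral>\<^sup>+x. ennreal (G x q) * indicator A x \<partial>\<mu>) = emeasure M (A \<times> {..q})"  for q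
    proof -
      have "(\<integral>\<^sup>+x. ennreal (G x q) * indicator A x \<partial>\<mu>) = (\<integral>\<^sup>+x\<in>A. f q x \<partial>\<mu>)"
        using good f1[of q]
        by (intro nn_integral_cong_AE, eventually_elim)
           (auto simp: G_def F_def ennreal_enn2real_le_1)
      then show ?thesis by (simp add: f)
    qed
    ultimately have "(\<lambda>n. emeasure M (A \<times> {..dyadic_above n r})) \<longlonglongrightarrow> emeasure M' X" by (simp add: X')
    moreover have "(\<lambda>n. emeasure M (A \<times> {..dyadic_above n r})) \<longlonglongrightarrow> emeasure M (\<Inter>n. A \<times> {..dyadic_above n r})"
      using decseq_dyadic_above[of r] by (intro Lim_emeasure_decseq) (auto simp: decseq_def intro: order_trans)
    moreover have "(\<Inter>n. A \<times> {..dyadic_above n r}) = X"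
      using INT_atMost_dyadic_above[of r] unfolding X by (auto simp: set_eq_iff)
    ultimately show "emeasure M X = emeasure M' X" using LIMSEQ_unique by metis
  qed
  then show ?thesis using \<kappa>M M' by blast
qed

section \<open>Forward boundedly compact spaces\<close>

locale boundedly_compact_space =
  fixes d :: "'a \<Rightarrow> 'a \<Rightarrow> real"
  assumes forward: "forward_metric_space d" and compact_balls: "forward_boundedly_compact d"
begin

lemma irreversible: "irreversible_metric d"
  using forward by (simp add: forward_metric_space_def)

lemma d_nonneg [simp]: "0 \<le> d x y" and d_eq_0 [simp]: "d x y = 0 \<longleftrightarrow> x = y"
  and d_triangle: "d x z \<le> d x y + d y z"
  using irreversible by (auto simp: irreversible_metric_def)

text \<open>The symmetrised distance. It is a genuine metric inducing the forward topology, so that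
  total boundedness, Cauchy sequences and sequential compactness become available.\<close>

definition sd :: "'a \<Rightarrow> 'a \<Rightarrow> real" where "sd x y = d x y + d y x"

lemma d_le_sd: "d x y \<le> sd x y" "d y x \<le> sd x y" by (auto simp: sd_def)

sublocale sd: Metric_space UNIV sd
proof
  show "sd x z \<le> sd x y + sd y z" for x y z
    using d_triangle[of x z y] d_triangle[of z x y] by (simp add: sd_def)
qed (auto simp: sd_def add_nonneg_eq_0_iff)

lemma d_self [simp]: "d x x = 0" and sd_self [simp]: "sd x x = 0"
  by (simp_all add: sd_def)

lemma d_diff_le: "\<bar>d x y - d x' y'\<bar> \<le> sd x x' + sd y y'"
  using d_triangle[of x y x'] d_triangle[of x' y y'] d_triangle[of x' y' x] d_triangle[of x y' y]
    d_nonneg[of x x'] d_nonneg[of x' x] d_nonneg[of y y'] d_nonneg[of y' y]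
    unfolding sd_def by linarith

lemma openin_fwd_ball: "openin (fwd_topology d) (fwd_ball d x r)"
  unfolding fwd_topology_def by (intro topology_generated_by_Basis) auto

lemma topspace_fwd [simp]: "topspace (fwd_topology d) = UNIV"
proof -
  have "x \<in> topspace (fwd_topology d)" for x
    using openin_subset[OF openin_fwd_ball[of x 1]] by (auto simp: fwd_ball_def subset_iff)
  then show ?thesis by auto
qed

lemma fwd_ball_subset_cball: "fwd_ball d x r \<subseteq> fwd_cball d x r"
  unfolding fwd_cball_def by (rule closure_of_subset) simp

text \<open>The hypothesis controls reversibility only on balls about one base point p, but the ball
  about x lies in a larger ball about p. A finite infimum means that some constant is
  admissible.\<close>

lemma reversible_on_cball:
  obtains L where "1 \<le> L" "\<And>y z. y \<in> fwd_cball d x r \<Longrightarrow> z \<in> fwd_cball d x r \<Longrightarrow> d y z \<le> L * d z y"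
proof -
  obtain p \<Theta> where \<Theta>: "\<And>r. r > 0 \<Longrightarrow> reversibility d (fwd_cball d p r) \<le> ereal (\<Theta> r)"
    using forward unfolding forward_metric_space_def by blast
  define R where "R = d p x + \<bar>r\<bar> + 1"
  have "R > 0" using d_nonneg[of p x] unfolding R_def by linarith
  have sub: "fwd_cball d x r \<subseteq> fwd_cball d p R"
    unfolding fwd_cball_def
  proof (rule closure_of_mono, rule subsetI)
    fix y assume "y \<in> fwd_ball d x r"
    then show "y \<in> fwd_ball d p R" using d_triangle[of p y x] by (simp add: fwd_ball_def R_def)
  qed
  have "{ereal l | l. 1 \<le> l \<and> (\<forall>x\<in>fwd_cball d p R. \<forall>y\<in>fwd_cball d p R. d x y \<le> l * d y x)} \<noteq> {}"
  proof
    assume "{ereal l | l. 1 \<le> l \<and> (\<forall>x\<in>fwd_cball d p R. \<forall>y\<in>fwd_cball d p R. d x y \<le> l * d y x)} = {}"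
    then have "reversibility d (fwd_cball d p R) = \<infinity>"
      by (simp only: reversibility_def Inf_empty top_ereal_def)
    then show False using \<Theta>[OF \<open>R > 0\<close>] by simp
  qed
  then obtain l where "1 \<le> l" "\<forall>x\<in>fwd_cball d p R. \<forall>y\<in>fwd_cball d p R. d x y \<le> l * d y x" by blast
  then show ?thesis using sub that by blast
qed

text \<open>By definition the balls are only a subbasis. That they form a neighbourhood basis rests
  on the triangle inequality with the centre kept in the first argument.\<close>

lemma openin_fwd_iff: "openin (fwd_topology d) U \<longleftrightarrow> (\<forall>x\<in>U. \<exists>r>0. fwd_ball d x r \<subseteq> U)"
proof
  assume "openin (fwd_topology d) U"
  then have "generate_topology_on {fwd_ball d x r | x r. True} U"
    by (simp add: fwd_topology_def openin_topology_generated_by_iff)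
  then show "\<forall>x\<in>U. \<exists>r>0. fwd_ball d x r \<subseteq> U"
  proof induction
    case (Int a b)
    show ?case
    proof
      fix x assume "x \<in> a \<inter> b"
      then obtain r s where "r > 0" "s > 0" "fwd_ball d x r \<subseteq> a" "fwd_ball d x s \<subseteq> b" using Int by blast
      then show "\<exists>r>0. fwd_ball d x r \<subseteq> a \<inter> b" by (intro exI[of _ "min r s"]) (auto simp: fwd_ball_def)
    qed
  next
    case (UN K)
    show ?case
    proof
      fix x assume "x \<in> \<Union>K"
      then obtain k where "k \<in> K" "x \<in> k" by blast
      then show "\<exists>r>0. fwd_ball d x r \<subseteq> \<Union>K" using UN.IH[of k] by blast
    qed
  next
    case (Basis s)
    then obtain x r where s: "s = fwd_ball d x r" by blast
    show ?case
    proof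
      fix y assume "y \<in> s"
      then have "0 < r - d x y" by (simp add: s fwd_ball_def)
      moreover have "fwd_ball d y (r - d x y) \<subseteq> s"
      proof
        fix z assume "z \<in> fwd_ball d y (r - d x y)"
        then show "z \<in> s" using d_triangle[of x z y] by (simp add: s fwd_ball_def)
      qed
      ultimately show "\<exists>r>0. fwd_ball d y r \<subseteq> s" by blast
    qed
  qed auto
next
  assume U: "\<forall>x\<in>U. \<exists>r>0. fwd_ball d x r \<subseteq> U"
  then have "U = \<Union>{fwd_ball d x r | x r. fwd_ball d x r \<subseteq> U}"
  proof -
    have "x \<in> \<Union>{fwd_ball d x r | x r. fwd_ball d x r \<subseteq> U}" if x: "x \<in> U" for x
    proof -
      obtain r where "r > 0" "fwd_ball d x r \<subseteq> U" using U x by blast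
      moreover have "x \<in> fwd_ball d x r" using \<open>r > 0\<close> by (simp add: fwd_ball_def)
      ultimately show ?thesis by blast
    qed
    then show ?thesis by auto
  qed
  also have "openin (fwd_topology d) \<dots>" using openin_fwd_ball by (intro openin_Union) auto
  finally show "openin (fwd_topology d) U" .
qed

text \<open>On the unit ball about x the reverse distance to x is at most L times the forward one,
  so \<open>sd x y\<close> is at most (1 + L) times \<open>d x y\<close>.\<close>

lemma fwd_ball_subset_sd_ball:
  assumes "r > 0" obtains s where "s > 0" "fwd_ball d x s \<subseteq> sd.mball x r"
proof -
  obtain L where L: "1 \<le> L" "\<And>y z. y \<in> fwd_cball d x 1 \<Longrightarrow> z \<in> fwd_cball d x 1 \<Longrightarrow> d y z \<le> L * d z y"
    using reversible_on_cball[of x 1] by metis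
  define s where "s = min 1 (r / (1 + L))"
  have s: "s > 0" using assms L by (simp add: s_def)
  have "y \<in> sd.mball x r" if y: "y \<in> fwd_ball d x s" for y
  proof -
    have "x \<in> fwd_ball d x 1" "y \<in> fwd_ball d x 1" using y by (auto simp: fwd_ball_def s_def)
    then have "d y x \<le> L * d x y" using fwd_ball_subset_cball L by blast
    then have "sd x y \<le> (1 + L) * d x y" by (simp add: sd_def algebra_simps)
    also have "\<dots> < (1 + L) * (r / (1 + L))" using y L by (intro mult_strict_left_mono) (auto simp: fwd_ball_def s_def)
    also have "\<dots> = r" using L by simp
    finally show ?thesis by simp
  qed
  then show ?thesis using s that by blast
qed

lemma fwd_topology_eq: "fwd_topology d = sd.mtopology"
proof -
  have "openin (fwd_topology d) U \<longleftrightarrow> openin sd.mtopology U" for U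
    unfolding openin_fwd_iff sd.openin_mtopology
  proof (intro iffI conjI ballI allI impI)
    fix x assume "\<forall>x\<in>U. \<exists>r>0. fwd_ball d x r \<subseteq> U" "x \<in> U"
    then obtain r where "r > 0" "fwd_ball d x r \<subseteq> U" by blast
    moreover have "sd.mball x r \<subseteq> fwd_ball d x r"
      by (auto simp: fwd_ball_def intro: le_less_trans[OF d_le_sd(1)])
    ultimately show "\<exists>r>0. sd.mball x r \<subseteq> U" by blast
  next
    fix x assume "U \<subseteq> UNIV \<and> (\<forall>x. x \<in> U \<longrightarrow> (\<exists>r>0. sd.mball x r \<subseteq> U))" "x \<in> U"
    then obtain r where "r > 0" "sd.mball x r \<subseteq> U" by blast
    then show "\<exists>r>0. fwd_ball d x r \<subseteq> U" using fwd_ball_subset_sd_ball by (metis order.trans)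
  qed auto
  then show ?thesis by (simp add: topology_eq)
qed

lemma compactin_fwd_cball: "compactin sd.mtopology (fwd_cball d x r)"
  using compact_balls unfolding forward_boundedly_compact_def fwd_topology_eq by blast

text \<open>Closed balls of integer radius about one point are compact, hence totally bounded, and
  they exhaust the space.\<close>

lemma countable_dense:
  obtains q :: "nat \<Rightarrow> 'a" where "\<And>x e. 0 < e \<Longrightarrow> \<exists>n. sd (q n) x < e"
proof -
  define p :: 'a where "p = undefined"
  have "\<exists>K. finite K \<and> fwd_cball d p (real n) \<subseteq> (\<Union>x\<in>K. sd.mball x (1 / real (Suc k)))" for n k
    using sd.compactin_imp_mtotally_bounded[OF compactin_fwd_cball] unfolding sd.mtotally_bounded_def
    by (metis of_nat_0_less_iff zero_less_Suc zero_less_divide_1_iff)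
  then obtain K where K: "\<And>n k. finite (K n k)"
    "\<And>n k. fwd_cball d p (real n) \<subseteq> (\<Union>x\<in>K n k. sd.mball x (1 / real (Suc k)))" by metis
  define Q where "Q = insert p (\<Union>n k. K n k)"
  have Q: "countable Q" "Q \<noteq> {}" using K(1) countable_finite[OF K(1)] by (auto simp: Q_def)
  show ?thesis
  proof (rule that[of "from_nat_into Q"])
    fix x :: 'a and e :: real assume "0 < e"
    obtain n where "d p x < real n" using reals_Archimedean2 by blast
    then have "x \<in> fwd_cball d p (real n)" using fwd_ball_subset_cball by (auto simp: fwd_ball_def)
    moreover obtain k where k: "1 / real (Suc k) < e" using \<open>0 < e\<close> nat_approx_posE by metis
    ultimately obtain y where y: "y \<in> K n k" "sd y x < 1 / real (Suc k)" using K(2)[of n k] by auto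
    then have "y \<in> range (from_nat_into Q)" using Q by (simp add: range_from_nat_into Q_def) blast
    then show "\<exists>m. sd (from_nat_into Q m) x < e" using y k by (metis imageE less_trans)
  qed
qed

definition dense_seq :: "nat \<Rightarrow> 'a" where
  "dense_seq = (SOME q. \<forall>x. \<forall>e>0. \<exists>n. sd (q n) x < e)"

lemma dense_seq: "0 < e \<Longrightarrow> \<exists>n. sd (dense_seq n) x < e"
proof -
  obtain q :: "nat \<Rightarrow> 'a" where "\<forall>x. \<forall>e>0. \<exists>n. sd (q n) x < e" using countable_dense by metis
  from someI[of "\<lambda>q. \<forall>x. \<forall>e>0. \<exists>n. sd (q n) x < e", OF this]
  show "0 < e \<Longrightarrow> \<exists>n. sd (dense_seq n) x < e" unfolding dense_seq_def by blast
qed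

text \<open>Second countability in explicit form: Borel measurability and null sets can be checked
  on countably many balls.\<close>

lemma open_eq_Union_dense_balls:
  assumes "openin (fwd_topology d) U"
  shows "U = (\<Union>(n, k)\<in>{(n, k). sd.mball (dense_seq n) (1 / real (Suc k)) \<subseteq> U}.
    sd.mball (dense_seq n) (1 / real (Suc k)))"
proof (intro equalityI subsetI)
  fix x assume "x \<in> U"
  then obtain r where r: "r > 0" "sd.mball x r \<subseteq> U"
    using assms unfolding fwd_topology_eq sd.openin_mtopology by blast
  obtain k where k: "1 / real (Suc k) < r / 2" using r nat_approx_posE[of "r / 2"] by auto
  obtain n where n: "sd (dense_seq n) x < 1 / real (Suc k)" using dense_seq by (metis of_nat_0_less_iff zero_less_Suc zero_less_divide_1_iff)
  have "sd.mball (dense_seq n) (1 / real (Suc k)) \<subseteq> U"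
  proof
    fix y assume "y \<in> sd.mball (dense_seq n) (1 / real (Suc k))"
    then have "sd x y < r" using sd.triangle[of x "dense_seq n" y] n k by (simp add: sd.commute)
    then show "y \<in> U" using r by auto
  qed
  then show "x \<in> (\<Union>(n, k)\<in>{(n, k). sd.mball (dense_seq n) (1 / real (Suc k)) \<subseteq> U}.
    sd.mball (dense_seq n) (1 / real (Suc k)))" using n by auto
qed auto

section \<open>Borel sets, supports and finiteness on compact sets\<close>

lemma space_fwd_borel [simp]: "space (fwd_borel d) = UNIV"
  by (simp add: fwd_borel_def)

lemma sets_fwd_borel_open: "openin (fwd_topology d) U \<Longrightarrow> U \<in> sets (fwd_borel d)"
  by (auto simp: fwd_borel_def)

lemma sets_fwd_borel_closed: "closedin (fwd_topology d) U \<Longrightarrow> U \<in> sets (fwd_borel d)"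
  using sets_fwd_borel_open[of "UNIV - U"] sets.compl_sets[of "UNIV - U" "fwd_borel d"]
  by (auto simp: closedin_def Diff_Diff_Int)

lemma openin_sd_ball: "openin (fwd_topology d) (sd.mball x r)"
  unfolding fwd_topology_eq by (rule sd.openin_mball)

text \<open>All four cases come from d being 1-Lipschitz with respect to \<open>sd\<close> in either
  argument.\<close>

lemma openin_d_less: "openin (fwd_topology d) {y. d y x < r}" "openin (fwd_topology d) {y. d x y < r}"
  "openin (fwd_topology d) {y. r < d y x}" "openin (fwd_topology d) {y. r < d x y}"
proof -
  have *: "openin (fwd_topology d) {y. P y}"
    if "\<And>y. P y \<Longrightarrow> \<exists>e>0. \<forall>z. sd y z < e \<longrightarrow> P z" for P
    unfolding fwd_topology_eq sd.openin_mtopology using that by fastforce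
  have close: "\<bar>d y x - d z x\<bar> \<le> sd y z" "\<bar>d x y - d x z\<bar> \<le> sd y z" for y z
    using d_diff_le[of y x z x] d_diff_le[of x y x z] by simp_all
  show "openin (fwd_topology d) {y. d y x < r}"
  proof (intro *)
    fix y assume "d y x < r"
    then have "0 < r - d y x \<and> (\<forall>z. sd y z < r - d y x \<longrightarrow> d z x < r)" using close(1)[of y]
      by (intro conjI allI impI) (simp, smt (verit))
    then show "\<exists>e>0. \<forall>z. sd y z < e \<longrightarrow> d z x < r" by blast
  qed
  show "openin (fwd_topology d) {y. d x y < r}"
  proof (intro *)
    fix y assume "d x y < r"
    then have "0 < r - d x y \<and> (\<forall>z. sd y z < r - d x y \<longrightarrow> d x z < r)" using close(2)[of y]
      by (intro conjI allI impI) (simp, smt (verit))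
    then show "\<exists>e>0. \<forall>z. sd y z < e \<longrightarrow> d x z < r" by blast
  qed
  show "openin (fwd_topology d) {y. r < d y x}"
  proof (intro *)
    fix y assume "r < d y x"
    then have "0 < d y x - r \<and> (\<forall>z. sd y z < d y x - r \<longrightarrow> r < d z x)" using close(1)[of y]
      by (intro conjI allI impI) (simp, smt (verit))
    then show "\<exists>e>0. \<forall>z. sd y z < e \<longrightarrow> r < d z x" by blast
  qed
  show "openin (fwd_topology d) {y. r < d x y}"
  proof (intro *)
    fix y assume "r < d x y"
    then have "0 < d x y - r \<and> (\<forall>z. sd y z < d x y - r \<longrightarrow> r < d x z)" using close(2)[of y]
      by (intro conjI allI impI) (simp, smt (verit))
    then show "\<exists>e>0. \<forall>z. sd y z < e \<longrightarrow> r < d x z" by blast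
  qed
qed

lemma compactin_bounded_closed:
  assumes "closedin (fwd_topology d) C" "\<And>y. y \<in> C \<Longrightarrow> d x y \<le> r"
  shows "compactin (fwd_topology d) C"
proof (rule closed_compactin[OF _ _ assms(1)])
  show "compactin (fwd_topology d) (fwd_cball d x (r + 1))"
    using compact_balls by (simp add: forward_boundedly_compact_def)
  show "C \<subseteq> fwd_cball d x (r + 1)"
    using assms(2) fwd_ball_subset_cball[of x "r + 1"] by (fastforce simp: fwd_ball_def)
qed

lemma measurable_d_left [measurable]: "(\<lambda>y. d x y) \<in> borel_measurable (fwd_borel d)"
  unfolding borel_measurable_iff_less using openin_d_less(2) by (auto intro: sets_fwd_borel_open)

lemma measurable_d_right [measurable]: "(\<lambda>y. d y x) \<in> borel_measurable (fwd_borel d)"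
  unfolding borel_measurable_iff_less using openin_d_less(1) by (auto intro: sets_fwd_borel_open)

text \<open>Joint measurability is reduced to the measurability in each argument by routing the
  distance through a dense point, which costs arbitrarily little.\<close>

lemma measurable_d_pair: "(\<lambda>z. d (fst z) (snd z)) \<in> borel_measurable (fwd_borel d \<Otimes>\<^sub>M fwd_borel d)"
proof -
  have eq: "d x y < c \<longleftrightarrow> (\<exists>n. d x (dense_seq n) + d (dense_seq n) y < c)" for x y c
  proof
    assume lt: "d x y < c"
    obtain n where n: "sd (dense_seq n) y < (c - d x y) / 2" using dense_seq lt by (metis diff_gt_0_iff_gt half_gt_zero)
    have "d x (dense_seq n) \<le> d x y + d y (dense_seq n)" by (rule d_triangle)
    then have "d x (dense_seq n) + d (dense_seq n) y \<le> d x y + sd (dense_seq n) y" by (simp add: sd_def)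
    also have "\<dots> < c" using n lt by (simp add: field_simps) 
    finally show "\<exists>n. d x (dense_seq n) + d (dense_seq n) y < c" by blast
  qed (use d_triangle in \<open>blast intro: le_less_trans\<close>)
  show ?thesis unfolding borel_measurable_iff_less eq by measurable
qed

lemma measurable_d [measurable (raw)]:
  assumes [measurable]: "f \<in> M \<rightarrow>\<^sub>M fwd_borel d" "g \<in> M \<rightarrow>\<^sub>M fwd_borel d"
  shows "(\<lambda>x. d (f x) (g x)) \<in> borel_measurable M"
  using measurable_compose[OF measurable_Pair[OF assms] measurable_d_pair] by simp

text \<open>An open set is a countable union of \<open>sd\<close> balls about dense points, so the
  distances to fixed points decide measurability.\<close>

lemma measurable_fwd_borelI:
  assumes "\<And>x. (\<lambda>w. sd x (f w)) \<in> borel_measurable M"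
  shows "f \<in> M \<rightarrow>\<^sub>M fwd_borel d"
  unfolding fwd_borel_def
proof (rule measurable_measure_of)
  fix U assume "U \<in> {U. openin (fwd_topology d) U}"
  then have U: "openin (fwd_topology d) U" by simp
  have "f -` U \<inter> space M = (\<Union>(n, k)\<in>{(n, k). sd.mball (dense_seq n) (1 / real (Suc k)) \<subseteq> U}.
    {w \<in> space M. sd (dense_seq n) (f w) < 1 / real (Suc k)})"
    by (subst open_eq_Union_dense_balls[OF U]) (simp add: set_eq_iff, blast)
  also have "\<dots> \<in> sets M"
    using assms by (intro sets.countable_UN') (auto intro!: borel_measurable_less[of _ M])
  finally show "f -` U \<inter> space M \<in> sets M" .
qed auto

lemma closedin_msupp: "closedin (fwd_topology d) (msupp d \<mu>)"
proof -
  have "openin (fwd_topology d) (UNIV - msupp d \<mu>)"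
    by (subst openin_subopen) (fastforce simp: msupp_def)
  then show ?thesis by (simp add: closedin_def)
qed

lemma sets_msupp [measurable]: "msupp d \<mu> \<in> sets (fwd_borel d)"
  by (intro sets_fwd_borel_closed closedin_msupp)

text \<open>Each point off the support has a null neighbourhood, which contains a ball of the
  countable base around that point. Countably many null balls thus cover the complement.\<close>

lemma emeasure_compl_msupp:
  assumes [measurable_cong]: "sets \<mu> = sets (fwd_borel d)"
  shows "emeasure \<mu> (- msupp d \<mu>) = 0"
proof -
  define I where "I = {(n, k). emeasure \<mu> (sd.mball (dense_seq n) (1 / real (Suc k))) = 0}"
  have "- msupp d \<mu> \<subseteq> (\<Union>(n, k)\<in>I. sd.mball (dense_seq n) (1 / real (Suc k)))"
  proof
    fix x assume "x \<in> - msupp d \<mu>"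
    then obtain U where U: "openin (fwd_topology d) U" "x \<in> U" "emeasure \<mu> U = 0"
      by (auto simp: msupp_def)
    then obtain n k where nk: "sd.mball (dense_seq n) (1 / real (Suc k)) \<subseteq> U" "x \<in> sd.mball (dense_seq n) (1 / real (Suc k))"
      using open_eq_Union_dense_balls[OF U(1)] by blast
    then have "emeasure \<mu> (sd.mball (dense_seq n) (1 / real (Suc k))) = 0"
      using emeasure_mono[OF nk(1), of \<mu>] U sets_fwd_borel_open[OF U(1)] assms by auto
    then show "x \<in> (\<Union>(n, k)\<in>I. sd.mball (dense_seq n) (1 / real (Suc k)))" using nk by (auto simp: I_def)
  qed
  moreover have "(\<Union>(n, k)\<in>I. sd.mball (dense_seq n) (1 / real (Suc k))) \<in> null_sets \<mu>"
    by (intro null_sets_UN') (auto simp: I_def null_sets_def assms intro: sets_fwd_borel_open openin_sd_ball)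
  ultimately have "- msupp d \<mu> \<in> null_sets \<mu>"
    using sets_msupp[of \<mu>] assms by (intro null_sets_subset[of _ \<mu> "- msupp d \<mu>"]) (auto simp: Compl_eq_Diff_UNIV intro!: sets.Diff sets.top[of "fwd_borel d", simplified])
  then show ?thesis by (simp add: null_sets_def)
qed

lemma emeasure_compact_finite:
  assumes "locally_finite_borel_measure d \<nu>" "compactin (fwd_topology d) C"
  shows "emeasure \<nu> C < \<infinity>"
proof -
  have s: "sets \<nu> = sets (fwd_borel d)"
    and "\<forall>x. \<exists>U. openin (fwd_topology d) U \<and> x \<in> U \<and> emeasure \<nu> U < \<infinity>"
    using assms(1) by (auto simp: locally_finite_borel_measure_def)
  then obtain U where U: "\<And>x. openin (fwd_topology d) (U x)" "\<And>x. x \<in> U x" "\<And>x. emeasure \<nu> (U x) < \<infinity>" by metis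
  obtain F where F: "finite F" "F \<subseteq> range U" "C \<subseteq> \<Union>F"
    using assms(2) U(1,2) unfolding compactin_def by (metis (no_types, lifting) UNIV_I UN_I imageE subsetI)
  have m: "V \<in> sets \<nu>" if "V \<in> F" for V using that F(2) U(1) sets_fwd_borel_open s by auto
  have "emeasure \<nu> C \<le> emeasure \<nu> (\<Union>V\<in>F. V)"
    using F m by (intro emeasure_mono) auto
  also have "\<dots> \<le> (\<Sum>V\<in>F. emeasure \<nu> V)"
    using F m by (intro emeasure_subadditive_finite) auto
  also have "\<dots> < \<infinity>" using F U(3) by (auto simp: ennreal_sum_less_top)
  finally show ?thesis .
qed

text \<open>The tail of a Cauchy sequence lies in one closed forward ball, whose compactness
  provides a convergent subsequence.\<close>

lemma sd_complete:
  assumes "sd.MCauchy s" shows "\<exists>x. limitin sd.mtopology s x sequentially"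
proof -
  obtain n where n: "\<And>m k. n \<le> m \<Longrightarrow> n \<le> k \<Longrightarrow> sd (s m) (s k) < 1"
    using assms unfolding sd.MCauchy_def by (metis zero_less_one)
  have "range (\<lambda>k. s (k + n)) \<subseteq> fwd_cball d (s n) 1"
  proof (rule subsetI, elim rangeE)
    fix y k assume y: "y = s (k + n)"
    have "d (s n) y < 1" using n[of n "k + n"] d_le_sd(1)[of "s n" y] unfolding y by simp
    then show "y \<in> fwd_cball d (s n) 1" using fwd_ball_subset_cball[of "s n" 1] by (auto simp: fwd_ball_def)
  qed
  then obtain l r where r: "strict_mono r" "limitin sd.mtopology ((\<lambda>k. s (k + n)) \<circ> r) l sequentially"
    using compactin_fwd_cball[of "s n" 1] unfolding sd.compactin_sequentially by blast
  have "limitin sd.mtopology (s \<circ> (\<lambda>k. r k + n)) l sequentially" using r by (simp add: o_def)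
  then have "limitin sd.mtopology s l sequentially"
    using r by (intro sd.MCauchy_convergent_subsequence[OF assms]) (auto simp: strict_mono_def)
  then show ?thesis by blast
qed

end

section \<open>Disintegration on forward boundedly compact spaces\<close>

text \<open>A set is recovered from its ternary digit by iterating the shift map.\<close>

definition digit_sum :: "(nat \<Rightarrow> 'b set) \<Rightarrow> nat \<Rightarrow> 'b \<Rightarrow> real" where
  "digit_sum E k x = (\<Sum>j. indicator (E (k + j)) x * (1 / 3) ^ j)"

definition digit_shift :: "real \<Rightarrow> real" where
  "digit_shift r = 3 * (r - (if 1 \<le> r then 1 else 0))"

lemma summable_digits: "summable (\<lambda>j. indicator (E (k + j)) x * (1 / 3 :: real) ^ j)"
  by (rule summable_comparison_test'[OF summable_geometric[of "1 / 3"]]) (auto simp: indicator_def)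

lemma digit_sum_bounds: "0 \<le> digit_sum E k x" "digit_sum E k x \<le> 3 / 2"
proof -
  show "0 \<le> digit_sum E k x" unfolding digit_sum_def by (intro suminf_nonneg summable_digits) auto
  have "digit_sum E k x \<le> (\<Sum>j. (1 / 3) ^ j)"
    unfolding digit_sum_def by (intro suminf_le summable_digits summable_geometric) (auto simp: indicator_def)
  also have "\<dots> = 3 / 2" by (subst suminf_geometric) auto
  finally show "digit_sum E k x \<le> 3 / 2" .
qed

lemma digit_sum_Suc: "digit_sum E k x = indicator (E k) x + digit_sum E (Suc k) x / 3"
proof -
  have "digit_sum E k x = (\<Sum>j. indicator (E (k + Suc j)) x * (1 / 3) ^ Suc j) + indicator (E k) x"
    unfolding digit_sum_def using suminf_split_head[OF summable_digits[of E k x]] by simp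
  also have "(\<Sum>j. indicator (E (k + Suc j)) x * (1 / 3) ^ Suc j)
      = (\<Sum>j. indicator (E (Suc k + j)) x * (1 / 3) ^ j * (1 / 3 :: real))"
    by (intro suminf_cong) simp
  also have "\<dots> = digit_sum E (Suc k) x * (1 / 3)"
    unfolding digit_sum_def by (rule suminf_mult2[symmetric, OF summable_digits])
  finally show ?thesis by simp
qed

text \<open>Base 3 with digits 0 and 1 leaves a gap: the tail after the leading digit is at most (3
  / 2) / 3 = 1 / 2, so that digit is read off by comparison with 1.\<close>

lemma digit_sum_ge_1_iff: "1 \<le> digit_sum E k x \<longleftrightarrow> x \<in> E k"
  using digit_sum_Suc[of E k x] digit_sum_bounds[of E "Suc k" x] by (auto simp: indicator_def)

lemma digit_shift_funpow: "(digit_shift ^^ k) (digit_sum E 0 x) = digit_sum E k x"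
proof (induction k)
  case (Suc k)
  have "(digit_shift ^^ Suc k) (digit_sum E 0 x) = digit_shift (digit_sum E k x)" by (simp add: Suc)
  also have "\<dots> = digit_sum E (Suc k) x"
    unfolding digit_shift_def digit_sum_ge_1_iff using digit_sum_Suc[of E k x] by (auto simp: indicator_def)
  finally show ?case .
qed simp

lemma measurable_digit_shift_funpow [measurable]: "(digit_shift ^^ k) \<in> borel_measurable borel"
proof (induction k)
  case (Suc k)
  have "digit_shift \<in> borel_measurable borel" unfolding digit_shift_def by measurable
  then show ?case using measurable_compose[OF Suc] by (simp add: o_def)
qed simp

context boundedly_compact_space
begin

section \<open>Borel coding of points by real numbers\<close>

definition nearest :: "nat \<Rightarrow> 'a \<Rightarrow> nat" where
  "nearest n x = (LEAST i. sd (dense_seq i) x < (1 / 2) ^ n)"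

lemma nearest: "sd (dense_seq (nearest n x)) x < (1 / 2) ^ n"
  unfolding nearest_def by (rule LeastI_ex) (simp add: dense_seq)

lemma measurable_sd_left [measurable]: "(\<lambda>x. sd z x) \<in> borel_measurable (fwd_borel d)"
  unfolding sd_def by measurable

lemma measurable_nearest [measurable]: "nearest n \<in> fwd_borel d \<rightarrow>\<^sub>M count_space UNIV"
  unfolding nearest_def by measurable

text \<open>The k-th digit of a code answers one yes-no question: with k read as a pair (n, i),
  whether i is the index chosen at precision 2^(- n).\<close>

definition code_set :: "nat \<Rightarrow> 'a set" where
  "code_set k = {x. nearest (fst (prod_decode k)) x = snd (prod_decode k)}"

definition encode :: "'a \<Rightarrow> real" where "encode = digit_sum code_set 0"

text \<open>On a code exactly one i has digit 1 at position (n, i), so the least such i is the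
  chosen index; \<open>LEAST\<close> gives a total measurable map.\<close>

definition decode_index :: "nat \<Rightarrow> real \<Rightarrow> nat" where
  "decode_index n r = (LEAST i. 1 \<le> (digit_shift ^^ prod_encode (n, i)) r)"

lemma measurable_encode [measurable]: "encode \<in> borel_measurable (fwd_borel d)"
proof -
  have [measurable]: "code_set k \<in> sets (fwd_borel d)" for k
  proof -
    have "{x \<in> space (fwd_borel d). nearest (fst (prod_decode k)) x = snd (prod_decode k)} \<in> sets (fwd_borel d)"
      by measurable
    then show ?thesis by (simp add: code_set_def)
  qed
  show ?thesis unfolding encode_def digit_sum_def[abs_def] by measurable
qed

lemma measurable_decode_index [measurable]: "decode_index n \<in> borel \<rightarrow>\<^sub>M count_space UNIV"
  unfolding decode_index_def by measurable

lemma decode_index_encode: "decode_index n (encode x) = nearest n x"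
  unfolding decode_index_def encode_def digit_shift_funpow digit_sum_ge_1_iff code_set_def
  by (intro Least_equality) auto

definition decode_seq :: "real \<Rightarrow> nat \<Rightarrow> 'a" where
  "decode_seq r n = dense_seq (decode_index n r)"

text \<open>The decoded dense points converge for every code. The fixed value in the other case
  makes the map total, as is required for pushing measures forward.\<close>

definition decode :: "real \<Rightarrow> 'a" where
  "decode r = (if sd.MCauchy (decode_seq r) then SOME l. limitin sd.mtopology (decode_seq r) l sequentially
     else dense_seq 0)"

lemma limitin_sd: "limitin sd.mtopology u l sequentially \<longleftrightarrow> (\<lambda>n. sd (u n) l) \<longlonglongrightarrow> 0"
  unfolding sd.limitin_metric tendsto_iff by simp

lemma decode_limit:
  assumes "sd.MCauchy (decode_seq r)"
  shows "(\<lambda>n. sd (decode_seq r n) (decode r)) \<longlonglongrightarrow> 0"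
  unfolding limitin_sd[symmetric] decode_def using someI_ex[OF sd_complete[OF assms]] assms by simp

lemma sd_tendsto:
  assumes "(\<lambda>n. sd (u n) l) \<longlonglongrightarrow> 0" shows "(\<lambda>n. sd z (u n)) \<longlonglongrightarrow> sd z l"
proof (rule LIMSEQ_I)
  fix e :: real assume "0 < e"
  then obtain n where n: "\<And>m. m \<ge> n \<Longrightarrow> sd (u m) l < e"
    using assms unfolding LIMSEQ_def dist_real_def by fastforce
  have "norm (sd z (u m) - sd z l) < e" if "m \<ge> n" for m
    using sd.triangle[of z l "u m"] sd.triangle[of z "u m" l] n[OF that] sd.commute[of l "u m"]
    by (auto simp: abs_less_iff)
  then show "\<exists>no. \<forall>n\<ge>no. norm (sd z (u n) - sd z l) < e" by blast
qed

lemma decode_encode: "decode (encode x) = x"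
proof -
  have eq: "decode_seq (encode x) = (\<lambda>n. dense_seq (nearest n x))"
    by (simp add: decode_seq_def[abs_def] decode_index_encode)
  have lim: "(\<lambda>n. sd (decode_seq (encode x) n) x) \<longlonglongrightarrow> 0"
  proof (rule tendsto_sandwich[of "\<lambda>_. 0" _ _ "\<lambda>n. (1 / 2) ^ n"])
    show "\<forall>\<^sub>F n in sequentially. sd (decode_seq (encode x) n) x \<le> (1 / 2) ^ n"
      unfolding eq using nearest by (auto intro!: always_eventually less_imp_le)
  qed (auto intro!: LIMSEQ_realpow_zero)
  then have "sd.MCauchy (decode_seq (encode x))"
    unfolding limitin_sd[symmetric] by (intro sd.convergent_imp_MCauchy) auto
  from decode_limit[OF this] lim show ?thesis
    unfolding limitin_sd[symmetric] using sd.limitin_metric_unique by (metis sequentially_bot)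
qed

text \<open>With the tolerances 1 / (k + 1) the Cauchy property becomes a countable condition; where
  it holds, the distance from z to the limit is the limit of the distances.\<close>

lemma measurable_decode [measurable]: "decode \<in> borel \<rightarrow>\<^sub>M fwd_borel d"
proof (rule measurable_fwd_borelI)
  fix z
  have [measurable]: "(\<lambda>r. sd (decode_seq r n) (decode_seq r m)) \<in> borel_measurable borel" for n m
    unfolding decode_seq_def
    by (rule measurable_compose_countable[OF _ measurable_decode_index[of n]],
        rule measurable_compose_countable[OF _ measurable_decode_index[of m]]) simp
  have [measurable]: "(\<lambda>r. sd z (decode_seq r n)) \<in> borel_measurable borel" for n
    unfolding decode_seq_def by (rule measurable_compose_countable[OF _ measurable_decode_index[of n]]) simp
  have cau: "sd.MCauchy (decode_seq r) \<longleftrightarrow>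
      (\<forall>k. \<exists>N. \<forall>n. \<forall>m. N \<le> n \<longrightarrow> N \<le> m \<longrightarrow> sd (decode_seq r n) (decode_seq r m) < 1 / real (Suc k))" for r
    unfolding sd.MCauchy_def
  proof (intro iffI conjI allI impI subset_UNIV; (elim conjE)?)
    fix e :: real assume *: "\<forall>k. \<exists>N. \<forall>n m. N \<le> n \<longrightarrow> N \<le> m \<longrightarrow> sd (decode_seq r n) (decode_seq r m) < 1 / real (Suc k)"
      and "0 < e"
    then obtain k where "1 / real (Suc k) < e" using nat_approx_posE by metis
    then show "\<exists>N. \<forall>n m. N \<le> n \<longrightarrow> N \<le> m \<longrightarrow> sd (decode_seq r n) (decode_seq r m) < e"
      using * by (meson less_trans)
  qed (metis of_nat_0_less_iff zero_less_Suc zero_less_divide_1_iff)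
  have [measurable]: "Measurable.pred borel (\<lambda>r. sd.MCauchy (decode_seq r))" unfolding cau by measurable
  define h where "h r = lim (\<lambda>n. if sd.MCauchy (decode_seq r) then sd z (decode_seq r n) else 0)" for r
  have hM: "h \<in> borel_measurable borel" unfolding h_def[abs_def] by measurable
  have "sd z (decode r) = (if sd.MCauchy (decode_seq r) then h r else sd z (dense_seq 0))" for r
  proof (cases "sd.MCauchy (decode_seq r)")
    case True
    then have "(\<lambda>n. if sd.MCauchy (decode_seq r) then sd z (decode_seq r n) else 0) \<longlonglongrightarrow> sd z (decode r)"
      using sd_tendsto[OF decode_limit[OF True]] by simp
    then show ?thesis using True by (simp add: h_def limI)
  qed (simp add: decode_def)
  then show "(\<lambda>r. sd z (decode r)) \<in> borel_measurable borel" using hM by simp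
qed

text \<open>Coding the second coordinate moves the plan to the product of the space with the real
  line, where a kernel exists; decoding pushes that kernel back. Thus the choice in
  \<open>disintegration\<close> succeeds.\<close>

lemma disintegration_exists:
  assumes \<mu>: "prob_space \<mu>" and s\<mu>: "sets \<mu> = sets (fwd_borel d)"
    and s\<pi>: "sets \<pi> = sets (\<mu> \<Otimes>\<^sub>M \<mu>)" and marg: "distr \<pi> \<mu> fst = \<mu>"
  shows "disintegration \<pi> \<mu> \<in> \<mu> \<rightarrow>\<^sub>M prob_algebra \<mu>"
    and "A \<in> sets (\<mu> \<Otimes>\<^sub>M \<mu>) \<Longrightarrow> emeasure \<pi> A = (\<integral>\<^sup>+x. emeasure (disintegration \<pi> \<mu> x) (Pair x -` A) \<partial>\<mu>)"
proof -
  note s\<mu>[measurable_cong] s\<pi>[measurable_cong]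
  have m1: "fst \<in> \<pi> \<rightarrow>\<^sub>M \<mu>" "snd \<in> \<pi> \<rightarrow>\<^sub>M \<mu>" by (simp_all add: measurable_cong_sets[OF s\<pi> refl])
  have enc[measurable]: "encode \<in> borel_measurable \<mu>" by (simp add: measurable_cong_sets[OF s\<mu> refl])
  have dec[measurable]: "decode \<in> borel \<rightarrow>\<^sub>M \<mu>" by (simp add: measurable_cong_sets[OF refl s\<mu>])
  have em: "(\<lambda>z. (fst z, encode (snd z))) \<in> \<pi> \<rightarrow>\<^sub>M \<mu> \<Otimes>\<^sub>M borel"
    using m1 measurable_compose[OF m1(2) enc] by (intro measurable_Pair) auto
  define M where "M = distr \<pi> (\<mu> \<Otimes>\<^sub>M borel) (\<lambda>z. (fst z, encode (snd z)))"
  have sM: "sets M = sets (\<mu> \<Otimes>\<^sub>M borel)" by (simp add: M_def)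
  have "distr M \<mu> fst = \<mu>"
    unfolding M_def by (subst distr_distr[OF _ em]) (auto simp: o_def marg)
  then obtain \<kappa> where \<kappa>: "\<kappa> \<in> \<mu> \<rightarrow>\<^sub>M prob_algebra borel"
    "\<And>A. A \<in> sets (\<mu> \<Otimes>\<^sub>M borel) \<Longrightarrow> emeasure M A = (\<integral>\<^sup>+x. emeasure (\<kappa> x) (Pair x -` A) \<partial>\<mu>)"
    using real_disintegration[OF \<mu>, of M] sM by blast
  have "\<exists>\<kappa>. \<kappa> \<in> \<mu> \<rightarrow>\<^sub>M prob_algebra \<mu> \<and>
     (\<forall>A\<in>sets (\<mu> \<Otimes>\<^sub>M \<mu>). emeasure \<pi> A = (\<integral>\<^sup>+x. emeasure (\<kappa> x) (Pair x -` A) \<partial>\<mu>))"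
  proof (intro exI[of _ "\<lambda>x. distr (\<kappa> x) \<mu> decode"] conjI ballI)
    show "(\<lambda>x. distr (\<kappa> x) \<mu> decode) \<in> \<mu> \<rightarrow>\<^sub>M prob_algebra \<mu>"
      by (rule measurable_compose[OF \<kappa>(1) measurable_distr_prob_space[OF dec]])
    fix A assume A: "A \<in> sets (\<mu> \<Otimes>\<^sub>M \<mu>)"
    have dm: "(\<lambda>z. (fst z, decode (snd z))) \<in> \<mu> \<Otimes>\<^sub>M borel \<rightarrow>\<^sub>M \<mu> \<Otimes>\<^sub>M \<mu>"
      by (intro measurable_Pair) (auto intro: measurable_compose[OF measurable_snd dec])
    define B where "B = (\<lambda>z. (fst z, decode (snd z))) -` A \<inter> space (\<mu> \<Otimes>\<^sub>M borel)"
    have B: "B \<in> sets (\<mu> \<Otimes>\<^sub>M borel)" unfolding B_def by (rule measurable_sets[OF dm A])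
    have sp: "space \<mu> = UNIV" "space \<pi> = UNIV" using sets_eq_imp_space_eq[OF s\<mu>] sets_eq_imp_space_eq[OF s\<pi>] by (auto simp: space_pair_measure)
    \<comment> \<open>Decoding inverts coding, so the preimage of \<open>B\<close> under the coding
      is \<open>A\<close> again.\<close>
    have "emeasure \<pi> A = emeasure M B"
      unfolding M_def by (subst emeasure_distr[OF em B]) (simp add: B_def sp space_pair_measure decode_encode vimage_comp o_def)
    also have "\<dots> = (\<integral>\<^sup>+x. emeasure (\<kappa> x) (Pair x -` B) \<partial>\<mu>)" by (rule \<kappa>(2)[OF B])
    also have "\<dots> = (\<integral>\<^sup>+x. emeasure (distr (\<kappa> x) \<mu> decode) (Pair x -` A) \<partial>\<mu>)"
    proof (intro nn_integral_cong)
      fix x assume "x \<in> space \<mu>"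
      then have sk: "sets (\<kappa> x) = sets borel" using measurable_space[OF \<kappa>(1)] by (simp add: space_prob_algebra)
      have "decode \<in> \<kappa> x \<rightarrow>\<^sub>M \<mu>" using dec by (simp add: measurable_cong_sets[OF sk refl])
      moreover have "Pair x -` A \<in> sets \<mu>" by (rule sets_Pair1[OF A])
      moreover have "Pair x -` B = decode -` (Pair x -` A) \<inter> space (\<kappa> x)"
        using sets_eq_imp_space_eq[OF sk] by (auto simp: B_def sp space_pair_measure)
      ultimately show "emeasure (\<kappa> x) (Pair x -` B) = emeasure (distr (\<kappa> x) \<mu> decode) (Pair x -` A)"
        by (simp add: emeasure_distr)
    qed
    finally show "emeasure \<pi> A = (\<integral>\<^sup>+x. emeasure (distr (\<kappa> x) \<mu> decode) (Pair x -` A) \<partial>\<mu>)" .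
  qed
  from someI_ex[OF this] show "disintegration \<pi> \<mu> \<in> \<mu> \<rightarrow>\<^sub>M prob_algebra \<mu>"
    "A \<in> sets (\<mu> \<Otimes>\<^sub>M \<mu>) \<Longrightarrow> emeasure \<pi> A = (\<integral>\<^sup>+x. emeasure (disintegration \<pi> \<mu> x) (Pair x -` A) \<partial>\<mu>)"
    unfolding disintegration_def[symmetric] by blast+
qed

text \<open>The plan is the bind of \<mu> with the kernel that places \<open>\<kappa> x\<close> on
  the fibre over x, which brings in the integral formula for \<open>bind\<close>.\<close>

lemma nn_integral_disintegration:
  assumes \<mu>: "prob_space \<mu>" and s\<mu>: "sets \<mu> = sets (fwd_borel d)"
    and s\<pi>: "sets \<pi> = sets (\<mu> \<Otimes>\<^sub>M \<mu>)" and marg: "distr \<pi> \<mu> fst = \<mu>"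
    and H: "H \<in> borel_measurable (\<mu> \<Otimes>\<^sub>M \<mu>)"
  shows "(\<integral>\<^sup>+z. H z \<partial>\<pi>) = (\<integral>\<^sup>+x. (\<integral>\<^sup>+y. H (x, y) \<partial>disintegration \<pi> \<mu> x) \<partial>\<mu>)"
proof -
  define \<kappa> where "\<kappa> = disintegration \<pi> \<mu>"
  note dis = disintegration_exists[OF \<mu> s\<mu> s\<pi> marg, folded \<kappa>_def]
  have \<kappa>S: "\<kappa> \<in> \<mu> \<rightarrow>\<^sub>M subprob_algebra \<mu>" by (intro measurable_prob_algebraD dis)
  have ne: "space \<mu> \<noteq> {}" using prob_space.not_empty[OF \<mu>] .
  define P where "P x = distr (\<kappa> x) (\<mu> \<Otimes>\<^sub>M \<mu>) (Pair x)" for x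
  have PM: "P \<in> \<mu> \<rightarrow>\<^sub>M subprob_algebra (\<mu> \<Otimes>\<^sub>M \<mu>)"
    unfolding P_def[abs_def] by (rule measurable_distr2[OF _ \<kappa>S]) simp
  have sk: "sets (\<kappa> x) = sets \<mu>" if "x \<in> space \<mu>" for x
    using measurable_space[OF dis(1) that] by (simp add: space_prob_algebra)
  have pm: "Pair x \<in> \<kappa> x \<rightarrow>\<^sub>M \<mu> \<Otimes>\<^sub>M \<mu>" if "x \<in> space \<mu>" for x
    using that by (simp add: measurable_cong_sets[OF sk[OF that] refl])
  have "\<pi> = bind \<mu> P"
  proof (rule measure_eqI)
    show "sets \<pi> = sets (bind \<mu> P)" using s\<pi> ne by (simp add: sets_bind[of \<mu> P "\<mu> \<Otimes>\<^sub>M \<mu>"] P_def)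
    fix A assume "A \<in> sets \<pi>"
    then have A: "A \<in> sets (\<mu> \<Otimes>\<^sub>M \<mu>)" by (simp add: s\<pi>)
    show "emeasure \<pi> A = emeasure (bind \<mu> P) A"
      unfolding dis(2)[OF A] emeasure_bind[OF ne PM A]
    proof (intro nn_integral_cong)
      fix x assume x: "x \<in> space \<mu>"
      have "Pair x -` A \<inter> space (\<kappa> x) = Pair x -` A"
        using sets.sets_into_space[OF sets_Pair1[OF A, of x]] sets_eq_imp_space_eq[OF sk[OF x]] by auto
      then show "emeasure (\<kappa> x) (Pair x -` A) = emeasure (P x) A"
        unfolding P_def by (simp add: emeasure_distr[OF pm[OF x] A])
    qed
  qed
  then have "(\<integral>\<^sup>+z. H z \<partial>\<pi>) = (\<integral>\<^sup>+x. (\<integral>\<^sup>+z. H z \<partial>P x) \<partial>\<mu>)"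
    by (simp add: nn_integral_bind[OF H PM])
  also have "\<dots> = (\<integral>\<^sup>+x. (\<integral>\<^sup>+y. H (x, y) \<partial>\<kappa> x) \<partial>\<mu>)"
    by (intro nn_integral_cong) (simp add: P_def nn_integral_distr[OF pm] H)
  finally show ?thesis by (simp add: \<kappa>_def)
qed

end

section \<open>Entropy functionals\<close>

text \<open>Convexity of exp between 0 and ln (r / r0) gives (r / r0)^p \<le> 1 - p + p (r / r0),
  which is the claim divided by r0^p. The logarithm forces r = 0 to be treated apart.\<close>

lemma powr_le_tangent:
  fixes p r r0 :: real
  assumes "0 < p" "p < 1" "0 < r0" "0 \<le> r"
  shows "r powr p \<le> r0 powr p + p * r0 powr (p - 1) * (r - r0)"
proof (cases "r = 0")
  case True
  have "p * r0 powr (p - 1) * r0 = p * r0 powr p" using assms by (simp add: powr_diff)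
  then show ?thesis using True assms by (simp add: algebra_simps)
next
  case False
  then have r: "0 < r" using assms by simp
  have "exp ((1 - p) *\<^sub>R 0 + p *\<^sub>R ln (r / r0)) \<le> (1 - p) * exp 0 + p * exp (ln (r / r0))"
    using assms by (intro convex_onD[OF exp_convex]) auto
  then have "(r / r0) powr p \<le> 1 - p + p * (r / r0)" using r assms by (simp add: powr_def)
  then have "r0 powr p * (r / r0) powr p \<le> r0 powr p * (1 - p + p * (r / r0))"
    by (intro mult_left_mono) auto
  also have "r0 powr p * (r / r0) powr p = r powr p" using r assms by (simp add: powr_divide)
  also have "r0 powr p * (1 - p + p * (r / r0)) = r0 powr p + p * r0 powr (p - 1) * (r - r0)"
    using assms by (simp add: powr_diff field_simps)
  finally show ?thesis .
qed

section \<open>The power and square entropies\<close>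

definition U_power :: "real \<Rightarrow> real \<Rightarrow> real" where "U_power N r = - (r powr (1 - 1 / N))"

definition U_square :: "real \<Rightarrow> real" where "U_square r = r\<^sup>2"

text \<open>With p = 1 - 1 / N the pressure is r^p / N, so the quotient that has to be nondecreasing
  is constant: this entropy is a borderline member of the class.\<close>

lemma U_power_in_DC:
  assumes N: "1 < N" shows "U_power N \<in> DC N"
proof -
  define p where "p = 1 - 1 / N"
  have p: "0 < p" "p < 1" using N by (auto simp: p_def)
  have U: "U_power N = (\<lambda>r. - (r powr p))" by (auto simp: U_power_def p_def)
  have der: "(U_power N has_real_derivative - (p * r powr (p - 1))) (at r)" if "0 < r" for r
    unfolding U using that by (auto intro!: derivative_eq_intros simp: powr_diff)
  have deriv: "deriv (U_power N) r = - (p * r powr (p - 1))" if "0 < r" for r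
    using DERIV_imp_deriv[OF der[OF that]] .
  have der2: "(deriv (U_power N) has_real_derivative - (p * ((p - 1) * r powr (p - 2)))) (at r)" if r: "0 < r" for r
  proof (rule has_field_derivative_transform_within_open)
    show "((\<lambda>r. - (p * r powr (p - 1))) has_real_derivative - (p * ((p - 1) * r powr (p - 2)))) (at r)"
      using DERIV_minus[OF DERIV_cmult[OF has_real_derivative_powr[OF r, of "p - 1"], of p]] by simp
    show "open {0::real<..}" by simp
  qed (use r deriv in auto)
  have "convex_on {0..} (\<lambda>r. - (r powr p))"
  proof (rule convex_onI)
    fix t x y :: real assume t: "0 < t" "t < 1" and xy: "x \<in> {0..}" "y \<in> {0..}"
    define z where "z = (1 - t) * x + t * y"
    show "- (((1 - t) *\<^sub>R x + t *\<^sub>R y) powr p) \<le> (1 - t) * - (x powr p) + t * - (y powr p)"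
    proof (cases "z = 0")
      case True
      then have "x = 0" "y = 0" using t xy unfolding z_def
        by (auto simp: add_nonneg_eq_0_iff)
      then show ?thesis by simp
    next
      case False
      then have z: "0 < z" using t xy unfolding z_def by (simp add: less_le)
      define c where "c = p * z powr (p - 1)"
      have "(1 - t) * x powr p + t * y powr p
          \<le> (1 - t) * (z powr p + c * (x - z)) + t * (z powr p + c * (y - z))"
        unfolding c_def using t xy p z by (intro add_mono mult_left_mono powr_le_tangent) auto
      also have "\<dots> = z powr p" by (simp add: z_def algebra_simps)
      finally show ?thesis by (simp add: z_def)
    qed
  qed simp
  moreover have "continuous_on {0..} (\<lambda>r. - (r powr p))"
    using p by (intro continuous_intros continuous_on_powr') auto
  moreover have "pressure (U_power N) r / r powr (1 - 1 / N) = 1 - p" if "0 < r" for r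
    using that p unfolding pressure_def deriv[OF that] unfolding U by (simp add: powr_diff p_def[symmetric] field_simps)
  then have "mono_on {0<..} (\<lambda>r. pressure (U_power N) r / r powr (1 - 1 / N))"
    by (auto intro!: mono_onI)
  moreover have "continuous_on {0<..} (\<lambda>r. - (p * ((p - 1) * r powr (p - 2))))"
    by (intro continuous_intros) auto
  ultimately show ?thesis unfolding DC_def mem_Collect_eq using der deriv der2 p
    by (intro conjI exI[of _ "\<lambda>r. - (p * ((p - 1) * r powr (p - 2)))"]) (auto simp: U)
qed

text \<open>The pressure is r^2, hence the quotient r^(1 + 1 / N). The square is used for its
  superlinear growth, which makes singular mass cost infinity.\<close>

lemma U_square_in_DC:
  assumes N: "1 < N" shows "U_square \<in> DC N"
proof -
  have U: "U_square = (\<lambda>r. r\<^sup>2)" by (auto simp: U_square_def)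
  have der: "(U_square has_real_derivative 2 * r) (at r)" for r
    unfolding U by (auto intro!: derivative_eq_intros)
  have deriv: "deriv U_square = (\<lambda>r. 2 * r)" using DERIV_imp_deriv[OF der] by auto
  have "pressure U_square r / r powr (1 - 1 / N) = r powr (1 + 1 / N)" if "0 < r" for r
    using that unfolding pressure_def deriv U
    by (simp add: powr_diff powr_add power2_eq_square field_simps)
  then have "mono_on {0<..} (\<lambda>r. pressure U_square r / r powr (1 - 1 / N))"
    using N by (auto intro!: mono_onI powr_mono2)
  moreover have "convex_on {0..} (\<lambda>r::real. r\<^sup>2)"
    by (rule convex_on_subset[OF convex_power2]) auto
  moreover have "continuous_on {0..} (\<lambda>r::real. r\<^sup>2)" by (intro continuous_intros)
  moreover have "((\<lambda>r. 2 * r) has_real_derivative 2) (at r)" for r :: real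
    by (auto intro!: derivative_eq_intros)
  ultimately show ?thesis unfolding DC_def mem_Collect_eq using der deriv
    by (intro conjI exI[of _ "\<lambda>r. 2"]) (auto simp: U)
qed

lemma slope_infinity_U_power: "1 < N \<Longrightarrow> slope_infinity (U_power N) = 0"
proof -
  assume N: "1 < N"
  have "((\<lambda>r. U_power N r / r) \<longlongrightarrow> 0) at_top" unfolding U_power_def using N by real_asymp
  then have "((\<lambda>r. ereal (U_power N r / r)) \<longlongrightarrow> ereal 0) at_top" by (rule tendsto_ereal)
  then show ?thesis unfolding slope_infinity_def zero_ereal_def by (rule tendsto_Lim[rotated]) simp
qed

lemma tendsto_MInfty_of_at_bot:
  assumes "filterlim f at_bot F" shows "((\<lambda>x. ereal (f x)) \<longlongrightarrow> - \<infinity>) F"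
  unfolding tendsto_MInfty using assms by (simp add: filterlim_at_bot_dense)

lemma slope_zero_U_power: "1 < N \<Longrightarrow> slope_zero (U_power N) = - \<infinity>"
proof -
  assume N: "1 < N"
  have "filterlim (\<lambda>r. U_power N r / r) at_bot (at_right 0)" unfolding U_power_def using N by real_asymp
  then have "((\<lambda>r. ereal (U_power N r / r)) \<longlongrightarrow> - \<infinity>) (at_right 0)"
    by (rule tendsto_MInfty_of_at_bot)
  then show ?thesis unfolding slope_zero_def by (intro tendsto_Lim) auto
qed

lemma slope_infinity_U_square: "slope_infinity U_square = \<infinity>"
proof -
  have "filterlim (\<lambda>r. U_square r / r) at_top at_top" unfolding U_square_def by real_asymp
  then have "((\<lambda>r. ereal (U_square r / r)) \<longlongrightarrow> \<infinity>) at_top"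
    unfolding tendsto_PInfty_eq_at_top .
  then show ?thesis unfolding slope_infinity_def by (intro tendsto_Lim) auto
qed

lemma slope_zero_U_square: "slope_zero U_square = 0"
proof -
  have "((\<lambda>r. U_square r / r) \<longlongrightarrow> 0) (at_right 0)" unfolding U_square_def by real_asymp
  then have "((\<lambda>r. ereal (U_square r / r)) \<longlongrightarrow> ereal 0) (at_right 0)" by (rule tendsto_ereal)
  then show ?thesis unfolding slope_zero_def zero_ereal_def by (rule tendsto_Lim[rotated]) simp
qed

lemma distorted_U_power:
  assumes "1 < N" "0 \<le> r" "0 < b"
  shows "distorted (U_power N) r (ereal b) = ereal (- (r powr (1 - 1 / N) * b powr (1 / N)))"
  using assms by (simp add: distorted_def U_power_def powr_divide powr_diff)

lemma distorted_U_power_infinity: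
  assumes "1 < N" "0 < r" shows "distorted (U_power N) r \<infinity> = - \<infinity>"
  using assms by (simp add: distorted_def slope_zero_U_power)

lemma distorted_U_square: "0 < b \<Longrightarrow> distorted U_square r (ereal b) = ereal (r\<^sup>2 / b)"
  by (simp add: distorted_def U_square_def power2_eq_square)

lemma distorted_U_square_infinity: "distorted U_square r \<infinity> = 0"
  by (simp add: distorted_def slope_zero_U_square)

lemma distorted_U_power_nonpos:
  assumes "1 < N" "0 \<le> r" "0 < b" shows "distorted (U_power N) r b \<le> 0"
proof (cases b)
  case (real c)
  then show ?thesis using assms distorted_U_power[of N r c] by simp
next
  case PInf
  then show ?thesis using assms distorted_U_power_infinity[of N r] by (cases "r = 0") (auto simp: distorted_def simp flip: zero_ereal_def)
qed (use assms in auto)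

text \<open>In the two cases the distorted value is r^2 / b and - r^(1 - 1 / N) b^(1 / N), both
  nonincreasing in b.\<close>

lemma distorted_antimono:
  assumes "U = U_square \<or> U = U_power N" "1 < N" "0 \<le> r" "0 < b" "b \<le> b'" "b' \<noteq> \<infinity>"
  shows "distorted U r b' \<le> distorted U r b"
proof -
  obtain c c' where c: "b = ereal c" "b' = ereal c'" "0 < c" "c \<le> c'"
    using assms(4,5,6) by (cases b; cases b') auto
  then have "c powr (1 / N) \<le> c' powr (1 / N)" using assms by (intro powr_mono2) auto
  then show ?thesis using c assms
    by (auto simp: distorted_U_square distorted_U_power intro!: mult_left_mono divide_left_mono)
qed

text \<open>An infinite coefficient gives - \<infinity> for r > 0; a finite one has b^(1 / N) \<ge>
  exp (E / N) \<ge> 1 + E / N. The estimates for the power entropy keep only this minorant, which is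
  linear in E.\<close>

lemma e2ennreal_distorted_U_power_ge:
  assumes "1 < N" "0 \<le> r" and b: "b \<noteq> \<infinity> \<Longrightarrow> \<exists>c. b = ereal c \<and> exp E \<le> c"
  shows "ennreal (r powr (1 - 1 / N) * (1 + E / N)) \<le> e2ennreal (- distorted (U_power N) r b)"
proof (cases "b = \<infinity>")
  case True
  then show ?thesis using assms by (cases "r = 0") (auto simp: distorted_U_power_infinity)
next
  case False
  then obtain c where c: "b = ereal c" "exp E \<le> c" using b by blast
  then have c0: "0 < c" by (meson exp_gt_zero less_le_trans)
  have "1 + E / N \<le> exp (E / N)" by (rule exp_ge_add_one_self)
  also have "\<dots> = exp E powr (1 / N)" by (simp add: exp_powr_real)
  also have "\<dots> \<le> c powr (1 / N)" using c assms by (intro powr_mono2) auto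
  finally have "r powr (1 - 1 / N) * (1 + E / N) \<le> r powr (1 - 1 / N) * c powr (1 / N)"
    by (intro mult_left_mono) auto
  then show ?thesis using c(1) c0 assms by (simp add: distorted_U_power ennreal_leI)
qed

lemma U_beta_mono:
  assumes "\<And>x y. distorted U (ac_density \<nu> \<mu> x) (\<beta> x y) \<le> distorted U (ac_density \<nu> \<mu> x) (\<beta>' x y)"
  shows "U_beta U \<beta> \<pi> \<nu> \<mu> \<le> U_beta U \<beta>' \<pi> \<nu> \<mu>"
  unfolding U_beta_def Let_def using assms
  by (intro add_right_mono ereal_minus_mono) (auto simp: less_eq_ennreal.rep_eq[symmetric] intro!: nn_integral_mono e2ennreal_mono)

lemma tendsto_at_right_INF:
  fixes F :: "real \<Rightarrow> ereal"
  assumes "\<And>x y. N < x \<Longrightarrow> x \<le> y \<Longrightarrow> F x \<le> F y"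
  shows "(F \<longlongrightarrow> (INF x\<in>{N<..}. F x)) (at_right N)"
proof (rule order_tendstoI)
  fix a assume a: "a < (INF x\<in>{N<..}. F x)"
  show "\<forall>\<^sub>F x in at_right N. a < F x"
    unfolding eventually_at_right_field
    by (intro exI[of _ "N + 1"]) (auto intro: less_le_trans[OF a INF_lower])
next
  fix a assume "(INF x\<in>{N<..}. F x) < a"
  then obtain y where "N < y" "F y < a" unfolding INF_less_iff by auto
  then show "\<forall>\<^sub>F x in at_right N. F x < a"
    unfolding eventually_at_right_field by (intro exI[of _ y]) (meson assms le_less_trans less_imp_le)
qed

text \<open>In the borderline case the limit in the definition exists by monotonicity, so the bounds for
  \<open>N' > N\<close> pass to it.\<close>

lemma U_beta_KN_le:
  assumes le: "\<And>N'. N \<le> N' \<Longrightarrow> U_beta U (\<beta> N') \<pi> \<nu> \<mu> \<le> B"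
    and mono: "\<And>N1 N2 x y. (\<And>x y. d x y \<le> diam_bound K N) \<Longrightarrow> N < N1 \<Longrightarrow> N1 \<le> N2 \<Longrightarrow>
      distorted U (ac_density \<nu> \<mu> x) (\<beta> N1 x y) \<le> distorted U (ac_density \<nu> \<mu> x) (\<beta> N2 x y)"
  shows "U_beta_KN d K N U \<beta> \<pi> \<nu> \<mu> \<le> B"
proof (cases "(SUP (x, y)\<in>UNIV. ereal (d x y)) = ereal (diam_bound K N)")
  case True
  have "d x y \<le> diam_bound K N" for x y
  proof -
    have "ereal (d x y) \<le> (SUP (x, y)\<in>UNIV. ereal (d x y))"
      by (rule SUP_upper2[of "(x, y)"]) auto
    then show ?thesis unfolding True by simp
  qed
  note m = mono[OF this]
  have "((\<lambda>N'. U_beta U (\<beta> N') \<pi> \<nu> \<mu>) \<longlongrightarrow> (INF N'\<in>{N<..}. U_beta U (\<beta> N') \<pi> \<nu> \<mu>)) (at_right N)"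
    by (intro tendsto_at_right_INF U_beta_mono m)
  then have "U_beta_KN d K N U \<beta> \<pi> \<nu> \<mu> = (INF N'\<in>{N<..}. U_beta U (\<beta> N') \<pi> \<nu> \<mu>)"
    unfolding U_beta_KN_def using True by (simp add: tendsto_Lim)
  \<comment> \<open>As the limit is an infimum, a single parameter above N suffices to bound
    it.\<close>
  also have "\<dots> \<le> U_beta U (\<beta> (N + 1)) \<pi> \<nu> \<mu>" by (intro INF_lower) auto
  also have "\<dots> \<le> B" by (rule le) simp
  finally show ?thesis .
qed (simp add: U_beta_KN_def le)

text \<open>Exhaustion: \<open>B\<close> is a \<nu>-null set of maximal \<mu>-mass, attained by a
  countable union. The part of \<mu> inside \<open>B\<close> is singular, and the part outside is
  absolutely continuous.\<close>

lemma lebesgue_decomposition_exists: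
  assumes \<nu>: "sigma_finite_measure \<nu>" and \<mu>: "finite_measure \<mu>" and s: "sets \<mu> = sets \<nu>"
  shows "\<exists>\<rho> \<mu>s. lebesgue_decomposition \<nu> \<mu> \<rho> \<mu>s"
proof -
  interpret \<nu>: sigma_finite_measure \<nu> by fact
  interpret \<mu>: finite_measure \<mu> by fact
  note s[measurable_cong]
  have sp: "space \<mu> = space \<nu>" using s by (rule sets_eq_imp_space_eq)
  obtain f :: "nat \<Rightarrow> ennreal" where f: "range f \<subseteq> emeasure \<mu> ` null_sets \<nu>"
    "Sup (emeasure \<mu> ` null_sets \<nu>) = Sup (range f)"
    using ennreal_Sup_countable_SUP[of "emeasure \<mu> ` null_sets \<nu>"] null_sets.empty_sets[of \<nu>] by blast
  have "\<forall>n. \<exists>C. C \<in> null_sets \<nu> \<and> f n = emeasure \<mu> C" using f(1) by blast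
  then obtain A where A: "\<And>n. A n \<in> null_sets \<nu>" "\<And>n. f n = emeasure \<mu> (A n)" by metis
  define B where "B = (\<Union>n. A n)"
  have B: "B \<in> null_sets \<nu>" unfolding B_def using A by auto
  then have Bs[measurable]: "B \<in> sets \<mu>" using s by (auto simp: null_sets_def)
  have max: "emeasure \<mu> C \<le> emeasure \<mu> B" if "C \<in> null_sets \<nu>" for C
  proof -
    have "emeasure \<mu> C \<le> Sup (range f)" unfolding f(2)[symmetric] using that by (intro SUP_upper)
    also have "\<dots> \<le> emeasure \<mu> B"
      using A Bs by (intro SUP_least) (auto simp: B_def intro!: emeasure_mono)
    finally show ?thesis .
  qed
  define \<mu>1 where "\<mu>1 = density \<mu> (indicator (space \<mu> - B))"
  have \<mu>1: "emeasure \<mu>1 C = emeasure \<mu> (C - B)" if "C \<in> sets \<mu>" for C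
  proof -
    have "emeasure \<mu>1 C = emeasure \<mu> ((space \<mu> - B) \<inter> C)"
      unfolding \<mu>1_def using that by (subst emeasure_restricted) auto
    also have "(space \<mu> - B) \<inter> C = C - B" using sets.sets_into_space[OF that] by auto
    finally show ?thesis .
  qed
  have s1: "sets \<mu>1 = sets \<nu>" by (simp add: \<mu>1_def s)
  have ac: "absolutely_continuous \<nu> \<mu>1"
    unfolding absolutely_continuous_def
  proof
    fix C assume C: "C \<in> null_sets \<nu>"
    then have Cs: "C \<in> sets \<mu>" using s by auto
    \<comment> \<open>The union of \<open>B\<close> with the null set \<open>C\<close> is again a
      null set, so by maximality it has no more \<mu>-mass than \<open>B\<close>.\<close>
    have "emeasure \<mu> B + emeasure \<mu> (C - B) = emeasure \<mu> (B \<union> (C - B))"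
      using Cs by (intro plus_emeasure) auto
    also have "\<dots> \<le> emeasure \<mu> B" using B C by (intro max) (simp add: Un_Diff_cancel null_sets.Un)
    finally have "emeasure \<mu> (C - B) = 0"
      using \<mu>.emeasure_finite[of B] by (metis add.right_neutral ennreal_add_left_cancel_le le_zero_eq infinity_ennreal_def)
    then show "C \<in> null_sets \<mu>1" using Cs \<mu>1[OF Cs] s1 s by (simp add: null_sets_def)
  qed
  have "emeasure \<mu>1 (space \<mu>1) \<noteq> \<infinity>"
    using \<mu>1[of "space \<mu>"] by (simp add: \<mu>1_def)
  then have "finite_measure \<mu>1" by (rule finite_measureI)
  then have sf1: "sigma_finite_measure \<mu>1" by (rule finite_measure.axioms)
  define \<rho> where "\<rho> x = enn2real (RN_deriv \<nu> \<mu>1 x)" for x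
  have "AE x in \<nu>. ennreal (\<rho> x) = RN_deriv \<nu> \<mu>1 x"
    using \<nu>.RN_deriv_finite[OF sf1 ac s1] by eventually_elim (simp add: \<rho>_def less_top)
  then have "density \<nu> (\<lambda>x. ennreal (\<rho> x)) = density \<nu> (RN_deriv \<nu> \<mu>1)"
    by (intro density_cong) (auto simp: \<rho>_def)
  also have "\<dots> = \<mu>1" by (rule \<nu>.density_RN_deriv[OF ac s1])
  finally have dens: "density \<nu> (\<lambda>x. ennreal (\<rho> x)) = \<mu>1" .
  define \<mu>s where "\<mu>s = density \<mu> (indicator B)"
  have \<mu>s: "emeasure \<mu>s C = emeasure \<mu> (B \<inter> C)" if "C \<in> sets \<mu>" for C
    unfolding \<mu>s_def using that by (subst emeasure_restricted) auto
  have "lebesgue_decomposition \<nu> \<mu> \<rho> \<mu>s"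
    unfolding lebesgue_decomposition_def dens
  proof (intro conjI allI ballI bexI[of _ B])
    show "\<rho> \<in> borel_measurable \<nu>" unfolding \<rho>_def by measurable
    show "sets \<mu>s = sets \<nu>" by (simp add: \<mu>s_def s)
    show "emeasure \<nu> B = 0" using B by auto
    have "space \<nu> - B \<in> sets \<mu>" using Bs s sp by (metis sets.compl_sets)
    then show "emeasure \<mu>s (space \<nu> - B) = 0" by (simp add: \<mu>s)
    show "B \<in> sets \<nu>" using B by auto
    fix C assume "C \<in> sets \<nu>"
    then have C: "C \<in> sets \<mu>" by (simp add: s)
    have "emeasure \<mu> C = emeasure \<mu> ((C - B) \<union> (B \<inter> C))" by (intro arg_cong[where f = "emeasure \<mu>"]) auto
    also have "\<dots> = emeasure \<mu> (C - B) + emeasure \<mu> (B \<inter> C)"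
      using C by (intro plus_emeasure[symmetric]) auto
    finally show "emeasure \<mu> C = emeasure \<mu>1 C + emeasure \<mu>s C" using \<mu>1[OF C] \<mu>s[OF C] by simp
  qed (simp add: \<rho>_def)
  then show ?thesis by blast
qed

lemma
  assumes "sigma_finite_measure \<nu>" "finite_measure \<mu>" "sets \<mu> = sets \<nu>"
  shows ac_density_decomposition: "\<exists>\<mu>s. lebesgue_decomposition \<nu> \<mu> (ac_density \<nu> \<mu>) \<mu>s"
    and singular_part_decomposition: "\<exists>\<rho>. lebesgue_decomposition \<nu> \<mu> \<rho> (singular_part \<nu> \<mu>)"
proof -
  have ex: "\<exists>\<rho> \<mu>s. lebesgue_decomposition \<nu> \<mu> \<rho> \<mu>s" by (rule lebesgue_decomposition_exists[OF assms])
  then show "\<exists>\<mu>s. lebesgue_decomposition \<nu> \<mu> (ac_density \<nu> \<mu>) \<mu>s"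
    unfolding ac_density_def by (rule someI_ex)
  from ex have "\<exists>\<mu>s \<rho>. lebesgue_decomposition \<nu> \<mu> \<rho> \<mu>s" by blast
  then show "\<exists>\<rho>. lebesgue_decomposition \<nu> \<mu> \<rho> (singular_part \<nu> \<mu>)"
    unfolding singular_part_def by (rule someI_ex)
qed

text \<open>Uniqueness: the null set that carries the singular part has no mass for a measure with a
  density. So the singular part vanishes, and the two densities define the same measure.\<close>

lemma lebesgue_decomposition_density:
  assumes \<nu>: "sigma_finite_measure \<nu>" and \<rho>0: "\<rho>0 \<in> borel_measurable \<nu>" "\<And>x. 0 \<le> \<rho>0 x"
    and dec: "lebesgue_decomposition \<nu> (density \<nu> (\<lambda>x. ennreal (\<rho>0 x))) \<rho> \<mu>s"
  shows "emeasure \<mu>s (space \<nu>) = 0" "AE x in \<nu>. \<rho> x = \<rho>0 x"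
proof -
  interpret \<nu>: sigma_finite_measure \<nu> by fact
  let ?\<mu> = "density \<nu> (\<lambda>x. ennreal (\<rho>0 x))"
  note [measurable] = \<rho>0(1)
  obtain A where A: "A \<in> sets \<nu>" "emeasure \<nu> A = 0" "emeasure \<mu>s (space \<nu> - A) = 0"
    using dec by (auto simp: lebesgue_decomposition_def)
  have s: "sets \<mu>s = sets \<nu>" and \<rho>[measurable]: "\<rho> \<in> borel_measurable \<nu>" and \<rho>n: "\<And>x. 0 \<le> \<rho> x"
    using dec by (auto simp: lebesgue_decomposition_def)
  have eq: "emeasure ?\<mu> C = emeasure (density \<nu> (\<lambda>x. ennreal (\<rho> x))) C + emeasure \<mu>s C" if "C \<in> sets \<nu>" for C
    using dec that unfolding lebesgue_decomposition_def by blast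
  have "absolutely_continuous \<nu> ?\<mu>" by (rule absolutely_continuousI_density) measurable
  from absolutely_continuousD[OF this A(1,2)] have "emeasure ?\<mu> A = 0" .
  then have "emeasure \<mu>s A = 0" using eq[OF A(1)] by simp
  moreover have "emeasure \<mu>s (space \<nu>) = emeasure \<mu>s A + emeasure \<mu>s (space \<nu> - A)"
  proof -
    have "A \<union> (space \<nu> - A) = space \<nu>" using sets.sets_into_space[OF A(1)] by blast
    moreover have "emeasure \<mu>s A + emeasure \<mu>s (space \<nu> - A) = emeasure \<mu>s (A \<union> (space \<nu> - A))"
      using A(1) by (intro plus_emeasure) (auto simp: s)
    ultimately show ?thesis by simp
  qed
  ultimately show z: "emeasure \<mu>s (space \<nu>) = 0" using A by simp
  have "emeasure \<mu>s C = 0" if "C \<in> sets \<nu>" for C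
    using emeasure_mono[of C "space \<nu>" \<mu>s] sets.sets_into_space[OF that] s z by simp
  then have "density \<nu> (\<lambda>x. ennreal (\<rho> x)) = ?\<mu>"
    using eq by (intro measure_eqI[OF _]) simp_all
  moreover have "(\<lambda>x. ennreal (\<rho> x)) \<in> borel_measurable \<nu>" "(\<lambda>x. ennreal (\<rho>0 x)) \<in> borel_measurable \<nu>"
    by measurable
  ultimately have "AE x in \<nu>. ennreal (\<rho> x) = ennreal (\<rho>0 x)"
    using \<nu>.density_unique_iff by blast
  moreover have "ennreal (\<rho> x) = ennreal (\<rho>0 x) \<longleftrightarrow> \<rho> x = \<rho>0 x" for x
    by (rule ennreal_inj[OF \<rho>n \<rho>0(2)])
  ultimately show "AE x in \<nu>. \<rho> x = \<rho>0 x" by simp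
qed

context boundedly_compact_space
begin

section \<open>Distorted functionals of absolutely continuous measures\<close>

context
  fixes \<nu> \<mu> :: "'a measure" and \<pi> :: "('a \<times> 'a) measure" and \<rho>0 :: "'a \<Rightarrow> real"
  assumes \<nu>: "sigma_finite_measure \<nu>" and s\<nu>: "sets \<nu> = sets (fwd_borel d)"
    and \<rho>0: "\<rho>0 \<in> borel_measurable \<nu>" "\<And>x. 0 \<le> \<rho>0 x"
    and \<mu>: "\<mu> = density \<nu> (\<lambda>x. ennreal (\<rho>0 x))" and prob: "prob_space \<mu>"
    and s\<pi>: "sets \<pi> = sets (\<mu> \<Otimes>\<^sub>M \<mu>)" and marg: "distr \<pi> \<mu> fst = \<mu>"
begin

lemma ac_density_eq: "AE x in \<nu>. ac_density \<nu> \<mu> x = \<rho>0 x"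
  and singular_part_eq: "emeasure (singular_part \<nu> \<mu>) (space \<nu>) = 0"
proof -
  have s\<mu>: "sets \<mu> = sets \<nu>" by (simp add: \<mu>)
  have fin: "finite_measure \<mu>" using prob by (rule prob_space.finite_measure)
  show "AE x in \<nu>. ac_density \<nu> \<mu> x = \<rho>0 x"
    using ac_density_decomposition[OF \<nu> fin s\<mu>] lebesgue_decomposition_density(2)[OF \<nu> \<rho>0] unfolding \<mu> by blast
  show "emeasure (singular_part \<nu> \<mu>) (space \<nu>) = 0"
    using singular_part_decomposition[OF \<nu> fin s\<mu>] lebesgue_decomposition_density(1)[OF \<nu> \<rho>0] unfolding \<mu> by blast
qed

text \<open>The functional integrates over \<nu> and not over \<mu>, so the density is moved into
  the inner integral. Where it is 0 the arbitrarily chosen kernel contributes nothing.\<close>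

lemma nn_integral_plan:
  assumes H: "H \<in> borel_measurable (fwd_borel d \<Otimes>\<^sub>M fwd_borel d)"
  shows "(\<integral>\<^sup>+z. H z \<partial>\<pi>) = (\<integral>\<^sup>+x. (\<integral>\<^sup>+y. ennreal (\<rho>0 x) * H (x, y) \<partial>disintegration \<pi> \<mu> x) \<partial>\<nu>)"
proof -
  have s\<mu>: "sets \<mu> = sets (fwd_borel d)" by (simp add: \<mu> s\<nu>)
  have sp: "sets (\<mu> \<Otimes>\<^sub>M \<mu>) = sets (fwd_borel d \<Otimes>\<^sub>M fwd_borel d)" by (intro sets_pair_measure_cong s\<mu>)
  have H': "H \<in> borel_measurable (\<mu> \<Otimes>\<^sub>M \<mu>)" using H by (simp add: measurable_cong_sets[OF sp refl])
  note dis = disintegration_exists[OF prob s\<mu> s\<pi> marg]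
  have kS: "disintegration \<pi> \<mu> \<in> \<mu> \<rightarrow>\<^sub>M subprob_algebra \<mu>" by (intro measurable_prob_algebraD dis)
  have inner: "(\<lambda>x. \<integral>\<^sup>+y. H (x, y) \<partial>disintegration \<pi> \<mu> x) \<in> borel_measurable \<mu>"
    using H' by (intro nn_integral_measurable_subprob_algebra2[OF _ kS]) simp
  have "(\<integral>\<^sup>+z. H z \<partial>\<pi>) = (\<integral>\<^sup>+x. (\<integral>\<^sup>+y. H (x, y) \<partial>disintegration \<pi> \<mu> x) \<partial>\<mu>)"
    by (rule nn_integral_disintegration[OF prob s\<mu> s\<pi> marg H'])
  also have "\<dots> = (\<integral>\<^sup>+x. ennreal (\<rho>0 x) * (\<integral>\<^sup>+y. H (x, y) \<partial>disintegration \<pi> \<mu> x) \<partial>\<nu>)"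
    using inner \<rho>0 unfolding \<mu> by (subst nn_integral_density) auto
  also have "\<dots> = (\<integral>\<^sup>+x. (\<integral>\<^sup>+y. ennreal (\<rho>0 x) * H (x, y) \<partial>disintegration \<pi> \<mu> x) \<partial>\<nu>)"
  proof (intro nn_integral_cong)
    fix x assume "x \<in> space \<nu>"
    then have x: "x \<in> space \<mu>" by (simp add: \<mu>)
    then have "sets (disintegration \<pi> \<mu> x) = sets \<mu>"
      using measurable_space[OF dis(1)] by (simp add: space_prob_algebra)
    then have "(\<lambda>y. H (x, y)) \<in> borel_measurable (disintegration \<pi> \<mu> x)"
      using measurable_compose[OF measurable_Pair1'[OF x] H'] measurable_cong_sets[of "disintegration \<pi> \<mu> x" \<mu> borel borel]
      by blast
    then show "ennreal (\<rho>0 x) * (\<integral>\<^sup>+y. H (x, y) \<partial>disintegration \<pi> \<mu> x)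
        = (\<integral>\<^sup>+y. ennreal (\<rho>0 x) * H (x, y) \<partial>disintegration \<pi> \<mu> x)"
      by (simp add: nn_integral_cmult)
  qed
  finally show ?thesis .
qed

text \<open>For the power entropy the positive part vanishes and so does the slope at infinity. What
  remains is the negative part, and a minorant of it of the form \<rho>0 H integrates to the
  integral of H against the plan.\<close>

lemma U_beta_power_le:
  assumes N: "1 < N" and H: "H \<in> borel_measurable (fwd_borel d \<Otimes>\<^sub>M fwd_borel d)"
    and \<beta>: "\<And>x y. 0 < \<beta> x y"
    and le: "\<And>x y. ennreal (\<rho>0 x) * H (x, y) \<le> e2ennreal (- distorted (U_power N) (\<rho>0 x) (\<beta> x y))"
  shows "U_beta (U_power N) \<beta> \<pi> \<nu> \<mu> \<le> - enn2ereal (\<integral>\<^sup>+z. H z \<partial>\<pi>)"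
proof -
  let ?\<rho> = "ac_density \<nu> \<mu>" and ?\<kappa> = "disintegration \<pi> \<mu>"
  have z: "(\<integral>\<^sup>+x. (\<integral>\<^sup>+y. e2ennreal (distorted (U_power N) (?\<rho> x) (\<beta> x y)) \<partial>?\<kappa> x) \<partial>\<nu>) = 0"
  proof -
    have "(\<integral>\<^sup>+x. (\<integral>\<^sup>+y. e2ennreal (distorted (U_power N) (?\<rho> x) (\<beta> x y)) \<partial>?\<kappa> x) \<partial>\<nu>) = (\<integral>\<^sup>+x. 0 \<partial>\<nu>)"
    proof (rule nn_integral_cong_AE, use ac_density_eq in eventually_elim)
      case (elim x)
      have "e2ennreal (distorted (U_power N) (?\<rho> x) (\<beta> x y)) = 0" for y
        using distorted_U_power_nonpos[OF N \<rho>0(2) \<beta>] by (simp add: elim e2ennreal_neg)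
      then show ?case by simp
    qed
    then show ?thesis by simp
  qed
  have "(\<integral>\<^sup>+z. H z \<partial>\<pi>) \<le> (\<integral>\<^sup>+x. (\<integral>\<^sup>+y. e2ennreal (- distorted (U_power N) (?\<rho> x) (\<beta> x y)) \<partial>?\<kappa> x) \<partial>\<nu>)"
    unfolding nn_integral_plan[OF H]
    by (rule nn_integral_mono_AE, use ac_density_eq in eventually_elim) (auto intro!: nn_integral_mono le)
  then have "- enn2ereal (\<integral>\<^sup>+x. (\<integral>\<^sup>+y. e2ennreal (- distorted (U_power N) (?\<rho> x) (\<beta> x y)) \<partial>?\<kappa> x) \<partial>\<nu>)
      \<le> - enn2ereal (\<integral>\<^sup>+z. H z \<partial>\<pi>)"
    by (simp add: less_eq_ennreal.rep_eq)
  then show ?thesis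
    unfolding U_beta_def Let_def z singular_part_eq by (simp add: slope_infinity_U_power[OF N] zero_ennreal.rep_eq)
qed

text \<open>The kernel consists of probability measures, so a bound independent of y passes through
  the inner integral. The singular part contributes nothing, although its coefficient is
  infinite.\<close>

lemma U_beta_square_le:
  assumes le: "\<And>x y. distorted U_square (\<rho>0 x) (\<beta> x y) \<le> ereal ((\<rho>0 x)\<^sup>2)"
    and nonneg: "\<And>x y. 0 \<le> distorted U_square (\<rho>0 x) (\<beta> x y)"
  shows "U_beta U_square \<beta> \<pi> \<nu> \<mu> \<le> enn2ereal (\<integral>\<^sup>+x. ennreal ((\<rho>0 x)\<^sup>2) \<partial>\<nu>)"
proof -
  let ?\<rho> = "ac_density \<nu> \<mu>" and ?\<kappa> = "disintegration \<pi> \<mu>"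
  have s\<mu>: "sets \<mu> = sets (fwd_borel d)" by (simp add: \<mu> s\<nu>)
  note dis = disintegration_exists[OF prob s\<mu> s\<pi> marg]
  have "(\<integral>\<^sup>+x. (\<integral>\<^sup>+y. e2ennreal (distorted U_square (?\<rho> x) (\<beta> x y)) \<partial>?\<kappa> x) \<partial>\<nu>)
      \<le> (\<integral>\<^sup>+x. ennreal ((\<rho>0 x)\<^sup>2) \<partial>\<nu>)"
  proof (rule nn_integral_mono_AE, use ac_density_eq AE_space in eventually_elim)
    case (elim x)
    then have "x \<in> space \<mu>" by (simp add: \<mu>)
    then interpret k: prob_space "?\<kappa> x" using measurable_space[OF dis(1)] by (simp add: space_prob_algebra)
    have "(\<integral>\<^sup>+y. e2ennreal (distorted U_square (?\<rho> x) (\<beta> x y)) \<partial>?\<kappa> x) \<le> (\<integral>\<^sup>+y. ennreal ((\<rho>0 x)\<^sup>2) \<partial>?\<kappa> x)"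
      unfolding elim using e2ennreal_mono[OF le] by (intro nn_integral_mono) (simp add: )
    then show ?case by (simp add: k.emeasure_space_1)
  qed
  moreover have "0 \<le> enn2ereal (\<integral>\<^sup>+x. (\<integral>\<^sup>+y. e2ennreal (- distorted U_square (?\<rho> x) (\<beta> x y)) \<partial>?\<kappa> x) \<partial>\<nu>)" by simp
  ultimately have "enn2ereal (\<integral>\<^sup>+x. (\<integral>\<^sup>+y. e2ennreal (distorted U_square (?\<rho> x) (\<beta> x y)) \<partial>?\<kappa> x) \<partial>\<nu>)
      - enn2ereal (\<integral>\<^sup>+x. (\<integral>\<^sup>+y. e2ennreal (- distorted U_square (?\<rho> x) (\<beta> x y)) \<partial>?\<kappa> x) \<partial>\<nu>)
      \<le> enn2ereal (\<integral>\<^sup>+x. ennreal ((\<rho>0 x)\<^sup>2) \<partial>\<nu>) - 0"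
    by (intro ereal_minus_mono) (auto simp: less_eq_ennreal.rep_eq)
  then show ?thesis
    unfolding U_beta_def Let_def singular_part_eq by (simp add: zero_ennreal.rep_eq)
qed

end

end

section \<open>Weak curvature-dimension spaces\<close>

lemma irreversible_metric_flip: "irreversible_metric d \<Longrightarrow> irreversible_metric (\<lambda>x y. d y x)"
  unfolding irreversible_metric_def by (metis add.commute)

lemma beta_KN_flip: "beta_KN (\<lambda>x y. d y x) K N t x y = beta_KN d K N t y x"
  by (auto simp: beta_KN_def)

lemma beta_KN_pos:
  assumes "irreversible_metric d" "0 < K" "1 < N" "0 < t" "t < 1"
  shows "0 < beta_KN d K N t x y"
proof (cases "beta_KN d K N t x y = \<infinity>")
  case False
  then obtain b where "beta_KN d K N t x y = ereal b" "exp (K * (d x y)\<^sup>2 * (1 - t\<^sup>2) / 6) \<le> b"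
    using beta_KN_lower_bound[OF assms] by metis
  then show ?thesis by (simp add: less_le_trans[OF exp_gt_zero])
qed simp

lemma diam_bound_strict_mono:
  assumes "0 < K" "1 < N" "N < N'" shows "diam_bound K N < diam_bound K N'"
  using assms by (simp add: diam_bound_def divide_strict_right_mono)

locale weak_CD_space =
  fixes d :: "'a \<Rightarrow> 'a \<Rightarrow> real" and \<nu> :: "'a measure" and K N :: real
  assumes K: "0 < K" and N: "1 < N" and CD: "weak_CD d \<nu> K N"
begin

sublocale boundedly_compact_space d
  using CD by unfold_locales (auto simp: weak_CD_def forward_geodesic_space_def)

lemma sigma_finite: "sigma_finite_measure \<nu>" and locally_finite: "locally_finite_borel_measure d \<nu>"
  and sets_nu [measurable_cong]: "sets \<nu> = sets (fwd_borel d)"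
  using CD by (auto simp: weak_CD_def locally_finite_borel_measure_def)

lemma space_nu [simp]: "space \<nu> = UNIV"
  using sets_eq_imp_space_eq[OF sets_nu] by simp

lemma UNIV_sets [simp]: "UNIV \<in> sets \<nu>" "UNIV \<in> sets (fwd_borel d)"
  using sets.top[of \<nu>] sets.top[of "fwd_borel d"] by simp_all

text \<open>The reversed coefficients are rewritten as the coefficients of the reverse distance, so
  that one family of estimates serves both ends of the transport.\<close>

lemma weak_CD_plan:
  assumes "admissible_marginal d \<nu> \<mu>0" "admissible_marginal d \<nu> \<mu>1"
  obtains P where "dynamical_optimal_plan d P" "eval_at d P 0 = \<mu>0" "eval_at d P 1 = \<mu>1"
    "\<And>U t. U \<in> DC N \<Longrightarrow> 0 \<le> t \<Longrightarrow> t \<le> 1 \<Longrightarrow> U_functional U \<nu> (eval_at d P t) \<le>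
        ereal (1 - t) * U_beta_KN d K N U (\<lambda>N'. beta_KN d K N' (1 - t)) (endpoint_plan d P) \<nu> \<mu>0
      + ereal t * U_beta_KN d K N U (\<lambda>N'. beta_KN (\<lambda>x y. d y x) K N' t)
          (distr (endpoint_plan d P) (fwd_borel d \<Otimes>\<^sub>M fwd_borel d) prod.swap) \<nu> \<mu>1"
proof -
  obtain \<mu> \<pi> where *: "displacement_interpolation d \<mu> \<pi>" "\<mu> 0 = \<mu>0" "\<mu> 1 = \<mu>1"
    "\<forall>U\<in>DC N. \<forall>t\<in>{0..1}. U_functional U \<nu> (\<mu> t) \<le>
        ereal (1 - t) * U_beta_KN d K N U (\<lambda>N'. beta_KN d K N' (1 - t)) \<pi> \<nu> \<mu>0
      + ereal t * U_beta_KN d K N U (\<lambda>N' x y. beta_KN d K N' t y x)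
          (distr \<pi> (fwd_borel d \<Otimes>\<^sub>M fwd_borel d) prod.swap) \<nu> \<mu>1"
    using CD assms unfolding weak_CD_def by blast
  obtain P where P: "dynamical_optimal_plan d P" "\<forall>t\<in>{0..1}. \<mu> t = eval_at d P t" "\<pi> = endpoint_plan d P"
    using *(1) unfolding displacement_interpolation_def by blast
  show ?thesis
  proof (rule that[OF P(1)])
    show "eval_at d P 0 = \<mu>0" "eval_at d P 1 = \<mu>1" using P(2) *(2,3) by auto
    have flip: "(\<lambda>N'. beta_KN (\<lambda>x y. d y x) K N' t) = (\<lambda>N' x y. beta_KN d K N' t y x)" for t
      by (intro ext beta_KN_flip)
    show "U_functional U \<nu> (eval_at d P t) \<le>
        ereal (1 - t) * U_beta_KN d K N U (\<lambda>N'. beta_KN d K N' (1 - t)) (endpoint_plan d P) \<nu> \<mu>0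
      + ereal t * U_beta_KN d K N U (\<lambda>N'. beta_KN (\<lambda>x y. d y x) K N' t)
          (distr (endpoint_plan d P) (fwd_borel d \<Otimes>\<^sub>M fwd_borel d) prod.swap) \<nu> \<mu>1"
      if "U \<in> DC N" "0 \<le> t" "t \<le> 1" for U t
    proof -
      have "t \<in> {0..1}" using that by simp
      then have "eval_at d P t = \<mu> t" using P(2) by simp
      note eq = this P(3)[symmetric] flip
      from *(4) \<open>U \<in> DC N\<close> have "\<forall>t\<in>{0..1}. U_functional U \<nu> (\<mu> t) \<le>
          ereal (1 - t) * U_beta_KN d K N U (\<lambda>N'. beta_KN d K N' (1 - t)) \<pi> \<nu> \<mu>0
        + ereal t * U_beta_KN d K N U (\<lambda>N' x y. beta_KN d K N' t y x)
            (distr \<pi> (fwd_borel d \<Otimes>\<^sub>M fwd_borel d) prod.swap) \<nu> \<mu>1" by (rule bspec)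
      from bspec[OF this \<open>t \<in> {0..1}\<close>] show ?thesis unfolding eq .
    qed
  qed
qed

section \<open>Dynamical plans as random geodesics\<close>

context
  fixes P :: "(real \<Rightarrow> 'a) measure"
  assumes P: "dynamical_optimal_plan d P"
begin

lemma prob_P: "prob_space P" and sets_P: "sets P = sets (geodesic_algebra d)"
  using P by (auto simp: dynamical_optimal_plan_def)

lemma space_P: "\<gamma> \<in> space P \<Longrightarrow> \<gamma> \<in> geodesics d"
  using sets_eq_imp_space_eq[OF sets_P] by (simp add: geodesic_algebra_def space_restrict_space)

lemma geodesic_d: "\<gamma> \<in> space P \<Longrightarrow> 0 \<le> s \<Longrightarrow> s \<le> t \<Longrightarrow> t \<le> 1 \<Longrightarrow> d (\<gamma> s) (\<gamma> t) = (t - s) * d (\<gamma> 0) (\<gamma> 1)"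
  using space_P[of \<gamma>] unfolding geodesics_def by blast

lemma measurable_eval:
  assumes "0 \<le> t" "t \<le> 1" shows "(\<lambda>\<gamma>. \<gamma> t) \<in> P \<rightarrow>\<^sub>M fwd_borel d"
proof -
  have "(\<lambda>\<gamma>. \<gamma> t) \<in> geodesic_algebra d \<rightarrow>\<^sub>M fwd_borel d"
    unfolding geodesic_algebra_def using assms
    by (intro measurable_restrict_space1 measurable_component_singleton) auto
  then show ?thesis by (simp add: measurable_cong_sets[OF sets_P refl])
qed

lemma measurable_eval_01 [measurable]: "(\<lambda>\<gamma>. \<gamma> 0) \<in> P \<rightarrow>\<^sub>M fwd_borel d" "(\<lambda>\<gamma>. \<gamma> 1) \<in> P \<rightarrow>\<^sub>M fwd_borel d"
  by (auto intro: measurable_eval)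

lemma nn_integral_eval_at:
  assumes "0 \<le> t" "t \<le> 1" "h \<in> borel_measurable (fwd_borel d)"
  shows "(\<integral>\<^sup>+x. h x \<partial>eval_at d P t) = (\<integral>\<^sup>+\<gamma>. h (\<gamma> t) \<partial>P)"
  unfolding eval_at_def using assms by (subst nn_integral_distr[OF measurable_eval]) auto

lemma AE_eval_at:
  assumes "0 \<le> t" "t \<le> 1" "C \<in> sets (fwd_borel d)" "emeasure (eval_at d P t) (- C) = 0"
  shows "AE \<gamma> in P. \<gamma> t \<in> C"
proof -
  have "- C \<in> sets (fwd_borel d)" using sets.compl_sets[OF assms(3)] by (simp add: Compl_eq_Diff_UNIV)
  then have "emeasure P ((\<lambda>\<gamma>. \<gamma> t) -` (- C) \<inter> space P) = 0"
    and m: "(\<lambda>\<gamma>. \<gamma> t) -` (- C) \<inter> space P \<in> sets P"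
    using assms(4) measurable_eval[OF assms(1,2)] by (simp_all add: eval_at_def emeasure_distr measurable_sets)
  then have "(\<lambda>\<gamma>. \<gamma> t) -` (- C) \<inter> space P \<in> null_sets P" by (simp add: null_sets_def)
  from AE_not_in[OF this] show ?thesis by (rule AE_mp) (auto intro!: AE_I2)
qed

lemma endpoint_plan_swap:
  "distr (endpoint_plan d P) (fwd_borel d \<Otimes>\<^sub>M fwd_borel d) prod.swap
    = distr P (fwd_borel d \<Otimes>\<^sub>M fwd_borel d) (\<lambda>\<gamma>. (\<gamma> 1, \<gamma> 0))"
proof -
  have sw: "prod.swap \<in> fwd_borel d \<Otimes>\<^sub>M fwd_borel d \<rightarrow>\<^sub>M fwd_borel d \<Otimes>\<^sub>M fwd_borel d"
    unfolding prod.swap_def by measurable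
  show ?thesis unfolding endpoint_plan_def by (subst distr_distr[OF sw]) (auto simp: o_def)
qed

text \<open>The endpoints a and b are kept general to cover both the plan and its reverse.\<close>

lemma plan_marginal:
  assumes "a \<in> {0, 1}" "b \<in> {0, 1}" "eval_at d P a = \<mu>"
  defines "\<pi> \<equiv> distr P (fwd_borel d \<Otimes>\<^sub>M fwd_borel d) (\<lambda>\<gamma>. (\<gamma> a, \<gamma> b))"
  shows "sets \<pi> = sets (\<mu> \<Otimes>\<^sub>M \<mu>)" "distr \<pi> \<mu> fst = \<mu>"
proof -
  have s: "sets \<mu> = sets (fwd_borel d)" using assms(3) by (auto simp: eval_at_def)
  show "sets \<pi> = sets (\<mu> \<Otimes>\<^sub>M \<mu>)" unfolding \<pi>_def using sets_pair_measure_cong[OF s s] by simp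
  have m: "(\<lambda>\<gamma>. (\<gamma> a, \<gamma> b)) \<in> P \<rightarrow>\<^sub>M fwd_borel d \<Otimes>\<^sub>M fwd_borel d"
    using assms(1,2) by (intro measurable_Pair) auto
  have "distr \<pi> \<mu> fst = distr \<pi> (fwd_borel d) fst" by (intro distr_cong) (auto simp: s)
  also have "\<dots> = distr P (fwd_borel d) (\<lambda>\<gamma>. \<gamma> a)"
    unfolding \<pi>_def by (subst distr_distr[OF _ m]) (auto simp: o_def)
  finally show "distr \<pi> \<mu> fst = \<mu>" using assms(3) by (simp add: eval_at_def)
qed

lemma nn_integral_plan_P:
  assumes "a \<in> {0, 1}" "b \<in> {0, 1}" "H \<in> borel_measurable (fwd_borel d \<Otimes>\<^sub>M fwd_borel d)"
  shows "(\<integral>\<^sup>+z. H z \<partial>distr P (fwd_borel d \<Otimes>\<^sub>M fwd_borel d) (\<lambda>\<gamma>. (\<gamma> a, \<gamma> b))) = (\<integral>\<^sup>+\<gamma>. H (\<gamma> a, \<gamma> b) \<partial>P)"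
  using assms by (subst nn_integral_distr) (auto intro!: measurable_Pair)

lemma prob_eval_at: "0 \<le> t \<Longrightarrow> t \<le> 1 \<Longrightarrow> prob_space (eval_at d P t)"
  unfolding eval_at_def by (intro prob_space.prob_space_distr prob_P measurable_eval)

end

lemma finite_bounded_set: "emeasure \<nu> {z. d p z \<le> r} < \<infinity>"
  and closedin_bounded_set: "closedin (fwd_topology d) {z. d p z \<le> r}"
proof -
  have "UNIV - {z. d p z \<le> r} = {z. r < d p z}" by auto
  then show "closedin (fwd_topology d) {z. d p z \<le> r}"
    using openin_d_less(4)[of r p] by (simp add: closedin_def)
  then show "emeasure \<nu> {z. d p z \<le> r} < \<infinity>"
    by (intro emeasure_compact_finite locally_finite compactin_bounded_closed) auto
qed

text \<open>A density vanishing off a bounded set confines the support to a closed bounded, hence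
  compact, set. Absolute continuity places it inside the support of \<nu>.\<close>

lemma admissible_density:
  assumes \<rho>[measurable]: "\<rho> \<in> borel_measurable \<nu>" and prob: "(\<integral>\<^sup>+x. ennreal (\<rho> x) \<partial>\<nu>) = 1"
    and bnd: "\<And>z. \<rho> z \<noteq> 0 \<Longrightarrow> d p z \<le> r"
  shows "admissible_marginal d \<nu> (density \<nu> (\<lambda>x. ennreal (\<rho> x)))" (is "admissible_marginal d \<nu> ?\<mu>")
proof -
  have "msupp d ?\<mu> \<subseteq> {z. d p z \<le> r}"
  proof
    fix z assume z: "z \<in> msupp d ?\<mu>"
    show "z \<in> {z. d p z \<le> r}"
    proof (rule ccontr)
      assume "z \<notin> {z. d p z \<le> r}"
      then have "0 < emeasure ?\<mu> {z. r < d p z}" using z openin_d_less(4)[of r p] by (auto simp: msupp_def)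
      moreover have "{z. r < d p z} \<in> sets \<nu>"
        using sets_fwd_borel_open[OF openin_d_less(4)[of r p]] by (simp add: sets_nu)
      then have "emeasure ?\<mu> {z. r < d p z} = (\<integral>\<^sup>+x. ennreal (\<rho> x) * indicator {z. r < d p z} x \<partial>\<nu>)"
        by (simp add: emeasure_density)
      moreover have "\<dots> = (\<integral>\<^sup>+x. 0 \<partial>\<nu>)"
      proof (intro nn_integral_cong)
        fix x show "ennreal (\<rho> x) * indicator {z. r < d p z} x = 0"
          using bnd[of x] by (cases "\<rho> x = 0") (auto simp: indicator_def)
      qed
      ultimately show False by simp
    qed
  qed
  then have "compactin (fwd_topology d) (msupp d ?\<mu>)"
    by (intro compactin_bounded_closed closedin_msupp) auto
  moreover have "msupp d ?\<mu> \<subseteq> msupp d \<nu>"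
  proof
    fix z assume z: "z \<in> msupp d ?\<mu>"
    have ac: "absolutely_continuous \<nu> ?\<mu>" by (rule absolutely_continuousI_density) simp
    have "emeasure \<nu> U \<noteq> 0" if U: "openin (fwd_topology d) U" "z \<in> U" for U
    proof
      assume "emeasure \<nu> U = 0"
      moreover have "U \<in> sets \<nu>" using sets_fwd_borel_open[OF U(1)] by (simp add: sets_nu)
      ultimately have "emeasure ?\<mu> U = 0" using absolutely_continuousD[OF ac] by blast
      then show False using z U by (auto simp: msupp_def)
    qed
    then show "z \<in> msupp d \<nu>" by (auto simp: msupp_def zero_less_iff_neq_zero)
  qed
  moreover have "prob_space ?\<mu>" using prob by (intro prob_spaceI) (simp add: emeasure_density)
  ultimately show ?thesis by (simp add: admissible_marginal_def sets_nu)
qed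

lemma
  assumes "finite_measure \<mu>" "sets \<mu> = sets (fwd_borel d)"
  shows ac_density_nonneg: "0 \<le> ac_density \<nu> \<mu> x"
    and measurable_ac_density: "ac_density \<nu> \<mu> \<in> borel_measurable (fwd_borel d)"
    and ac_density_le: "C \<in> sets (fwd_borel d) \<Longrightarrow> (\<integral>\<^sup>+x\<in>C. ennreal (ac_density \<nu> \<mu> x) \<partial>\<nu>) \<le> emeasure \<mu> C"
proof -
  obtain \<mu>s where "lebesgue_decomposition \<nu> \<mu> (ac_density \<nu> \<mu>) \<mu>s"
    using ac_density_decomposition[OF sigma_finite assms(1)] assms(2) sets_nu by auto
  then have m: "ac_density \<nu> \<mu> \<in> borel_measurable \<nu>" and nn: "\<And>x. 0 \<le> ac_density \<nu> \<mu> x"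
    and dec: "\<And>C. C \<in> sets \<nu> \<Longrightarrow> emeasure \<mu> C = emeasure (density \<nu> (\<lambda>x. ennreal (ac_density \<nu> \<mu> x))) C + emeasure \<mu>s C"
    unfolding lebesgue_decomposition_def by blast+
  show "0 \<le> ac_density \<nu> \<mu> x" by (rule nn)
  show m': "ac_density \<nu> \<mu> \<in> borel_measurable (fwd_borel d)"
    using m measurable_cong_sets[OF sets_nu refl, of borel] by blast
  show "(\<integral>\<^sup>+x\<in>C. ennreal (ac_density \<nu> \<mu> x) \<partial>\<nu>) \<le> emeasure \<mu> C" if "C \<in> sets (fwd_borel d)"
  proof -
    have C: "C \<in> sets \<nu>" using that by (simp add: sets_nu)
    have "(\<integral>\<^sup>+x\<in>C. ennreal (ac_density \<nu> \<mu> x) \<partial>\<nu>) = emeasure (density \<nu> (\<lambda>x. ennreal (ac_density \<nu> \<mu> x))) C"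
      using m C by (subst emeasure_density) auto
    then show ?thesis using dec[OF C] by simp
  qed
qed

lemma U_functional_power:
  assumes "finite_measure \<mu>" "sets \<mu> = sets (fwd_borel d)"
  shows "U_functional (U_power N) \<nu> \<mu> = - enn2ereal (\<integral>\<^sup>+x. ennreal (ac_density \<nu> \<mu> x powr (1 - 1 / N)) \<partial>\<nu>)"
proof -
  have "ennreal (- (ac_density \<nu> \<mu> x powr (1 - 1 / N))) = 0" for x by (simp add: ennreal_neg)
  then show ?thesis
    unfolding U_functional_def Let_def by (simp add: slope_infinity_U_power[OF N] U_power_def zero_ennreal.rep_eq)
qed

text \<open>The bounds below are used for \<open>d\<close> and for the reverse distance, which enters through the
  reversed coefficients.\<close>

context
  fixes D :: "'a \<Rightarrow> 'a \<Rightarrow> real" and \<rho> :: "'a \<Rightarrow> real" and \<mu> :: "'a measure" and \<pi> :: "('a \<times> 'a) measure" and t :: real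
  assumes D: "D = d \<or> D = (\<lambda>x y. d y x)" and t: "0 < t" "t < 1"
    and \<rho>: "\<rho> \<in> borel_measurable \<nu>" "\<And>x. 0 \<le> \<rho> x" and \<mu>: "\<mu> = density \<nu> (\<lambda>x. ennreal (\<rho> x))"
    and prob: "prob_space \<mu>" and s\<pi>: "sets \<pi> = sets (\<mu> \<Otimes>\<^sub>M \<mu>)" and marg: "distr \<pi> \<mu> fst = \<mu>"
begin

lemma irreversible_D: "irreversible_metric D"
  using D irreversible irreversible_metric_flip by blast

lemma measurable_D: "(\<lambda>z. D (fst z) (snd z)) \<in> borel_measurable (fwd_borel d \<Otimes>\<^sub>M fwd_borel d)"
  using D by auto

lemma distorted_beta_mono:
  assumes U: "U = U_square \<or> U = U_power N" and dle: "\<And>x y. d x y \<le> diam_bound K N" and N12: "N < N1" "N1 \<le> N2"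
  shows "distorted U (ac_density \<nu> \<mu> x) (beta_KN D K N1 t x y) \<le> distorted U (ac_density \<nu> \<mu> x) (beta_KN D K N2 t x y)"
proof (rule distorted_antimono[OF U N])
  have s: "sets \<mu> = sets (fwd_borel d)" by (simp add: \<mu> sets_nu)
  show "0 \<le> ac_density \<nu> \<mu> x" by (rule ac_density_nonneg[OF prob_space.finite_measure[OF prob] s])
  \<comment> \<open>For N1 > N the diameter bound strictly exceeds every distance, so the
    coefficient at N1 is finite and the comparison applies.\<close>
  have "D x y < diam_bound K N1"
    using D dle diam_bound_strict_mono[OF K N N12(1)] by (auto intro: le_less_trans)
  then show "beta_KN D K N2 t x y \<le> beta_KN D K N1 t x y" "beta_KN D K N1 t x y \<noteq> \<infinity>"
    using beta_KN_antimono[of D K N1 N2 t x y] t N N12 K irreversible_D by (simp_all add: beta_KN_def)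
  show "0 < beta_KN D K N2 t x y" using t N N12 K by (intro beta_KN_pos irreversible_D) auto
qed

text \<open>The exponent - 1 / N reflects the change of measure: the functional integrates \<rho>^(1
  - 1 / N) over \<nu>, and one factor \<rho> is absorbed into the plan. The minorant of the
  coefficient is the same for all N' \<ge> N.\<close>

lemma U_beta_KN_power_le:
  "U_beta_KN d K N (U_power N) (\<lambda>N'. beta_KN D K N' t) \<pi> \<nu> \<mu>
     \<le> - enn2ereal (\<integral>\<^sup>+z. ennreal (\<rho> (fst z) powr (- 1 / N) * (1 + K * (D (fst z) (snd z))\<^sup>2 * (1 - t\<^sup>2) / (6 * N))) \<partial>\<pi>)"
proof (rule U_beta_KN_le)
  fix N' assume N': "N \<le> N'"
  have [measurable]: "\<rho> \<in> borel_measurable (fwd_borel d)" using \<rho>(1) measurable_cong_sets[OF sets_nu refl, of borel] by blast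
  note [measurable] = measurable_D
  show "U_beta (U_power N) (beta_KN D K N' t) \<pi> \<nu> \<mu>
     \<le> - enn2ereal (\<integral>\<^sup>+z. ennreal (\<rho> (fst z) powr (- 1 / N) * (1 + K * (D (fst z) (snd z))\<^sup>2 * (1 - t\<^sup>2) / (6 * N))) \<partial>\<pi>)"
  proof (rule U_beta_power_le[OF sigma_finite sets_nu \<rho> \<mu> prob s\<pi> marg N])
    fix x y
    show "0 < beta_KN D K N' t x y" using t N N' K by (intro beta_KN_pos irreversible_D) auto
    define E where "E = K * (D x y)\<^sup>2 * (1 - t\<^sup>2) / 6"
    have "E \<ge> 0" using K t by (simp add: E_def power_le_one)
    have "ennreal (\<rho> x) * ennreal (\<rho> x powr (- 1 / N) * (1 + K * (D x y)\<^sup>2 * (1 - t\<^sup>2) / (6 * N)))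
        = ennreal (\<rho> x powr (1 - 1 / N) * (1 + E / N))"
    proof (cases "\<rho> x = 0")
      case False
      then have "0 < \<rho> x" using \<rho>(2)[of x] by simp
      then have "\<rho> x * \<rho> x powr (- 1 / N) = \<rho> x powr (1 - 1 / N)"
        using powr_add[of "\<rho> x" 1 "- 1 / N"] by simp
      moreover have "1 + K * (D x y)\<^sup>2 * (1 - t\<^sup>2) / (6 * N) = 1 + E / N" by (simp add: E_def)
      moreover have "0 \<le> \<rho> x powr (- 1 / N) * (1 + E / N)" using \<open>E \<ge> 0\<close> N by simp
      ultimately show ?thesis using \<rho>(2)[of x] by (simp only: ennreal_mult[symmetric] mult.assoc[symmetric])
    qed simp
    also have "\<dots> \<le> e2ennreal (- distorted (U_power N) (\<rho> x) (beta_KN D K N' t x y))"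
    proof (rule e2ennreal_distorted_U_power_ge[OF N \<rho>(2)])
      assume "beta_KN D K N' t x y \<noteq> \<infinity>"
      then show "\<exists>c. beta_KN D K N' t x y = ereal c \<and> exp E \<le> c"
        using beta_KN_lower_bound[OF irreversible_D K _ t] N N' unfolding E_def by (metis less_le_trans)
    qed
    finally show "ennreal (\<rho> x) * ennreal (\<rho> (fst (x, y)) powr (- 1 / N) * (1 + K * (D (fst (x, y)) (snd (x, y)))\<^sup>2 * (1 - t\<^sup>2) / (6 * N)))
        \<le> e2ennreal (- distorted (U_power N) (\<rho> x) (beta_KN D K N' t x y))" by simp
  qed measurable
qed (use distorted_beta_mono in blast)

text \<open>The coefficients are at least 1, so distortion can only decrease the square entropy
  \<rho>^2 / \<beta>.\<close>

lemma U_beta_KN_square_le: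
  "U_beta_KN d K N U_square (\<lambda>N'. beta_KN D K N' t) \<pi> \<nu> \<mu> \<le> enn2ereal (\<integral>\<^sup>+x. ennreal ((\<rho> x)\<^sup>2) \<partial>\<nu>)"
proof (rule U_beta_KN_le)
  fix N' assume N': "N \<le> N'"
  have *: "distorted U_square (\<rho> x) (beta_KN D K N' t x y) \<le> ereal ((\<rho> x)\<^sup>2)
    \<and> 0 \<le> distorted U_square (\<rho> x) (beta_KN D K N' t x y)" for x y
  proof (cases "beta_KN D K N' t x y = \<infinity>")
    case False
    then obtain b where b: "beta_KN D K N' t x y = ereal b" "exp (K * (D x y)\<^sup>2 * (1 - t\<^sup>2) / 6) \<le> b"
      using beta_KN_lower_bound[OF irreversible_D K _ t] N N' by (metis less_le_trans)
    moreover have "1 \<le> exp (K * (D x y)\<^sup>2 * (1 - t\<^sup>2) / 6)" using K t by (simp add: power_le_one)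
    ultimately have "1 \<le> b" by linarith
    then show ?thesis using b(1) mult_left_mono[of 1 b "(\<rho> x)\<^sup>2"] by (auto simp: distorted_U_square divide_le_eq)
  qed (simp add: distorted_U_square_infinity)
  show "U_beta U_square (beta_KN D K N' t) \<pi> \<nu> \<mu> \<le> enn2ereal (\<integral>\<^sup>+x. ennreal ((\<rho> x)\<^sup>2) \<partial>\<nu>)"
    using * by (intro U_beta_square_le[OF sigma_finite sets_nu \<rho> \<mu> prob s\<pi> marg]) auto
qed (use distorted_beta_mono in blast)

end

text \<open>The slope of the square at infinity is infinite, so any singular mass would make the
  functional infinite.\<close>

lemma absolutely_continuous_of_U_square:
  assumes \<mu>: "finite_measure \<mu>" "sets \<mu> = sets (fwd_borel d)" and fin: "U_functional U_square \<nu> \<mu> \<noteq> \<infinity>"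
  shows "\<mu> = density \<nu> (\<lambda>x. ennreal (ac_density \<nu> \<mu> x))"
proof -
  have s: "sets \<mu> = sets \<nu>" by (simp add: \<mu> sets_nu)
  let ?r = "ac_density \<nu> \<mu>"
  have z: "emeasure (singular_part \<nu> \<mu>) (space \<nu>) = 0"
  proof (rule ccontr)
    assume "emeasure (singular_part \<nu> \<mu>) (space \<nu>) \<noteq> 0"
    then have "slope_infinity U_square * enn2ereal (emeasure (singular_part \<nu> \<mu>) (space \<nu>)) = \<infinity>"
      by (simp add: slope_infinity_U_square zero_less_iff_neq_zero[symmetric] less_ennreal.rep_eq zero_ennreal.rep_eq)
    then show False using fin unfolding U_functional_def Let_def by simp
  qed
  \<comment> \<open>The chosen density and the chosen singular part may come from different
    decompositions; uniqueness of the density links the two.\<close>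
  obtain \<rho>' where \<rho>': "lebesgue_decomposition \<nu> \<mu> \<rho>' (singular_part \<nu> \<mu>)"
    using singular_part_decomposition[OF sigma_finite \<mu>(1) s] by blast
  then have m: "\<rho>' \<in> borel_measurable \<nu>" "\<And>x. 0 \<le> \<rho>' x" and ss: "sets (singular_part \<nu> \<mu>) = sets \<nu>"
    and dec: "\<And>C. C \<in> sets \<nu> \<Longrightarrow> emeasure \<mu> C = emeasure (density \<nu> (\<lambda>x. ennreal (\<rho>' x))) C + emeasure (singular_part \<nu> \<mu>) C"
    unfolding lebesgue_decomposition_def by blast+
  have zC: "emeasure (singular_part \<nu> \<mu>) C = 0" if "C \<in> sets \<nu>" for C
    using emeasure_mono[of C "space \<nu>" "singular_part \<nu> \<mu>"] that ss z sets.sets_into_space[OF that] by simp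
  have eq: "\<mu> = density \<nu> (\<lambda>x. ennreal (\<rho>' x))"
    by (rule measure_eqI) (simp_all add: s dec zC)
  obtain \<mu>s where "lebesgue_decomposition \<nu> \<mu> ?r \<mu>s" using ac_density_decomposition[OF sigma_finite \<mu>(1) s] by blast
  then have "AE x in \<nu>. ?r x = \<rho>' x"
    using lebesgue_decomposition_density(2)[OF sigma_finite m, folded eq] by blast
  moreover have "?r \<in> borel_measurable \<nu>" using measurable_ac_density[OF \<mu>] measurable_cong_sets[OF sets_nu refl, of borel] by blast
  ultimately have "density \<nu> (\<lambda>x. ennreal (?r x)) = density \<nu> (\<lambda>x. ennreal (\<rho>' x))"
    using m by (intro density_cong) auto
  then show ?thesis using eq by simp
qed

text \<open>Bonnet-Myers: if the supports of the marginals are further apart than the bound, then the right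
  hand side of the curvature-dimension inequality for \<open>U_power N\<close> is \<open>-\<infinity>\<close>.\<close>

lemma diameter_le:
  assumes x: "x \<in> msupp d \<nu>" and y: "y \<in> msupp d \<nu>"
  shows "d x y \<le> diam_bound K N"
proof (rule ccontr)
  assume "\<not> d x y \<le> diam_bound K N"
  \<comment> \<open>Half the excess: points within e of x and y in the metric \<open>sd\<close> are
    still at least the diameter bound apart.\<close>
  define e where "e = (d x y - diam_bound K N) / 2"
  have e: "0 < e" using \<open>\<not> d x y \<le> diam_bound K N\<close> by (simp add: e_def)
  define \<rho> where "\<rho> z u = indicator (sd.mball z e) u / measure \<nu> (sd.mball z e)" for z u
  have ball[measurable]: "sd.mball z e \<in> sets \<nu>" for z
    using sets_fwd_borel_open[OF openin_sd_ball] by (simp add: sets_nu)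
  have adm: "admissible_marginal d \<nu> (density \<nu> (\<lambda>u. ennreal (\<rho> z u)))" (is ?A)
    and pos: "\<rho> z \<in> borel_measurable \<nu>" "\<And>u. 0 \<le> \<rho> z u" "\<And>u. u \<in> sd.mball z e \<Longrightarrow> 0 < \<rho> z u"
    and conc: "emeasure (density \<nu> (\<lambda>u. ennreal (\<rho> z u))) (- sd.mball z e) = 0"
    if z: "z \<in> msupp d \<nu>" for z
  proof -
    have "0 < emeasure \<nu> (sd.mball z e)" using z openin_sd_ball[of z e] e by (auto simp: msupp_def)
    moreover have "emeasure \<nu> (sd.mball z e) \<le> emeasure \<nu> {u. d z u \<le> e}"
      using d_le_sd(1)[of z] sets_fwd_borel_closed[OF closedin_bounded_set[of z e]]
      by (intro emeasure_mono) (auto simp: sets_nu intro: order_trans[OF d_le_sd(1)] less_imp_le)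
    then have fin: "emeasure \<nu> (sd.mball z e) < \<infinity>" using finite_bounded_set le_less_trans by blast
    ultimately have mpos: "0 < measure \<nu> (sd.mball z e)"
      by (simp add: measure_def enn2real_positive_iff)
    show m: "\<rho> z \<in> borel_measurable \<nu>" unfolding \<rho>_def by measurable
    show "\<And>u. 0 \<le> \<rho> z u" "\<And>u. u \<in> sd.mball z e \<Longrightarrow> 0 < \<rho> z u" using mpos by (auto simp: \<rho>_def)
    have "(\<integral>\<^sup>+u. ennreal (\<rho> z u) \<partial>\<nu>) = (\<integral>\<^sup>+u. ennreal (1 / measure \<nu> (sd.mball z e)) * indicator (sd.mball z e) u \<partial>\<nu>)"
      by (intro nn_integral_cong) (auto simp: \<rho>_def indicator_def)
    also have "\<dots> = ennreal (1 / measure \<nu> (sd.mball z e)) * emeasure \<nu> (sd.mball z e)"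
      by (simp add: nn_integral_cmult_indicator)
    also have "\<dots> = 1" using mpos fin by (simp add: emeasure_eq_ennreal_measure less_top[symmetric] ennreal_mult[symmetric])
    finally have int: "(\<integral>\<^sup>+u. ennreal (\<rho> z u) \<partial>\<nu>) = 1" .
    show ?A
    proof (rule admissible_density[OF m int])
      fix u assume "\<rho> z u \<noteq> 0"
      then have "u \<in> sd.mball z e" by (auto simp: \<rho>_def indicator_def split: if_splits)
      then show "d z u \<le> e" using d_le_sd(1)[of z u] by simp
    qed
    have "- sd.mball z e \<in> sets \<nu>" using sets.compl_sets[OF ball[of z]] by (simp add: Compl_eq_Diff_UNIV)
    then have "emeasure (density \<nu> (\<lambda>u. ennreal (\<rho> z u))) (- sd.mball z e)
        = (\<integral>\<^sup>+u. ennreal (\<rho> z u) * indicator (- sd.mball z e) u \<partial>\<nu>)"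
      using m by (subst emeasure_density) auto
    also have "\<dots> = (\<integral>\<^sup>+u. 0 \<partial>\<nu>)"
      by (intro nn_integral_cong) (auto simp: \<rho>_def indicator_def)
    finally show "emeasure (density \<nu> (\<lambda>u. ennreal (\<rho> z u))) (- sd.mball z e) = 0" by simp
  qed
  define \<mu>0 where "\<mu>0 = density \<nu> (\<lambda>u. ennreal (\<rho> x u))"
  define \<mu>1 where "\<mu>1 = density \<nu> (\<lambda>u. ennreal (\<rho> y u))"
  obtain P where P: "dynamical_optimal_plan d P" "eval_at d P 0 = \<mu>0" "eval_at d P 1 = \<mu>1"
    and cd: "\<And>U t. U \<in> DC N \<Longrightarrow> 0 \<le> t \<Longrightarrow> t \<le> 1 \<Longrightarrow> U_functional U \<nu> (eval_at d P t) \<le>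
        ereal (1 - t) * U_beta_KN d K N U (\<lambda>N'. beta_KN d K N' (1 - t)) (endpoint_plan d P) \<nu> \<mu>0
      + ereal t * U_beta_KN d K N U (\<lambda>N'. beta_KN (\<lambda>x y. d y x) K N' t)
          (distr (endpoint_plan d P) (fwd_borel d \<Otimes>\<^sub>M fwd_borel d) prod.swap) \<nu> \<mu>1"
    using weak_CD_plan[OF adm[OF x] adm[OF y]] unfolding \<mu>0_def \<mu>1_def by blast
  note prob = prob_P[OF P(1)]
  interpret P: prob_space P by (rule prob)
  note [measurable] = measurable_eval_01[OF P(1)]
  have ae0: "AE \<gamma> in P. \<gamma> 0 \<in> sd.mball x e" and ae1: "AE \<gamma> in P. \<gamma> 1 \<in> sd.mball y e"
    using AE_eval_at[OF P(1) order_refl zero_le_one, of "sd.mball x e"]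
      AE_eval_at[OF P(1) zero_le_one order_refl, of "sd.mball y e"] conc[OF x] conc[OF y] ball[of x] ball[of y]
    unfolding P(2,3) \<mu>0_def \<mu>1_def sets_nu by blast+
  have aed: "AE \<gamma> in P. diam_bound K N \<le> d (\<gamma> 0) (\<gamma> 1)"
    using ae0 ae1
  proof eventually_elim
    case (elim \<gamma>)
    then show ?case using d_diff_le[of x y "\<gamma> 0" "\<gamma> 1"] by (simp add: e_def abs_le_iff field_simps)
  qed
  \<comment> \<open>A generous radius that catches all midpoints, whose distance from x is at most e
    + (d x y + 2 e) / 2.\<close>
  define R where "R = 3 * e + d x y + e"
  define B where "B = {z. d x z \<le> R}"
  have B[measurable]: "B \<in> sets (fwd_borel d)" unfolding B_def by (intro sets_fwd_borel_closed closedin_bounded_set)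
  have mid: "AE \<gamma> in P. \<gamma> (1 / 2) \<in> B"
    using ae0 ae1 AE_space
  proof eventually_elim
    case (elim \<gamma>)
    have "d x (\<gamma> (1 / 2)) \<le> d x (\<gamma> 0) + d (\<gamma> 0) (\<gamma> (1 / 2))" by (rule d_triangle)
    also have "d (\<gamma> 0) (\<gamma> (1 / 2)) = 1 / 2 * d (\<gamma> 0) (\<gamma> 1)" using geodesic_d[OF P(1) elim(3), of 0 "1 / 2"] by simp
    also have "d (\<gamma> 0) (\<gamma> 1) \<le> d x y + (sd x (\<gamma> 0) + sd y (\<gamma> 1))"
      using d_diff_le[of x y "\<gamma> 0" "\<gamma> 1"] by (simp add: abs_le_iff)
    finally have "d x (\<gamma> (1 / 2)) \<le> d x (\<gamma> 0) + 1 / 2 * (d x y + (sd x (\<gamma> 0) + sd y (\<gamma> 1)))" by simp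
    moreover have "d x (\<gamma> 0) < e" "sd x (\<gamma> 0) < e" "sd y (\<gamma> 1) < e" using elim d_le_sd(1)[of x "\<gamma> 0"] by auto
    ultimately show ?case using d_nonneg[of x y] e unfolding B_def R_def mem_Collect_eq by argo
  qed
  define \<mu>t where "\<mu>t = eval_at d P (1 / 2)"
  have \<mu>t: "finite_measure \<mu>t" "sets \<mu>t = sets (fwd_borel d)"
    unfolding \<mu>t_def using prob_eval_at[OF P(1), of "1 / 2"] by (auto intro: prob_space.finite_measure simp: eval_at_def)
  let ?r = "ac_density \<nu> \<mu>t"
  have rm[measurable]: "?r \<in> borel_measurable (fwd_borel d)" by (rule measurable_ac_density[OF \<mu>t])
  have [measurable]: "?r \<in> borel_measurable \<nu>" using rm measurable_cong_sets[OF sets_nu refl, of borel] by blast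
  have Bn[measurable]: "B \<in> sets \<nu>" using B by (simp add: sets_nu)
  have cB: "- B \<in> sets (fwd_borel d)" using sets.compl_sets[OF B] by (simp add: Compl_eq_Diff_UNIV)
  have "emeasure \<mu>t (- B) = (\<integral>\<^sup>+u. indicator (- B) u \<partial>\<mu>t)" using cB \<mu>t by simp
  also have "\<dots> = (\<integral>\<^sup>+\<gamma>. indicator (- B) (\<gamma> (1 / 2)) \<partial>P)"
    unfolding \<mu>t_def using cB by (subst nn_integral_eval_at[OF P(1)]) auto
  also have "\<dots> = (\<integral>\<^sup>+\<gamma>. 0 \<partial>P)" using mid by (intro nn_integral_cong_AE) (auto elim!: eventually_mono)
  finally have "emeasure \<mu>t (- B) = 0" by simp
  then have "(\<integral>\<^sup>+u\<in>- B. ennreal (?r u) \<partial>\<nu>) = 0" using ac_density_le[OF \<mu>t cB] by simp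
  then have off: "AE u in \<nu>. ennreal (?r u) * indicator (- B) u = 0"
    by (subst (asm) nn_integral_0_iff_AE) auto
  \<comment> \<open>On \<open>B\<close>, which has finite mass, the power is at most 1 + r by the
    tangent at 1, and off \<open>B\<close> the density vanishes. So the entropy of the midpoint
    measure is finite.\<close>
  have "(\<integral>\<^sup>+u. ennreal (?r u powr (1 - 1 / N)) \<partial>\<nu>) \<le> (\<integral>\<^sup>+u. indicator B u + ennreal (?r u) \<partial>\<nu>)"
  proof (rule nn_integral_mono_AE, use off in eventually_elim)
    case (elim u)
    have nn: "0 \<le> ?r u" by (rule ac_density_nonneg[OF \<mu>t])
    show ?case
    proof (cases "u \<in> B")
      case True
      have "?r u powr (1 - 1 / N) \<le> 1 powr (1 - 1 / N) + (1 - 1 / N) * 1 powr (1 - 1 / N - 1) * (?r u - 1)"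
        using N nn by (intro powr_le_tangent) auto
      also have "\<dots> \<le> 1 + ?r u"
      proof -
        have "(1 - 1 / N) * ?r u \<le> 1 * ?r u" using N nn by (intro mult_right_mono) auto
        moreover have "0 \<le> 1 - 1 / N" using N by simp
        ultimately show ?thesis by (simp add: algebra_simps)
      qed
      finally have "ennreal (?r u powr (1 - 1 / N)) \<le> ennreal (1 + ?r u)" by (rule ennreal_leI)
      then show ?thesis using True nn by (simp add: ennreal_plus)
    next
      case False
      then have "?r u = 0" using elim nn by simp
      then show ?thesis by simp
    qed
  qed
  also have "\<dots> = emeasure \<nu> B + (\<integral>\<^sup>+u\<in>UNIV. ennreal (?r u) \<partial>\<nu>)"
    by (subst nn_integral_add) auto
  also have "\<dots> \<le> emeasure \<nu> B + emeasure \<mu>t UNIV"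
    using sets.top[of "fwd_borel d"] by (intro add_left_mono ac_density_le[OF \<mu>t]) simp
  also have "\<dots> < \<infinity>"
    using finite_bounded_set[of x R] finite_measure.emeasure_finite[OF \<mu>t(1), of UNIV] by (simp add: B_def less_top[symmetric])
  finally have "U_functional (U_power N) \<nu> \<mu>t \<noteq> - \<infinity>"
    unfolding U_functional_power[OF \<mu>t] by (metis enn2ereal_eq_top_iff ereal_uminus_eq_reorder infinity_ennreal_def less_irrefl ereal_uminus_uminus uminus_ereal.simps(2))
  moreover have "U_functional (U_power N) \<nu> \<mu>t \<le> - \<infinity>"
  proof -
    \<comment> \<open>The supremum of the distances exceeds the borderline value, so the functionals
      are the plain ones at N.\<close>
    have SUP: "(SUP (x, y)\<in>UNIV. ereal (d x y)) \<noteq> ereal (diam_bound K N)"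
    proof
      assume eq: "(SUP (x, y)\<in>UNIV. ereal (d x y)) = ereal (diam_bound K N)"
      have "ereal (d x y) \<le> (SUP (x, y)\<in>UNIV. ereal (d x y))" by (rule SUP_upper2[of "(x, y)"]) auto
      then show False using \<open>\<not> d x y \<le> diam_bound K N\<close> unfolding eq by simp
    qed
    \<comment> \<open>Infinite exactly where the coefficient is infinite; the plan is concentrated
      on such pairs.\<close>
    define H where "H z = (if diam_bound K N \<le> d (fst z) (snd z) then \<infinity> else 0 :: ennreal)" for z
    have Hm: "H \<in> borel_measurable (fwd_borel d \<Otimes>\<^sub>M fwd_borel d)" unfolding H_def by measurable
    have prob0: "prob_space \<mu>0" "prob_space \<mu>1" using adm[OF x] adm[OF y] by (auto simp: admissible_marginal_def \<mu>0_def \<mu>1_def)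
    have ep: "endpoint_plan d P = distr P (fwd_borel d \<Otimes>\<^sub>M fwd_borel d) (\<lambda>\<gamma>. (\<gamma> 0, \<gamma> 1))" by (simp add: endpoint_plan_def)
    have "U_beta (U_power N) (beta_KN d K N (1 / 2)) (endpoint_plan d P) \<nu> \<mu>0 \<le> - enn2ereal (\<integral>\<^sup>+z. H z \<partial>endpoint_plan d P)"
      unfolding ep
    proof (rule U_beta_power_le[OF sigma_finite sets_nu pos(1,2)[OF x] \<mu>0_def prob0(1) plan_marginal[OF P(1) _ _ P(2)] N Hm])
      fix u v
      show "0 < beta_KN d K N (1 / 2) u v" using K N by (intro beta_KN_pos irreversible) auto
      show "ennreal (\<rho> x u) * H (u, v) \<le> e2ennreal (- distorted (U_power N) (\<rho> x u) (beta_KN d K N (1 / 2) u v))"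
      proof (cases "\<rho> x u = 0 \<or> H (u, v) = 0")
        case False
        then have "0 < \<rho> x u" "diam_bound K N \<le> d u v" using pos(2)[OF x, of u] by (auto simp: H_def less_le split: if_splits)
        then show ?thesis using distorted_U_power_infinity[OF N] by (simp add: beta_KN_def)
      qed auto
    qed auto
    also have "(\<integral>\<^sup>+z. H z \<partial>endpoint_plan d P) = (\<integral>\<^sup>+\<gamma>. H (\<gamma> 0, \<gamma> 1) \<partial>P)"
      unfolding ep by (rule nn_integral_plan_P[OF P(1) _ _ Hm]) auto
    also have "\<dots> = (\<integral>\<^sup>+\<gamma>. \<infinity> \<partial>P)" using aed by (intro nn_integral_cong_AE) (auto simp: H_def elim!: eventually_mono)
    also have "\<dots> = \<infinity>" by (simp add: P.emeasure_space_1)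
    finally have 1: "U_beta (U_power N) (beta_KN d K N (1 / 2)) (endpoint_plan d P) \<nu> \<mu>0 = - \<infinity>" by simp
    \<comment> \<open>At the other end an upper bound by 0 is enough: it keeps \<infinity> out of
      the sum, which would otherwise win against - \<infinity>.\<close>
    have "U_beta (U_power N) (beta_KN (\<lambda>x y. d y x) K N (1 / 2)) (distr P (fwd_borel d \<Otimes>\<^sub>M fwd_borel d) (\<lambda>\<gamma>. (\<gamma> 1, \<gamma> 0))) \<nu> \<mu>1
        \<le> - enn2ereal (\<integral>\<^sup>+z. 0 \<partial>distr P (fwd_borel d \<Otimes>\<^sub>M fwd_borel d) (\<lambda>\<gamma>. (\<gamma> 1, \<gamma> 0)))"
      using K N
      by (intro U_beta_power_le[OF sigma_finite sets_nu pos(1,2)[OF y] \<mu>1_def prob0(2) plan_marginal[OF P(1) _ _ P(3)] N])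
         (auto intro!: beta_KN_pos irreversible_metric_flip irreversible)
    then have 2: "U_beta (U_power N) (beta_KN (\<lambda>x y. d y x) K N (1 / 2)) (distr P (fwd_borel d \<Otimes>\<^sub>M fwd_borel d) (\<lambda>\<gamma>. (\<gamma> 1, \<gamma> 0))) \<nu> \<mu>1 \<le> 0"
      by (simp add: zero_ennreal.rep_eq)
    have "U_functional (U_power N) \<nu> \<mu>t \<le> ereal (1 - 1 / 2) * U_beta (U_power N) (beta_KN d K N (1 - 1 / 2)) (endpoint_plan d P) \<nu> \<mu>0
       + ereal (1 / 2) * U_beta (U_power N) (beta_KN (\<lambda>x y. d y x) K N (1 / 2)) (distr P (fwd_borel d \<Otimes>\<^sub>M fwd_borel d) (\<lambda>\<gamma>. (\<gamma> 1, \<gamma> 0))) \<nu> \<mu>1"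
      using cd[OF U_power_in_DC[OF N], of "1 / 2"] SUP
      unfolding \<mu>t_def endpoint_plan_swap[OF P(1)] U_beta_KN_def by simp
    also have "\<dots> = - \<infinity>"
      using 1 2 by (cases "U_beta (U_power N) (beta_KN (\<lambda>x y. d y x) K N (1 / 2)) (distr P (fwd_borel d \<Otimes>\<^sub>M fwd_borel d) (\<lambda>\<gamma>. (\<gamma> 1, \<gamma> 0))) \<nu> \<mu>1") auto
    finally show ?thesis .
  qed
  ultimately show False by simp
qed

end

section \<open>The transport inequality\<close>

text \<open>Moves an inequality between negated extended reals to \<open>ennreal\<close>, where no
  sum is indeterminate.\<close>

lemma ennreal_weighted_le_of_ereal:
  assumes ab: "0 \<le> a" "0 \<le> b" and le: "- enn2ereal X \<le> ereal a * u + ereal b * v"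
    and u: "u \<le> - enn2ereal J0" and v: "v \<le> - enn2ereal J1"
  shows "ennreal a * J0 + ennreal b * J1 \<le> X"
proof -
  have "ereal a * u \<le> - enn2ereal (ennreal a * J0)"
  proof -
    have "ereal a * u \<le> ereal a * (- enn2ereal J0)" using ab u by (intro ereal_mult_left_mono) auto
    also have "\<dots> = - enn2ereal (ennreal a * J0)" using ab by (simp add: times_ennreal.rep_eq enn2ereal_ennreal)
    finally show ?thesis .
  qed
  moreover have "ereal b * v \<le> - enn2ereal (ennreal b * J1)"
  proof -
    have "ereal b * v \<le> ereal b * (- enn2ereal J1)" using ab v by (intro ereal_mult_left_mono) auto
    also have "\<dots> = - enn2ereal (ennreal b * J1)" using ab by (simp add: times_ennreal.rep_eq enn2ereal_ennreal)
    finally show ?thesis .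
  qed
  ultimately have "- enn2ereal X \<le> - enn2ereal (ennreal a * J0) + - enn2ereal (ennreal b * J1)"
    using le by (meson add_mono order_trans)
  also have "\<dots> = - (enn2ereal (ennreal a * J0 + ennreal b * J1))"
    using enn2ereal_nonneg[of "ennreal a * J0"] enn2ereal_nonneg[of "ennreal b * J1"] unfolding plus_ennreal.rep_eq
    by (cases "enn2ereal (ennreal a * J0)"; cases "enn2ereal (ennreal b * J1)") auto
  finally show ?thesis by (simp add: less_eq_ennreal.rep_eq)
qed

context weak_CD_space
begin

abbreviation "S \<equiv> msupp d \<nu>"

lemma measurable_nu_iff: "f \<in> borel_measurable \<nu> \<longleftrightarrow> f \<in> borel_measurable (fwd_borel d)"
  using measurable_cong_sets[OF sets_nu refl, of borel] by blast

lemma S_sets [measurable]: "S \<in> sets \<nu>"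
  by (simp add: sets_nu)

lemma AE_S: "AE x in \<nu>. x \<in> S"
proof -
  have "- S \<in> sets \<nu>" using sets.compl_sets[OF S_sets] by (simp add: Compl_eq_Diff_UNIV)
  then have "- S \<in> null_sets \<nu>" using emeasure_compl_msupp[OF sets_nu] by (simp add: null_sets_def)
  from AE_not_in[OF this] show ?thesis by simp
qed

section \<open>Transport from a perturbed measure to the uniform measure\<close>

context
  fixes p :: 'a
  assumes p: "p \<in> S"
begin

text \<open>The diameter bound puts S into a bounded set, which has finite mass; a point of the
  support forces positive mass.\<close>

lemma emeasure_S: "emeasure \<nu> S = ennreal (measure \<nu> S)" "0 < measure \<nu> S" "emeasure \<nu> S < \<infinity>"
proof -
  have "emeasure \<nu> S \<le> emeasure \<nu> {z. d p z \<le> diam_bound K N}"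
    using diameter_le[OF p] sets_fwd_borel_closed[OF closedin_bounded_set]
    by (intro emeasure_mono) (auto simp: sets_nu)
  then show fin: "emeasure \<nu> S < \<infinity>" using finite_bounded_set le_less_trans by blast
  then show eq: "emeasure \<nu> S = ennreal (measure \<nu> S)" by (intro emeasure_eq_ennreal_measure) (simp add: less_top)
  have "openin (fwd_topology d) UNIV" using openin_topspace[of "fwd_topology d"] by simp
  then have "0 < emeasure \<nu> UNIV" using p by (auto simp: msupp_def)
  moreover have "emeasure \<nu> UNIV = emeasure \<nu> S" using AE_S by (intro emeasure_eq_AE) auto
  ultimately show "0 < measure \<nu> S" by (simp add: eq)
qed

context
  fixes w :: "'a \<Rightarrow> real" and c C :: real
  assumes wM [measurable]: "w \<in> borel_measurable (fwd_borel d)"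
    and w: "0 < c" "\<And>x. c \<le> w x" "\<And>x. w x \<le> C"
    and mass: "(\<integral>\<^sup>+x\<in>S. ennreal (w x) \<partial>\<nu>) = emeasure \<nu> S"
begin

definition start_density :: "'a \<Rightarrow> real" where "start_density x = indicator S x * w x / measure \<nu> S"

text \<open>On S this is, up to the constant (1 - 1 / N) m^(1 / N) with m the mass of S, the
  derivative of r^(1 - 1 / N) at the starting density, that is, the slope of the tangent.\<close>

definition weight :: "'a \<Rightarrow> real" where "weight x = w x powr (- 1 / N)"

lemma wM_nu [measurable]: "w \<in> borel_measurable \<nu>"
  by (simp add: measurable_nu_iff)

lemma w_pos: "0 < w x" using w(1) w(2)[of x] by linarith

lemma measurable_start_density [measurable]: "start_density \<in> borel_measurable (fwd_borel d)"
  unfolding start_density_def by measurable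

lemma measurable_weight [measurable]: "weight \<in> borel_measurable (fwd_borel d)"
  unfolding weight_def by measurable

lemma weight_bounds: "0 < weight x" "weight x \<le> c powr (- 1 / N)"
  using w(1) w(2)[of x] N w_pos[of x] unfolding weight_def by (auto intro!: powr_mono2')

lemma start_density_bounds: "0 \<le> start_density x" "start_density x \<le> C / measure \<nu> S"
  using emeasure_S(2) w_pos[of x] w(3)[of x] by (auto simp: start_density_def indicator_def intro!: divide_right_mono)

lemma start_density_powr: "x \<in> S \<Longrightarrow> start_density x powr (- 1 / N) = measure \<nu> S powr (1 / N) * weight x"
  using w_pos[of x] emeasure_S(2) by (simp add: start_density_def weight_def powr_divide powr_minus field_simps)

lemma start_density_integral: "(\<integral>\<^sup>+x. ennreal (start_density x) \<partial>\<nu>) = 1"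
proof -
  have "(\<integral>\<^sup>+x. ennreal (start_density x) \<partial>\<nu>) = (\<integral>\<^sup>+x. ennreal (1 / measure \<nu> S) * (ennreal (w x) * indicator S x) \<partial>\<nu>)"
    using w_pos emeasure_S(2)
    by (intro nn_integral_cong) (auto simp: start_density_def indicator_def ennreal_mult[symmetric] less_imp_le)
  also have "\<dots> = ennreal (1 / measure \<nu> S) * emeasure \<nu> S"
    by (subst nn_integral_cmult) (auto simp: mass)
  also have "\<dots> = 1" using emeasure_S by (simp add: ennreal_mult[symmetric])
  finally show ?thesis .
qed

text \<open>Both densities carry the factor 1 / m, whose power - 1 / N is common to all terms and is
  cancelled at the end. The tangent at the starting density a has the value (1 / N) a q + (1 - 1 /
  N) r q at r, with q = a^(- 1 / N); this is why the mean weights at times 0 and t occur with these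
  shares.\<close>

lemma transport_inequality:
  obtains P where "dynamical_optimal_plan d P" "eval_at d P 0 = density \<nu> (\<lambda>x. ennreal (start_density x))"
    "\<And>t. 0 \<le> t \<Longrightarrow> t \<le> 1 \<Longrightarrow> AE \<gamma> in P. \<gamma> t \<in> S"
    "\<And>t. 0 < t \<Longrightarrow> t < 1 \<Longrightarrow>
       ennreal (1 - t) * (\<integral>\<^sup>+\<gamma>. ennreal (weight (\<gamma> 0) * (1 + K * (d (\<gamma> 0) (\<gamma> 1))\<^sup>2 * (1 - (1 - t)\<^sup>2) / (6 * N))) \<partial>P)
       + ennreal t * (\<integral>\<^sup>+\<gamma>. ennreal (1 + K * (d (\<gamma> 0) (\<gamma> 1))\<^sup>2 * (1 - t\<^sup>2) / (6 * N)) \<partial>P)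
       \<le> ennreal (1 / N) * (\<integral>\<^sup>+\<gamma>. ennreal (weight (\<gamma> 0)) \<partial>P) + ennreal (1 - 1 / N) * (\<integral>\<^sup>+\<gamma>. ennreal (weight (\<gamma> t)) \<partial>P)"
proof -
  define m where "m = measure \<nu> S"
  have m: "0 < m" using emeasure_S by (simp add: m_def)
  define \<rho>1 where "\<rho>1 x = indicator S x / m" for x
  have \<rho>1: "\<rho>1 \<in> borel_measurable (fwd_borel d)" "\<And>x. 0 \<le> \<rho>1 x"
    unfolding \<rho>1_def using m by (measurable, simp)
  have \<rho>1_int: "(\<integral>\<^sup>+x. ennreal (\<rho>1 x) \<partial>\<nu>) = 1"
  proof -
    have "(\<integral>\<^sup>+x. ennreal (\<rho>1 x) \<partial>\<nu>) = (\<integral>\<^sup>+x. ennreal (1 / m) * indicator S x \<partial>\<nu>)"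
      by (intro nn_integral_cong) (auto simp: \<rho>1_def indicator_def)
    also have "\<dots> = ennreal (1 / m) * emeasure \<nu> S" by (simp add: nn_integral_cmult_indicator)
    also have "\<dots> = 1" using m emeasure_S by (simp add: m_def ennreal_mult[symmetric])
    finally show ?thesis .
  qed
  define \<mu>0 where "\<mu>0 = density \<nu> (\<lambda>x. ennreal (start_density x))"
  define \<mu>1 where "\<mu>1 = density \<nu> (\<lambda>x. ennreal (\<rho>1 x))"
  have r0: "start_density \<in> borel_measurable \<nu>" "\<rho>1 \<in> borel_measurable \<nu>" using \<rho>1 by (simp_all add: measurable_nu_iff)
  have adm0: "admissible_marginal d \<nu> \<mu>0" unfolding \<mu>0_def
    using start_density_integral diameter_le[OF p]
    by (intro admissible_density[OF r0(1), of p "diam_bound K N"]) (auto simp: start_density_def indicator_def split: if_splits)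
  have adm1: "admissible_marginal d \<nu> \<mu>1" unfolding \<mu>1_def
    using \<rho>1_int diameter_le[OF p]
    by (intro admissible_density[OF r0(2), of p "diam_bound K N"]) (auto simp: \<rho>1_def indicator_def split: if_splits)
  have prob: "prob_space \<mu>0" "prob_space \<mu>1" using adm0 adm1 by (auto simp: admissible_marginal_def)
  obtain P where P: "dynamical_optimal_plan d P" "eval_at d P 0 = \<mu>0" "eval_at d P 1 = \<mu>1"
    and cd: "\<And>U t. U \<in> DC N \<Longrightarrow> 0 \<le> t \<Longrightarrow> t \<le> 1 \<Longrightarrow> U_functional U \<nu> (eval_at d P t) \<le>
        ereal (1 - t) * U_beta_KN d K N U (\<lambda>N'. beta_KN d K N' (1 - t)) (endpoint_plan d P) \<nu> \<mu>0
      + ereal t * U_beta_KN d K N U (\<lambda>N'. beta_KN (\<lambda>x y. d y x) K N' t)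
          (distr (endpoint_plan d P) (fwd_borel d \<Otimes>\<^sub>M fwd_borel d) prod.swap) \<nu> \<mu>1"
    using weak_CD_plan[OF adm0 adm1] by blast
  note [measurable] = measurable_eval_01[OF P(1)]
  have ep: "endpoint_plan d P = distr P (fwd_borel d \<Otimes>\<^sub>M fwd_borel d) (\<lambda>\<gamma>. (\<gamma> 0, \<gamma> 1))" by (simp add: endpoint_plan_def)
  have pm0: "sets (endpoint_plan d P) = sets (\<mu>0 \<Otimes>\<^sub>M \<mu>0)" "distr (endpoint_plan d P) \<mu>0 fst = \<mu>0"
    unfolding ep by (rule plan_marginal[OF P(1) _ _ P(2)]; simp)+
  have pm1: "sets (distr P (fwd_borel d \<Otimes>\<^sub>M fwd_borel d) (\<lambda>\<gamma>. (\<gamma> 1, \<gamma> 0))) = sets (\<mu>1 \<Otimes>\<^sub>M \<mu>1)"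
    "distr (distr P (fwd_borel d \<Otimes>\<^sub>M fwd_borel d) (\<lambda>\<gamma>. (\<gamma> 1, \<gamma> 0))) \<mu>1 fst = \<mu>1"
    by (rule plan_marginal[OF P(1) _ _ P(3)]; simp)+
  have ac: "eval_at d P t = density \<nu> (\<lambda>x. ennreal (ac_density \<nu> (eval_at d P t) x))"
    if t: "0 < t" "t < 1" for t
  proof (rule absolutely_continuous_of_U_square)
    show "finite_measure (eval_at d P t)"
      using prob_eval_at[OF P(1), of t] t by (auto intro: prob_space.finite_measure)
    show "sets (eval_at d P t) = sets (fwd_borel d)" by (simp add: eval_at_def)
    \<comment> \<open>Both endpoint densities are bounded and vanish off S, so the square entropies
      on the right are finite.\<close>
    have sq_fin: "(\<integral>\<^sup>+x. ennreal ((r x)\<^sup>2) \<partial>\<nu>) < \<infinity>"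
      if r: "\<And>x. 0 \<le> r x" "\<And>x. r x \<le> B" "\<And>x. x \<notin> S \<Longrightarrow> r x = 0" for r :: "'a \<Rightarrow> real" and B
    proof -
      have "(\<integral>\<^sup>+x. ennreal ((r x)\<^sup>2) \<partial>\<nu>) \<le> (\<integral>\<^sup>+x. ennreal (B\<^sup>2) * indicator S x \<partial>\<nu>)"
        using r by (intro nn_integral_mono) (auto simp: indicator_def intro!: ennreal_leI power_mono)
      also have "\<dots> = ennreal (B\<^sup>2) * emeasure \<nu> S" by (simp add: nn_integral_cmult_indicator)
      also have "\<dots> < \<infinity>" using emeasure_S by (simp add: ennreal_mult_less_top)
      finally show ?thesis .
    qed
    have 0: "U_beta_KN d K N U_square (\<lambda>N'. beta_KN d K N' (1 - t)) (endpoint_plan d P) \<nu> \<mu>0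
        \<le> enn2ereal (\<integral>\<^sup>+x. ennreal ((start_density x)\<^sup>2) \<partial>\<nu>)"
      using t by (intro U_beta_KN_square_le[OF _ _ _ r0(1) start_density_bounds(1) \<mu>0_def prob(1) pm0]) auto
    have 1: "U_beta_KN d K N U_square (\<lambda>N'. beta_KN (\<lambda>x y. d y x) K N' t)
          (distr P (fwd_borel d \<Otimes>\<^sub>M fwd_borel d) (\<lambda>\<gamma>. (\<gamma> 1, \<gamma> 0))) \<nu> \<mu>1
        \<le> enn2ereal (\<integral>\<^sup>+x. ennreal ((\<rho>1 x)\<^sup>2) \<partial>\<nu>)"
      using t by (intro U_beta_KN_square_le[OF _ _ _ r0(2) \<rho>1(2) \<mu>1_def prob(2) pm1]) auto
    have le: "U_functional U_square \<nu> (eval_at d P t) \<le>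
        ereal (1 - t) * enn2ereal (\<integral>\<^sup>+x. ennreal ((start_density x)\<^sup>2) \<partial>\<nu>)
        + ereal t * enn2ereal (\<integral>\<^sup>+x. ennreal ((\<rho>1 x)\<^sup>2) \<partial>\<nu>)"
      using cd[OF U_square_in_DC[OF N], of t] t 0 1 unfolding endpoint_plan_swap[OF P(1)]
      by (auto elim!: order_trans intro!: add_mono ereal_mult_left_mono)
    also have eq: "\<dots> = enn2ereal (ennreal (1 - t) * (\<integral>\<^sup>+x. ennreal ((start_density x)\<^sup>2) \<partial>\<nu>) + ennreal t * (\<integral>\<^sup>+x. ennreal ((\<rho>1 x)\<^sup>2) \<partial>\<nu>))"
      using t by (simp add: plus_ennreal.rep_eq times_ennreal.rep_eq enn2ereal_ennreal)
    finally have "U_functional U_square \<nu> (eval_at d P t) \<le>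
        enn2ereal (ennreal (1 - t) * (\<integral>\<^sup>+x. ennreal ((start_density x)\<^sup>2) \<partial>\<nu>) + ennreal t * (\<integral>\<^sup>+x. ennreal ((\<rho>1 x)\<^sup>2) \<partial>\<nu>))" .
    moreover have "enn2ereal (ennreal (1 - t) * (\<integral>\<^sup>+x. ennreal ((start_density x)\<^sup>2) \<partial>\<nu>) + ennreal t * (\<integral>\<^sup>+x. ennreal ((\<rho>1 x)\<^sup>2) \<partial>\<nu>)) \<noteq> \<infinity>"
    proof -
      have "(\<integral>\<^sup>+x. ennreal ((start_density x)\<^sup>2) \<partial>\<nu>) < \<infinity>"
        using start_density_bounds by (rule sq_fin) (simp add: start_density_def)
      moreover have "(\<integral>\<^sup>+x. ennreal ((\<rho>1 x)\<^sup>2) \<partial>\<nu>) < \<infinity>"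
        using \<rho>1(2) m by (intro sq_fin[of _ "1 / m"]) (auto simp: \<rho>1_def indicator_def)
      ultimately have "ennreal (1 - t) * (\<integral>\<^sup>+x. ennreal ((start_density x)\<^sup>2) \<partial>\<nu>) + ennreal t * (\<integral>\<^sup>+x. ennreal ((\<rho>1 x)\<^sup>2) \<partial>\<nu>) < \<infinity>"
        by (simp add: ennreal_mult_less_top)
      then show ?thesis using enn2ereal_eq_top_iff less_top by fastforce
    qed
    ultimately show "U_functional U_square \<nu> (eval_at d P t) \<noteq> \<infinity>" by auto
  qed
  \<comment> \<open>Every interpolating measure, including both ends, has a density, so the null
    complement of the support is null for it as well.\<close>
  have inS: "AE \<gamma> in P. \<gamma> t \<in> S" if t: "0 \<le> t" "t \<le> 1" for t
  proof (rule AE_eval_at[OF P(1) t sets_msupp])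
    have "\<exists>r. eval_at d P t = density \<nu> (\<lambda>x. ennreal (r x)) \<and> r \<in> borel_measurable \<nu>"
    proof -
      consider "t = 0" | "t = 1" | "0 < t" "t < 1" using t by linarith
      then show ?thesis
      proof cases
        case 1 then show ?thesis using P(2) r0(1) unfolding \<mu>0_def by blast
      next
        case 2 then show ?thesis using P(3) r0(2) unfolding \<mu>1_def by blast
      next
        case 3
        have "ac_density \<nu> (eval_at d P t) \<in> borel_measurable (fwd_borel d)"
          using prob_eval_at[OF P(1) t] by (intro measurable_ac_density) (auto intro: prob_space.finite_measure simp: eval_at_def)
        then show ?thesis using ac[OF 3] unfolding measurable_nu_iff by blast
      qed
    qed
    then obtain r where r: "eval_at d P t = density \<nu> (\<lambda>x. ennreal (r x))" "r \<in> borel_measurable \<nu>" by blast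
    have "absolutely_continuous \<nu> (eval_at d P t)" unfolding r(1) by (rule absolutely_continuousI_density) (use r(2) in simp)
    moreover have "- S \<in> sets \<nu>" using sets.compl_sets[OF S_sets] by (simp add: Compl_eq_Diff_UNIV)
    ultimately show "emeasure (eval_at d P t) (- S) = 0"
      using absolutely_continuousD[OF _ _ emeasure_compl_msupp[OF sets_nu]] by blast
  qed
  show ?thesis
  proof (rule that[OF P(1) P(2)[unfolded \<mu>0_def] inS])
    fix t :: real assume t: "0 < t" "t < 1"
    note evt[measurable] = measurable_eval[OF P(1), of t]
    define \<mu>t where "\<mu>t = eval_at d P t"
    have \<mu>t: "finite_measure \<mu>t" "sets \<mu>t = sets (fwd_borel d)"
      unfolding \<mu>t_def using prob_eval_at[OF P(1), of t] t by (auto intro: prob_space.finite_measure simp: eval_at_def)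
    let ?r = "ac_density \<nu> \<mu>t"
    have rm[measurable]: "?r \<in> borel_measurable \<nu>" using measurable_ac_density[OF \<mu>t] by (simp add: measurable_nu_iff)
    have rn: "0 \<le> ?r x" for x by (rule ac_density_nonneg[OF \<mu>t])
    have [measurable]: "weight \<in> borel_measurable \<nu>" "start_density \<in> borel_measurable \<nu>" by (simp_all add: measurable_nu_iff)
    let ?m = "ennreal (m powr (1 / N))"
    let ?k0 = "\<lambda>\<gamma>. 1 + K * (d (\<gamma> 0) (\<gamma> 1))\<^sup>2 * (1 - (1 - t)\<^sup>2) / (6 * N)"
    let ?k1 = "\<lambda>\<gamma>. 1 + K * (d (\<gamma> 0) (\<gamma> 1))\<^sup>2 * (1 - t\<^sup>2) / (6 * N)"
    have k0: "0 \<le> ?k0 \<gamma>" and k1: "0 \<le> ?k1 \<gamma>" for \<gamma>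
      using t K N by (auto intro!: add_nonneg_nonneg mult_nonneg_nonneg divide_nonneg_nonneg simp: power_le_one)
    let ?X = "\<integral>\<^sup>+x. ennreal (?r x powr (1 - 1 / N)) \<partial>\<nu>"
    let ?I0 = "\<integral>\<^sup>+\<gamma>. ennreal (weight (\<gamma> 0) * ?k0 \<gamma>) \<partial>P"
    let ?I1 = "\<integral>\<^sup>+\<gamma>. ennreal (?k1 \<gamma>) \<partial>P"
    have "U_beta_KN d K N (U_power N) (\<lambda>N'. beta_KN d K N' (1 - t)) (endpoint_plan d P) \<nu> \<mu>0
      \<le> - enn2ereal (\<integral>\<^sup>+z. ennreal (start_density (fst z) powr (- 1 / N) * (1 + K * (d (fst z) (snd z))\<^sup>2 * (1 - (1 - t)\<^sup>2) / (6 * N))) \<partial>endpoint_plan d P)"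
      using t by (intro U_beta_KN_power_le[OF _ _ _ r0(1) start_density_bounds(1) \<mu>0_def prob(1) pm0]) auto
    also have "(\<integral>\<^sup>+z. ennreal (start_density (fst z) powr (- 1 / N) * (1 + K * (d (fst z) (snd z))\<^sup>2 * (1 - (1 - t)\<^sup>2) / (6 * N))) \<partial>endpoint_plan d P)
        = (\<integral>\<^sup>+\<gamma>. ennreal (start_density (\<gamma> 0) powr (- 1 / N) * ?k0 \<gamma>) \<partial>P)"
      unfolding ep by (subst nn_integral_plan_P[OF P(1)]) auto
    also have "\<dots> = (\<integral>\<^sup>+\<gamma>. ?m * ennreal (weight (\<gamma> 0) * ?k0 \<gamma>) \<partial>P)"
    proof (rule nn_integral_cong_AE, use inS[OF order_refl zero_le_one] in eventually_elim)
      case (elim \<gamma>)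
      have "0 \<le> weight (\<gamma> 0) * ?k0 \<gamma>" by (intro mult_nonneg_nonneg k0 less_imp_le weight_bounds(1))
      then show ?case unfolding start_density_powr[OF elim] m_def[symmetric]
        by (simp only: ennreal_mult[symmetric] mult.assoc powr_ge_zero)
    qed
    also have "\<dots> = ?m * ?I0" by (rule nn_integral_cmult) measurable
    finally have U0: "U_beta_KN d K N (U_power N) (\<lambda>N'. beta_KN d K N' (1 - t)) (endpoint_plan d P) \<nu> \<mu>0 \<le> - enn2ereal (?m * ?I0)" .
    have "U_beta_KN d K N (U_power N) (\<lambda>N'. beta_KN (\<lambda>x y. d y x) K N' t) (distr P (fwd_borel d \<Otimes>\<^sub>M fwd_borel d) (\<lambda>\<gamma>. (\<gamma> 1, \<gamma> 0))) \<nu> \<mu>1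
      \<le> - enn2ereal (\<integral>\<^sup>+z. ennreal (\<rho>1 (fst z) powr (- 1 / N) * (1 + K * (d (snd z) (fst z))\<^sup>2 * (1 - t\<^sup>2) / (6 * N))) \<partial>distr P (fwd_borel d \<Otimes>\<^sub>M fwd_borel d) (\<lambda>\<gamma>. (\<gamma> 1, \<gamma> 0)))"
      using t by (intro U_beta_KN_power_le[OF _ _ _ r0(2) \<rho>1(2) \<mu>1_def prob(2) pm1]) auto
    also have "(\<integral>\<^sup>+z. ennreal (\<rho>1 (fst z) powr (- 1 / N) * (1 + K * (d (snd z) (fst z))\<^sup>2 * (1 - t\<^sup>2) / (6 * N))) \<partial>distr P (fwd_borel d \<Otimes>\<^sub>M fwd_borel d) (\<lambda>\<gamma>. (\<gamma> 1, \<gamma> 0)))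
        = (\<integral>\<^sup>+\<gamma>. ennreal (\<rho>1 (\<gamma> 1) powr (- 1 / N) * ?k1 \<gamma>) \<partial>P)"
      using \<rho>1(1) by (subst nn_integral_plan_P[OF P(1)]) auto
    also have "\<dots> = (\<integral>\<^sup>+\<gamma>. ?m * ennreal (?k1 \<gamma>) \<partial>P)"
    proof (rule nn_integral_cong_AE, use inS[OF zero_le_one order_refl] in eventually_elim)
      case (elim \<gamma>)
      have "\<rho>1 (\<gamma> 1) powr (- 1 / N) = m powr (1 / N)"
        using elim m by (simp add: \<rho>1_def powr_divide powr_minus)
      then show ?case using k1[of \<gamma>] by (simp only: ennreal_mult[symmetric] powr_ge_zero)
    qed
    also have "\<dots> = ?m * ?I1" by (rule nn_integral_cmult) measurable
    finally have U1: "U_beta_KN d K N (U_power N) (\<lambda>N'. beta_KN (\<lambda>x y. d y x) K N' t) (distr P (fwd_borel d \<Otimes>\<^sub>M fwd_borel d) (\<lambda>\<gamma>. (\<gamma> 1, \<gamma> 0))) \<nu> \<mu>1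
        \<le> - enn2ereal (?m * ?I1)" .
    have "- enn2ereal ?X = U_functional (U_power N) \<nu> \<mu>t" by (rule U_functional_power[OF \<mu>t, symmetric])
    also have "\<dots> \<le> ereal (1 - t) * U_beta_KN d K N (U_power N) (\<lambda>N'. beta_KN d K N' (1 - t)) (endpoint_plan d P) \<nu> \<mu>0
      + ereal t * U_beta_KN d K N (U_power N) (\<lambda>N'. beta_KN (\<lambda>x y. d y x) K N' t)
          (distr P (fwd_borel d \<Otimes>\<^sub>M fwd_borel d) (\<lambda>\<gamma>. (\<gamma> 1, \<gamma> 0))) \<nu> \<mu>1"
      using cd[OF U_power_in_DC[OF N], of t] t unfolding \<mu>t_def endpoint_plan_swap[OF P(1)] by simp
    finally have "ennreal (1 - t) * (?m * ?I0) + ennreal t * (?m * ?I1) \<le> ?X"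
      by (intro ennreal_weighted_le_of_ereal[OF _ _ _ U0 U1]) (use t in auto)
    also have "?X \<le> (\<integral>\<^sup>+x. ?m * (ennreal (1 / N) * (ennreal (start_density x) * ennreal (weight x))
        + ennreal (1 - 1 / N) * (ennreal (?r x) * ennreal (weight x))) \<partial>\<nu>)"
    proof (rule nn_integral_mono_AE, use AE_S in eventually_elim)
      case (elim x)
      have pos: "0 < start_density x" using elim w_pos[of x] m by (simp add: start_density_def m_def)
      define q where "q = start_density x powr (- 1 / N)"
      have q: "q = m powr (1 / N) * weight x" using start_density_powr[OF elim] by (simp add: q_def m_def)
      have tangent_rearrange: "a * (b * c) + (1 - i) * (b * c) * (r - a) = b * (i * (a * c) + (1 - i) * (r * c))"
        for a b c i r :: real by (simp add: algebra_simps)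
      have "?r x powr (1 - 1 / N) \<le> start_density x powr (1 - 1 / N)
          + (1 - 1 / N) * start_density x powr (1 - 1 / N - 1) * (?r x - start_density x)"
        using N rn pos by (intro powr_le_tangent) auto
      also have "start_density x powr (1 - 1 / N) = start_density x * q"
        using pos powr_add[of "start_density x" 1 "- 1 / N"] by (simp add: q_def)
      also have "start_density x powr (1 - 1 / N - 1) = q" by (simp add: q_def)
      also have "start_density x * q + (1 - 1 / N) * q * (?r x - start_density x)
          = m powr (1 / N) * (1 / N * (start_density x * weight x) + (1 - 1 / N) * (?r x * weight x))"
        unfolding q using tangent_rearrange .
      finally have "ennreal (?r x powr (1 - 1 / N))
          \<le> ennreal (m powr (1 / N) * (1 / N * (start_density x * weight x) + (1 - 1 / N) * (?r x * weight x)))"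
        by (rule ennreal_leI)
      also have "\<dots> = ?m * (ennreal (1 / N) * (ennreal (start_density x) * ennreal (weight x))
        + ennreal (1 - 1 / N) * (ennreal (?r x) * ennreal (weight x)))"
      proof -
        have "ennreal (b * (i * (a * c) + (1 - i) * (r * c)))
            = ennreal b * (ennreal i * (ennreal a * ennreal c) + ennreal (1 - i) * (ennreal r * ennreal c))"
          if "0 \<le> a" "0 \<le> b" "0 \<le> c" "0 \<le> r" "0 \<le> i" "i \<le> 1" for a b c i r :: real
          using that by (simp add: ennreal_mult ennreal_plus)
        note split = this
        show ?thesis by (rule split) (use N pos rn[of x] weight_bounds(1)[of x] in auto)
      qed
      finally show ?case .
    qed
    also have "\<dots> = ?m * (ennreal (1 / N) * (\<integral>\<^sup>+x. ennreal (start_density x) * ennreal (weight x) \<partial>\<nu>)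
        + ennreal (1 - 1 / N) * (\<integral>\<^sup>+x. ennreal (?r x) * ennreal (weight x) \<partial>\<nu>))"
      by (simp add: nn_integral_cmult nn_integral_add)
    also have "(\<integral>\<^sup>+x. ennreal (start_density x) * ennreal (weight x) \<partial>\<nu>) = (\<integral>\<^sup>+x. ennreal (weight x) \<partial>\<mu>0)"
      unfolding \<mu>0_def by (rule nn_integral_density[symmetric]) measurable
    also have "\<dots> = (\<integral>\<^sup>+\<gamma>. ennreal (weight (\<gamma> 0)) \<partial>P)"
      unfolding P(2)[symmetric] by (rule nn_integral_eval_at[OF P(1)]) auto
    also have "(\<integral>\<^sup>+x. ennreal (?r x) * ennreal (weight x) \<partial>\<nu>) = (\<integral>\<^sup>+x. ennreal (weight x) \<partial>\<mu>t)"
    proof -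
      have "(\<integral>\<^sup>+x. ennreal (weight x) \<partial>\<mu>t) = (\<integral>\<^sup>+x. ennreal (weight x) \<partial>density \<nu> (\<lambda>x. ennreal (?r x)))"
        by (rule arg_cong[where f = "\<lambda>M. \<integral>\<^sup>+x. ennreal (weight x) \<partial>M", OF ac[OF t, folded \<mu>t_def]])
      also have "\<dots> = (\<integral>\<^sup>+x. ennreal (?r x) * ennreal (weight x) \<partial>\<nu>)" by (rule nn_integral_density) measurable
      finally show ?thesis by (rule sym)
    qed
    also have "\<dots> = (\<integral>\<^sup>+\<gamma>. ennreal (weight (\<gamma> t)) \<partial>P)"
      unfolding \<mu>t_def using t by (intro nn_integral_eval_at[OF P(1)]) auto
    finally have "?m * (ennreal (1 - t) * ?I0 + ennreal t * ?I1)
        \<le> ?m * (ennreal (1 / N) * (\<integral>\<^sup>+\<gamma>. ennreal (weight (\<gamma> 0)) \<partial>P) + ennreal (1 - 1 / N) * (\<integral>\<^sup>+\<gamma>. ennreal (weight (\<gamma> t)) \<partial>P))"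
      by (simp add: distrib_left mult.left_commute)
    then show "ennreal (1 - t) * ?I0 + ennreal t * ?I1
        \<le> ennreal (1 / N) * (\<integral>\<^sup>+\<gamma>. ennreal (weight (\<gamma> 0)) \<partial>P) + ennreal (1 - 1 / N) * (\<integral>\<^sup>+\<gamma>. ennreal (weight (\<gamma> t)) \<partial>P)"
      using m by (subst (asm) ennreal_mult_le_mult_iff) auto
  qed
qed

text \<open>Dividing the transport inequality by t leaves, as t tends to 0, the factor 2 weight + 1
  in front of the squared distance; the lower bound a of the weight turns it into \<kappa>. The
  growth bound \<open>step\<close> is applied between \<gamma> 0 and \<gamma> t, where a short range
  suffices because their distance is t times that of the endpoints.\<close>

lemma derivative_inequality:
  fixes s :: "'a \<Rightarrow> real"
  assumes sM [measurable]: "s \<in> borel_measurable (fwd_borel d)" and s: "\<And>x. 0 \<le> s x" "\<And>x. s x \<le> B"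
    and L: "0 \<le> L" and \<delta>: "0 < \<delta>" and a: "0 < a" "\<And>x. a \<le> weight x"
    and step: "\<And>x y. x \<in> S \<Longrightarrow> y \<in> S \<Longrightarrow> d x y < \<delta> \<Longrightarrow> weight y - weight x \<le> L * (s x * d x y)"
  defines "\<kappa> \<equiv> K / (6 * N) * (2 * a + 1)"
  shows "(\<integral>x. indicator S x * (w x - w x powr (1 - 1 / N)) \<partial>\<nu>)
     \<le> ((1 - 1 / N) * L)\<^sup>2 / (4 * \<kappa>) * (\<integral>x. indicator S x * ((s x)\<^sup>2 * w x) \<partial>\<nu>)"
proof -
  obtain P where P: "dynamical_optimal_plan d P" "eval_at d P 0 = density \<nu> (\<lambda>x. ennreal (start_density x))"
    and inS: "\<And>t. 0 \<le> t \<Longrightarrow> t \<le> 1 \<Longrightarrow> AE \<gamma> in P. \<gamma> t \<in> S"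
    and tr: "\<And>t. 0 < t \<Longrightarrow> t < 1 \<Longrightarrow>
       ennreal (1 - t) * (\<integral>\<^sup>+\<gamma>. ennreal (weight (\<gamma> 0) * (1 + K * (d (\<gamma> 0) (\<gamma> 1))\<^sup>2 * (1 - (1 - t)\<^sup>2) / (6 * N))) \<partial>P)
       + ennreal t * (\<integral>\<^sup>+\<gamma>. ennreal (1 + K * (d (\<gamma> 0) (\<gamma> 1))\<^sup>2 * (1 - t\<^sup>2) / (6 * N)) \<partial>P)
       \<le> ennreal (1 / N) * (\<integral>\<^sup>+\<gamma>. ennreal (weight (\<gamma> 0)) \<partial>P) + ennreal (1 - 1 / N) * (\<integral>\<^sup>+\<gamma>. ennreal (weight (\<gamma> t)) \<partial>P)"
    by (rule transport_inequality) blast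
  interpret P: prob_space P by (rule prob_P[OF P(1)])
  note [measurable] = measurable_eval_01[OF P(1)]
  note ae0 = inS[OF order_refl zero_le_one] and ae1 = inS[OF zero_le_one order_refl]
  define D where "D = diam_bound K N"
  define dd where "dd \<gamma> = d (\<gamma> 0) (\<gamma> 1)" for \<gamma> :: "real \<Rightarrow> 'a"
  have [measurable]: "dd \<in> borel_measurable P" unfolding dd_def by measurable
  have dd0: "0 \<le> dd \<gamma>" for \<gamma> by (simp add: dd_def)
  have aeD: "AE \<gamma> in P. dd \<gamma> \<le> D"
    using ae0 ae1 by eventually_elim (auto simp: dd_def D_def intro: diameter_le)
  define b where "b = c powr (- 1 / N)"
  have wb: "0 \<le> weight x" "weight x \<le> b" for x using weight_bounds[of x] by (auto simp: b_def)
  have b0: "0 \<le> b" using wb[of undefined] by linarith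
  have B0: "0 \<le> B" using s[of undefined] by linarith
  have intW: "integrable P (\<lambda>\<gamma>. weight (\<gamma> t))" if "0 \<le> t" "t \<le> 1" for t
    using wb measurable_compose[OF measurable_eval[OF P(1) that] measurable_weight]
    by (intro P.integrable_const_bound[where B = b]) auto
  have intd: "integrable P (\<lambda>\<gamma>. (dd \<gamma>)\<^sup>2)"
    using aeD by (intro P.integrable_const_bound[where B = "D\<^sup>2"]) (auto elim!: eventually_mono intro: power_mono dd0)
  have intWd: "integrable P (\<lambda>\<gamma>. weight (\<gamma> 0) * (dd \<gamma>)\<^sup>2)"
  proof (rule P.integrable_const_bound[where B = "b * D\<^sup>2"])
    show "AE \<gamma> in P. norm (weight (\<gamma> 0) * (dd \<gamma>)\<^sup>2) \<le> b * D\<^sup>2"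
      using aeD by eventually_elim (auto simp: abs_mult wb intro!: mult_mono power_mono dd0 b0)
  qed measurable
  have ints: "integrable P (\<lambda>\<gamma>. (s (\<gamma> 0))\<^sup>2)"
    using s by (intro P.integrable_const_bound[where B = "B\<^sup>2"]) (auto intro!: power_mono)
  have intsd: "integrable P (\<lambda>\<gamma>. s (\<gamma> 0) * dd \<gamma>)"
  proof (rule P.integrable_const_bound[where B = "B * D"])
    show "AE \<gamma> in P. norm (s (\<gamma> 0) * dd \<gamma>) \<le> B * D"
      using aeD by eventually_elim (auto simp: abs_mult s dd0 intro!: mult_mono B0)
  qed measurable
  define k where "k = K / (6 * N)"
  have k: "0 < k" using K N by (simp add: k_def)
  define eW where "eW = (\<integral>\<gamma>. weight (\<gamma> 0) \<partial>P)"
  define eWd where "eWd = (\<integral>\<gamma>. weight (\<gamma> 0) * (dd \<gamma>)\<^sup>2 \<partial>P)"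
  define ed where "ed = (\<integral>\<gamma>. (dd \<gamma>)\<^sup>2 \<partial>P)"
  define esd where "esd = (\<integral>\<gamma>. s (\<gamma> 0) * dd \<gamma> \<partial>P)"
  define es where "es = (\<integral>\<gamma>. (s (\<gamma> 0))\<^sup>2 \<partial>P)"
  \<comment> \<open>All integrands are bounded almost everywhere, so the inequality can be restated
    with real integrals, where subtraction is available.\<close>
  have real_tr: "(1 - t) * (eW + k * (1 - (1 - t)\<^sup>2) * eWd) + t * (1 + k * (1 - t\<^sup>2) * ed)
      \<le> 1 / N * eW + (1 - 1 / N) * (\<integral>\<gamma>. weight (\<gamma> t) \<partial>P)" if t: "0 < t" "t < 1" for t
  proof -
    have q: "0 \<le> 1 - (1 - t)\<^sup>2" "0 \<le> 1 - t\<^sup>2" using t by (auto simp: power_le_one)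
    have I0: "(\<integral>\<^sup>+\<gamma>. ennreal (weight (\<gamma> 0) * (1 + K * (d (\<gamma> 0) (\<gamma> 1))\<^sup>2 * (1 - (1 - t)\<^sup>2) / (6 * N))) \<partial>P)
        = ennreal (eW + k * (1 - (1 - t)\<^sup>2) * eWd)"
    proof -
      have "(\<integral>\<^sup>+\<gamma>. ennreal (weight (\<gamma> 0) + k * (1 - (1 - t)\<^sup>2) * (weight (\<gamma> 0) * (dd \<gamma>)\<^sup>2)) \<partial>P)
        = ennreal (\<integral>\<gamma>. weight (\<gamma> 0) + k * (1 - (1 - t)\<^sup>2) * (weight (\<gamma> 0) * (dd \<gamma>)\<^sup>2) \<partial>P)"
        using q k wb by (intro nn_integral_eq_integral Bochner_Integration.integrable_add intW integrable_mult_right intWd) auto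
      also have "(\<integral>\<gamma>. weight (\<gamma> 0) + k * (1 - (1 - t)\<^sup>2) * (weight (\<gamma> 0) * (dd \<gamma>)\<^sup>2) \<partial>P) = eW + k * (1 - (1 - t)\<^sup>2) * eWd"
        using intW[of 0] intWd by (simp add: eW_def eWd_def)
      moreover have "x * (1 + K * y * z / (6 * N)) = x + k * z * (x * y)" for x y z
        by (simp add: k_def distrib_left mult_ac)
      ultimately show ?thesis by (simp add: dd_def)
    qed
    have I1: "(\<integral>\<^sup>+\<gamma>. ennreal (1 + K * (d (\<gamma> 0) (\<gamma> 1))\<^sup>2 * (1 - t\<^sup>2) / (6 * N)) \<partial>P)
        = ennreal (1 + k * (1 - t\<^sup>2) * ed)"
    proof -
      have "(\<integral>\<^sup>+\<gamma>. ennreal (1 + k * (1 - t\<^sup>2) * (dd \<gamma>)\<^sup>2) \<partial>P)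
        = ennreal (\<integral>\<gamma>. 1 + k * (1 - t\<^sup>2) * (dd \<gamma>)\<^sup>2 \<partial>P)"
        using q k by (intro nn_integral_eq_integral Bochner_Integration.integrable_add integrable_mult_right intd) auto
      also have "(\<integral>\<gamma>. 1 + k * (1 - t\<^sup>2) * (dd \<gamma>)\<^sup>2 \<partial>P) = 1 + k * (1 - t\<^sup>2) * ed"
        using intd by (simp add: ed_def P.prob_space)
      moreover have "1 + K * y * z / (6 * N) = 1 + k * z * y" for y z
        by (simp add: k_def mult_ac)
      ultimately show ?thesis by (simp add: dd_def)
    qed
    have W: "(\<integral>\<^sup>+\<gamma>. ennreal (weight (\<gamma> r)) \<partial>P) = ennreal (\<integral>\<gamma>. weight (\<gamma> r) \<partial>P)"
      if "0 \<le> r" "r \<le> 1" for r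
      using that wb by (intro nn_integral_eq_integral intW) auto
    have nn: "0 \<le> eW" "0 \<le> eWd" "0 \<le> ed" "0 \<le> (\<integral>\<gamma>. weight (\<gamma> t) \<partial>P)"
      using wb by (auto simp: eW_def eWd_def ed_def intro!: Bochner_Integration.integral_nonneg)
    have "ennreal (1 - t) * ennreal (eW + k * (1 - (1 - t)\<^sup>2) * eWd) + ennreal t * ennreal (1 + k * (1 - t\<^sup>2) * ed)
        \<le> ennreal (1 / N) * ennreal eW + ennreal (1 - 1 / N) * ennreal (\<integral>\<gamma>. weight (\<gamma> t) \<partial>P)"
      using tr[OF t] W[of 0] W[of t] t unfolding I0 I1 eW_def[symmetric] by simp
    moreover have comb: "ennreal a1 * ennreal b1 + ennreal a2 * ennreal b2 = ennreal (a1 * b1 + a2 * b2)"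
      if "0 \<le> a1" "0 \<le> b1" "0 \<le> a2" "0 \<le> b2" for a1 b1 a2 b2 :: real
      using that by (simp add: ennreal_mult ennreal_plus)
    have "ennreal (1 - t) * ennreal (eW + k * (1 - (1 - t)\<^sup>2) * eWd) + ennreal t * ennreal (1 + k * (1 - t\<^sup>2) * ed)
        = ennreal ((1 - t) * (eW + k * (1 - (1 - t)\<^sup>2) * eWd) + t * (1 + k * (1 - t\<^sup>2) * ed))"
      by (rule comb) (use t q k nn in auto)
    moreover have "ennreal (1 / N) * ennreal eW + ennreal (1 - 1 / N) * ennreal (\<integral>\<gamma>. weight (\<gamma> t) \<partial>P)
        = ennreal (1 / N * eW + (1 - 1 / N) * (\<integral>\<gamma>. weight (\<gamma> t) \<partial>P))"
      by (rule comb) (use N nn in auto)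
    ultimately have "ennreal ((1 - t) * (eW + k * (1 - (1 - t)\<^sup>2) * eWd) + t * (1 + k * (1 - t\<^sup>2) * ed))
        \<le> ennreal (1 / N * eW + (1 - 1 / N) * (\<integral>\<gamma>. weight (\<gamma> t) \<partial>P))" by simp
    moreover have "0 \<le> 1 / N * eW + (1 - 1 / N) * (\<integral>\<gamma>. weight (\<gamma> t) \<partial>P)" using N nn by simp
    ultimately show ?thesis by (simp add: ennreal_le_iff)
  qed
  have D0: "0 \<le> D" using K N by (simp add: D_def diam_bound_def)
  \<comment> \<open>The last condition on t keeps \<gamma> t within \<delta> of \<gamma> 0. All
    terms without a factor t cancel, and t is divided out.\<close>
  have small: "1 - eW + (k * (1 - t) * (2 - t) * eWd + k * (1 - t\<^sup>2) * ed) \<le> (1 - 1 / N) * L * esd"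
    if t: "0 < t" "t < 1" "t * (D + 1) < \<delta>" for t
  proof -
    have "(\<integral>\<gamma>. weight (\<gamma> t) \<partial>P) \<le> (\<integral>\<gamma>. weight (\<gamma> 0) + t * L * (s (\<gamma> 0) * dd \<gamma>) \<partial>P)"
    proof (rule integral_mono_AE)
      have "AE \<gamma> in P. \<gamma> t \<in> S" using t by (intro inS) auto
      then show "AE \<gamma> in P. weight (\<gamma> t) \<le> weight (\<gamma> 0) + t * L * (s (\<gamma> 0) * dd \<gamma>)"
        using ae0 aeD AE_space
      proof eventually_elim
        case (elim \<gamma>)
        have eq: "d (\<gamma> 0) (\<gamma> t) = t * dd \<gamma>" using geodesic_d[OF P(1) elim(4), of 0 t] t by (simp add: dd_def)
        have "t * dd \<gamma> \<le> t * (D + 1)" using elim t by (intro mult_left_mono) auto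
        then have "d (\<gamma> 0) (\<gamma> t) < \<delta>" unfolding eq using t by linarith
        then have "weight (\<gamma> t) - weight (\<gamma> 0) \<le> L * (s (\<gamma> 0) * d (\<gamma> 0) (\<gamma> t))"
          by (intro step elim)
        then show ?case unfolding eq by (simp add: algebra_simps)
      qed
    qed (use intW t intsd in auto)
    also have "\<dots> = eW + t * L * esd" using intW[of 0] intsd by (simp add: eW_def esd_def)
    finally have "(1 - 1 / N) * (\<integral>\<gamma>. weight (\<gamma> t) \<partial>P) \<le> (1 - 1 / N) * (eW + t * L * esd)"
      using N by (intro mult_left_mono) auto
    with real_tr[OF t(1,2)] have "(1 - t) * (eW + k * (1 - (1 - t)\<^sup>2) * eWd) + t * (1 + k * (1 - t\<^sup>2) * ed)
        \<le> 1 / N * eW + (1 - 1 / N) * (eW + t * L * esd)" by linarith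
    moreover have "(1 - t) * (eW + k * (1 - (1 - t)\<^sup>2) * eWd) + t * (1 + k * (1 - t\<^sup>2) * ed) - (1 / N * eW + (1 - 1 / N) * (eW + t * L * esd))
      = t * (1 - eW + (k * (1 - t) * (2 - t) * eWd + k * (1 - t\<^sup>2) * ed) - (1 - 1 / N) * L * esd)"
    proof -
      have "(1 - t) * (eW + k * (1 - (1 - t)\<^sup>2) * eWd) + t * (1 + k * (1 - t\<^sup>2) * ed) - (i * eW + (1 - i) * (eW + t * L * esd))
        = t * (1 - eW + (k * (1 - t) * (2 - t) * eWd + k * (1 - t\<^sup>2) * ed) - (1 - i) * L * esd)" for i
        by (simp add: algebra_simps power2_eq_square)
      then show ?thesis .
    qed
    ultimately have "t * (1 - eW + (k * (1 - t) * (2 - t) * eWd + k * (1 - t\<^sup>2) * ed) - (1 - 1 / N) * L * esd) \<le> 0"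
      by linarith
    then have "1 - eW + (k * (1 - t) * (2 - t) * eWd + k * (1 - t\<^sup>2) * ed) - (1 - 1 / N) * L * esd \<le> 0"
      using t by (simp only: mult_le_0_iff) linarith
    then show ?thesis by linarith
  qed
  have lim: "1 - eW + k * (2 * eWd + ed) \<le> (1 - 1 / N) * L * esd"
  proof (rule tendsto_upperbound)
    have "((\<lambda>t. 1 - eW + (k * (1 - t) * (2 - t) * eWd + k * (1 - t\<^sup>2) * ed)) \<longlongrightarrow>
        1 - eW + (k * (1 - 0) * (2 - 0) * eWd + k * (1 - 0\<^sup>2) * ed)) (at_right 0)"
      by (intro tendsto_intros)
    then show "((\<lambda>t. 1 - eW + (k * (1 - t) * (2 - t) * eWd + k * (1 - t\<^sup>2) * ed)) \<longlongrightarrow> 1 - eW + k * (2 * eWd + ed)) (at_right 0)"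
      by (simp add: algebra_simps)
    have "0 < min 1 (\<delta> / (D + 1))" using \<delta> D0 by simp
    then show "\<forall>\<^sub>F t in at_right 0. 1 - eW + (k * (1 - t) * (2 - t) * eWd + k * (1 - t\<^sup>2) * ed) \<le> (1 - 1 / N) * L * esd"
      unfolding eventually_at_right_field using D0
      by (intro exI[of _ "min 1 (\<delta> / (D + 1))"] conjI allI impI small) (auto simp: pos_less_divide_eq)
  qed simp
  have \<kappa>: "0 < \<kappa>" using K N a by (simp add: \<kappa>_def)
  have "a * ed \<le> eWd"
  proof -
    have "a * ed = (\<integral>\<gamma>. a * (dd \<gamma>)\<^sup>2 \<partial>P)" by (simp add: ed_def)
    also have "\<dots> \<le> eWd" unfolding eWd_def
      using intd intWd a by (intro integral_mono mult_right_mono) auto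
    finally show ?thesis .
  qed
  then have "\<kappa> * ed \<le> k * (2 * eWd + ed)"
  proof -
    have "\<kappa> = k * (2 * a + 1)" by (simp add: \<kappa>_def k_def)
    then have "\<kappa> * ed = 2 * k * (a * ed) + k * ed" by (simp add: algebra_simps)
    also have "\<dots> \<le> 2 * k * eWd + k * ed" using k \<open>a * ed \<le> eWd\<close> by (intro add_mono mult_left_mono) auto
    finally show ?thesis by (simp add: algebra_simps)
  qed
  moreover define q where "q = (1 - 1 / N) * L"
  \<comment> \<open>The square of 2 \<kappa> d - q s is expanded and divided by 4 \<kappa>. The
    coefficient \<kappa> is chosen so that the distance term is absorbed by the one already on the
    left.\<close>
  have "q * esd \<le> \<kappa> * ed + q\<^sup>2 / (4 * \<kappa>) * es"
  proof -
    have "q * esd = (\<integral>\<gamma>. q * (s (\<gamma> 0) * dd \<gamma>) \<partial>P)" by (simp add: esd_def)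
    also have "\<dots> \<le> (\<integral>\<gamma>. \<kappa> * (dd \<gamma>)\<^sup>2 + q\<^sup>2 / (4 * \<kappa>) * (s (\<gamma> 0))\<^sup>2 \<partial>P)"
    proof (rule integral_mono)
      fix \<gamma>
      have "0 \<le> (2 * \<kappa> * dd \<gamma> - q * s (\<gamma> 0))\<^sup>2 / (4 * \<kappa>)" using \<kappa> by simp
      also have "\<dots> = \<kappa> * (dd \<gamma>)\<^sup>2 + q\<^sup>2 / (4 * \<kappa>) * (s (\<gamma> 0))\<^sup>2 - q * (s (\<gamma> 0) * dd \<gamma>)"
        using \<kappa> by (simp add: field_simps power2_eq_square)
      finally show "q * (s (\<gamma> 0) * dd \<gamma>) \<le> \<kappa> * (dd \<gamma>)\<^sup>2 + q\<^sup>2 / (4 * \<kappa>) * (s (\<gamma> 0))\<^sup>2" by simp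
    qed (use intsd intd ints in auto)
    also have "\<dots> = \<kappa> * ed + q\<^sup>2 / (4 * \<kappa>) * es" using intd ints by (simp add: ed_def es_def)
    finally show ?thesis .
  qed
  ultimately have main: "1 - eW \<le> q\<^sup>2 / (4 * \<kappa>) * es" using lim unfolding q_def by linarith
  define m where "m = measure \<nu> S"
  have m: "0 < m" using emeasure_S by (simp add: m_def)
  have push: "(\<integral>\<gamma>. h (\<gamma> 0) \<partial>P) = (\<integral>x. indicator S x * (w x * h x) \<partial>\<nu>) / m"
    if [measurable]: "h \<in> borel_measurable (fwd_borel d)" for h :: "'a \<Rightarrow> real"
  proof -
    have hn: "h \<in> borel_measurable \<nu>" "start_density \<in> borel_measurable \<nu>" by (simp_all add: measurable_nu_iff)
    have "(\<integral>\<gamma>. h (\<gamma> 0) \<partial>P) = (\<integral>x. h x \<partial>eval_at d P 0)"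
      unfolding eval_at_def by (rule integral_distr[symmetric]) measurable
    also have "\<dots> = (\<integral>x. start_density x *\<^sub>R h x \<partial>\<nu>)"
      unfolding P(2) using hn start_density_bounds(1) by (intro integral_density) auto
    also have "\<dots> = (\<integral>x. indicator S x * (w x * h x) / m \<partial>\<nu>)"
      by (intro Bochner_Integration.integral_cong) (auto simp: start_density_def m_def)
    finally show ?thesis by simp
  qed
  have intwh: "integrable \<nu> (\<lambda>x. indicator S x * h x)"
    if [measurable]: "h \<in> borel_measurable (fwd_borel d)" and "\<And>x. \<bar>h x\<bar> \<le> A" for h :: "'a \<Rightarrow> real" and A
  proof -
    have "integrable \<nu> (\<lambda>x. indicator S x *\<^sub>R h x)"
      using that(2) emeasure_S(3) by (intro integrableI_bounded_set_indicator[where B = A]) (auto simp: measurable_nu_iff)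
    then show ?thesis by simp
  qed
  have C0: "0 \<le> C" using w(3)[of undefined] w_pos[of undefined] by linarith
  have one: "1 = (\<integral>x. indicator S x * w x \<partial>\<nu>) / m" using push[of "\<lambda>_. 1"] by (simp add: P.prob_space)
  have eW: "eW = (\<integral>x. indicator S x * w x powr (1 - 1 / N) \<partial>\<nu>) / m"
  proof -
    have "w x * weight x = w x powr (1 - 1 / N)" for x
      using powr_add[of "w x" 1 "- 1 / N"] w_pos[of x] by (simp add: weight_def)
    then show ?thesis using push[of weight] by (simp add: eW_def)
  qed
  have es: "es = (\<integral>x. indicator S x * ((s x)\<^sup>2 * w x) \<partial>\<nu>) / m"
    using push[of "\<lambda>x. (s x)\<^sup>2"] by (simp add: es_def mult.commute)
  have "integrable \<nu> (\<lambda>x. indicator S x * w x)"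
    using w(3) w_pos by (intro intwh[of _ C]) (auto simp: less_imp_le)
  moreover have "integrable \<nu> (\<lambda>x. indicator S x * w x powr (1 - 1 / N))"
    using w(3) w_pos N by (intro intwh[of _ "C powr (1 - 1 / N)"]) (auto intro!: powr_mono2 simp: less_imp_le)
  ultimately have "(\<integral>x. indicator S x * (w x - w x powr (1 - 1 / N)) \<partial>\<nu>)
      = (\<integral>x. indicator S x * w x \<partial>\<nu>) - (\<integral>x. indicator S x * w x powr (1 - 1 / N) \<partial>\<nu>)"
    by (simp add: right_diff_distrib)
  also have "\<dots> = m * (1 - eW)" using m by (subst one) (simp add: eW field_simps)
  also have "\<dots> \<le> m * (q\<^sup>2 / (4 * \<kappa>) * es)" using main m by (intro mult_left_mono) auto
  also have "\<dots> = q\<^sup>2 / (4 * \<kappa>) * (\<integral>x. indicator S x * ((s x)\<^sup>2 * w x) \<partial>\<nu>)" using m by (simp add: es)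
  finally show ?thesis by (simp add: q_def)
qed

end

end

end

section \<open>The spectral gap\<close>

text \<open>Mean value theorem. Only x - y is bounded from above: a negative power grows only where
  its base decreases, and this one-sidedness is what brings in the descending slope.\<close>

lemma powr_neg_diff_le:
  fixes r c x y z :: real
  assumes "0 < r" "0 < c" "c \<le> x" "c \<le> y" "x - y \<le> z" "0 \<le> z"
  shows "y powr (- r) - x powr (- r) \<le> r * c powr (- r - 1) * z"
proof (cases "x \<le> y")
  case True
  then have "y powr (- r) \<le> x powr (- r)" using assms by (intro powr_mono2') auto
  moreover have "0 \<le> r * c powr (- r - 1) * z" using assms by simp
  ultimately show ?thesis by linarith
next
  case False
  then have "y < x" by simp
  then obtain \<xi> where \<xi>: "y < \<xi>" "\<xi> < x" "x powr (- r) - y powr (- r) = (x - y) * (- r * \<xi> powr (- r - 1))"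
    using MVT2[OF \<open>y < x\<close>, of "\<lambda>u. u powr (- r)" "\<lambda>u. - r * u powr (- r - 1)"]
      has_real_derivative_powr[of _ "- r"] assms by fastforce
  have "\<xi> powr (- r - 1) \<le> c powr (- r - 1)" using assms \<xi> by (intro powr_mono2') auto
  then have "(x - y) * (r * \<xi> powr (- r - 1)) \<le> z * (r * c powr (- r - 1))"
    using assms \<open>y < x\<close> by (intro mult_mono) auto
  then show ?thesis using \<xi>(3) by (simp add: algebra_simps)
qed

text \<open>The second derivative of (1 + u)^q is - q (1 - q) (1 + u)^(q - 2), on [- b, b] smallest
  in absolute value at b. With this coefficient the right side minus the left, \<open>g\<close>, is
  convex with value and slope 0 at 0.\<close>

lemma one_plus_powr_le_quadratic:
  fixes q b u :: real
  assumes q: "0 < q" "q < 1" and b: "b < 1" "\<bar>u\<bar> \<le> b"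
  shows "(1 + u) powr q \<le> 1 + q * u - q * (1 - q) / 2 * (1 + b) powr (q - 2) * u\<^sup>2"
proof -
  define c where "c = q * (1 - q) / 2 * (1 + b) powr (q - 2)"
  define g where "g v = 1 + q * v - c * v\<^sup>2 - (1 + v) powr q" for v
  define g' where "g' v = q - 2 * c * v - q * (1 + v) powr (q - 1)" for v
  have "g' 0 * (u - 0) \<le> g u - g 0"
  proof (rule f''_imp_f')
    show "convex {-b..b}" by simp
    show "0 \<in> {-b..b}" "u \<in> {-b..b}" using b by auto
    fix v assume v: "v \<in> {-b..b}"
    then have pos: "0 < 1 + v" using b by auto
    show "(g has_real_derivative g' v) (at v)"
      unfolding g_def g'_def using pos by (auto intro!: derivative_eq_intros simp: powr_diff field_simps)
    show "(g' has_real_derivative (- 2 * c - q * ((q - 1) * (1 + v) powr (q - 2)))) (at v)"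
    proof -
      have "((\<lambda>v. (1 + v) powr (q - 1)) has_real_derivative (q - 1) * (1 + v) powr (q - 1 - 1) * 1) (at v)"
        using pos by (intro DERIV_chain2[OF has_real_derivative_powr]) (auto intro!: derivative_eq_intros)
      then show ?thesis unfolding g'_def using pos by (auto intro!: derivative_eq_intros)
    qed
    have "(1 + b) powr (q - 2) \<le> (1 + v) powr (q - 2)" using v pos q by (intro powr_mono2') auto
    then have "q * (1 - q) * (1 + b) powr (q - 2) \<le> q * (1 - q) * (1 + v) powr (q - 2)"
      using q by (intro mult_left_mono) auto
    moreover have "2 * c = q * (1 - q) * (1 + b) powr (q - 2)" by (simp add: c_def)
    moreover have "- q * ((q - 1) * (1 + v) powr (q - 2)) = q * (1 - q) * (1 + v) powr (q - 2)" by (simp add: algebra_simps)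
    ultimately show "0 \<le> - 2 * c - q * ((q - 1) * (1 + v) powr (q - 2))" by linarith
  qed
  then show ?thesis by (simp add: g_def g'_def c_def)
qed

context weak_CD_space
begin

lemma integrable_on_S:
  assumes "p \<in> S" and [measurable]: "h \<in> borel_measurable (fwd_borel d)" and "\<And>x. \<bar>h x\<bar> \<le> A"
  shows "integrable \<nu> (\<lambda>x. indicator S x * h x :: real)"
proof -
  have "integrable \<nu> (\<lambda>x. indicator S x *\<^sub>R h x)"
    using assms(3) emeasure_S(3)[OF assms(1)]
    by (intro integrableI_bounded_set_indicator[where B = A]) (auto simp: measurable_nu_iff)
  then show ?thesis by simp
qed

text \<open>The function \<open>s\<close> bounds difference quotients at a fixed scale \<delta>, so
  it does not change while the perturbation size e tends to 0. The constants depend on e only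
  through the bounds 1 - e M and 1 + e M of the perturbed density, which tend to 1.\<close>

lemma spectral_gap_at_scale:
  fixes f s :: "'a \<Rightarrow> real"
  assumes p: "p \<in> S" and fM [measurable]: "f \<in> borel_measurable (fwd_borel d)" and f: "\<And>x. \<bar>f x\<bar> \<le> M"
    and mean: "(\<integral>x. indicator S x * f x \<partial>\<nu>) = 0"
    and sM [measurable]: "s \<in> borel_measurable (fwd_borel d)" and s: "\<And>x. 0 \<le> s x" "\<And>x. s x \<le> B"
    and \<delta>: "0 < \<delta>" and slope: "\<And>x y. x \<in> S \<Longrightarrow> y \<in> S \<Longrightarrow> d x y < \<delta> \<Longrightarrow> f x - f y \<le> s x * d x y"
  shows "(\<integral>x. indicator S x * (f x)\<^sup>2 \<partial>\<nu>) \<le> (N - 1) / (N * K) * (\<integral>x. indicator S x * (s x)\<^sup>2 \<partial>\<nu>)"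
proof -
  define q where "q = 1 - 1 / N"
  have q: "0 < q" "q < 1" using N by (auto simp: q_def)
  have M0: "0 \<le> M" using f[of undefined] by linarith
  define F where "F = (\<integral>x. indicator S x * (f x)\<^sup>2 \<partial>\<nu>)"
  define G where "G = (\<integral>x. indicator S x * (s x)\<^sup>2 \<partial>\<nu>)"
  note int = integrable_on_S[OF p]
  have int1: "integrable \<nu> (\<lambda>x. indicator S x * f x)" using f by (intro int) auto
  have int2: "integrable \<nu> (\<lambda>x. indicator S x * (f x)\<^sup>2)"
    using f by (intro int[where A = "M\<^sup>2"]) (auto simp: abs_le_square_iff[symmetric] intro!: power_mono[of "\<bar>_\<bar>" M 2, simplified])
  have int3: "integrable \<nu> (\<lambda>x. indicator S x * (s x)\<^sup>2)"
    using s by (intro int[where A = "B\<^sup>2"]) (auto intro!: power_mono)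
  have int0: "integrable \<nu> (\<lambda>x. indicator S x * (1 :: real))" by (intro int[where h = "\<lambda>_. 1" and A = 1]) auto
  have ineq: "q / (2 * N) * (1 + e * M) powr (q - 2) * F
      \<le> (q * (1 / N * (1 - e * M) powr (- 1 / N - 1)))\<^sup>2 / (4 * (K / (6 * N) * (2 * (1 + e * M) powr (- 1 / N) + 1))) * (1 + e * M) * G"
    if e: "0 < e" "e * M < 1" for e
  proof -
    define w where "w x = 1 + e * f x" for x
    have [measurable]: "w \<in> borel_measurable (fwd_borel d)" unfolding w_def by measurable
    have ef: "\<bar>e * f x\<bar> \<le> e * M" for x using f[of x] e by (simp add: abs_mult)
    have c0: "0 < 1 - e * M" using e by simp
    have w: "1 - e * M \<le> w x" "w x \<le> 1 + e * M" for x
      using ef[of x] by (auto simp: w_def abs_le_iff)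
    have wpos: "0 < w x" for x using w(1)[of x] c0 by linarith
    \<comment> \<open>The mean of f being zero, the perturbation 1 + e f preserves the total mass of
      S.\<close>
    have mass: "(\<integral>\<^sup>+x\<in>S. ennreal (w x) \<partial>\<nu>) = emeasure \<nu> S"
    proof -
      have "(\<integral>\<^sup>+x\<in>S. ennreal (w x) \<partial>\<nu>) = (\<integral>\<^sup>+x. ennreal (indicator S x * 1 + e * (indicator S x * f x)) \<partial>\<nu>)"
        by (intro nn_integral_cong) (auto simp: w_def indicator_def)
      also have "\<dots> = ennreal (\<integral>x. indicator S x * 1 + e * (indicator S x * f x) \<partial>\<nu>)"
      proof (rule nn_integral_eq_integral)
        show "integrable \<nu> (\<lambda>x. indicator S x * 1 + e * (indicator S x * f x))"
          by (intro Bochner_Integration.integrable_add integrable_mult_right int0 int1)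
      qed (use wpos in \<open>auto simp: w_def indicator_def less_imp_le\<close>)
      also have "(\<integral>x. indicator S x * 1 + e * (indicator S x * f x) \<partial>\<nu>) = measure \<nu> S"
        using Bochner_Integration.integral_add[OF int0 integrable_mult_right[OF int1, of e]] mean by simp
      finally show ?thesis using emeasure_S[OF p] by simp
    qed
    define a where "a = (1 + e * M) powr (- 1 / N)"
    \<comment> \<open>A Lipschitz constant of u^(- 1 / N) on u \<ge> 1 - e M, by the derivative at
      the left end.\<close>
    define l where "l = 1 / N * (1 - e * M) powr (- 1 / N - 1)"
    have l0: "0 \<le> l" using N by (simp add: l_def)
    have "0 < 1 + e * M" using e M0 by (simp add: add_pos_nonneg)
    then have a0: "0 < a" by (simp add: a_def)
    have wM: "w \<in> borel_measurable (fwd_borel d)" by measurable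
    have main: "(\<integral>x. indicator S x * (w x - w x powr (1 - 1 / N)) \<partial>\<nu>)
     \<le> ((1 - 1 / N) * (e * l))\<^sup>2 / (4 * (K / (6 * N) * (2 * a + 1))) * (\<integral>x. indicator S x * ((s x)\<^sup>2 * w x) \<partial>\<nu>)"
    proof (rule derivative_inequality[OF p wM c0 w mass sM s _ \<delta> a0])
      show "a \<le> weight w x" for x
        unfolding weight_def[OF p wM c0 w mass] a_def using wpos w(2) N by (intro powr_mono2') auto
      fix x y assume xy: "x \<in> S" "y \<in> S" "d x y < \<delta>"
      have "w y powr (- (1 / N)) - w x powr (- (1 / N)) \<le> 1 / N * (1 - e * M) powr (- (1 / N) - 1) * (e * (s x * d x y))"
      proof (rule powr_neg_diff_le)
        have "e * (f x - f y) \<le> e * (s x * d x y)" using slope[OF xy] e by (intro mult_left_mono) auto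
        then show "w x - w y \<le> e * (s x * d x y)" by (simp add: w_def algebra_simps)
      qed (use N c0 w s e in auto)
      then show "weight w y - weight w x \<le> e * l * (s x * d x y)"
        unfolding weight_def[OF p wM c0 w mass] l_def by (simp add: mult_ac)
    qed (use e l0 in auto)
    define cc where "cc = q * (1 - q) / 2 * (1 + e * M) powr (q - 2)"
    have intw: "integrable \<nu> (\<lambda>x. indicator S x * (w x - w x powr (1 - 1 / N)))"
    proof (rule int)
      fix x
      have "w x powr (1 - 1 / N) \<le> (1 + e * M) powr (1 - 1 / N)"
        using w(2)[of x] wpos[of x] N by (intro powr_mono2) auto
      moreover have "0 \<le> w x powr (1 - 1 / N)" "0 \<le> (1 + e * M) powr (1 - 1 / N)" by simp_all
      ultimately show "\<bar>w x - w x powr (1 - 1 / N)\<bar> \<le> 1 + e * M + (1 + e * M) powr (1 - 1 / N)"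
        using w(2)[of x] wpos[of x] unfolding abs_le_iff by linarith
    qed measurable
    \<comment> \<open>The term linear in f has integral 0 and is inserted to allow a pointwise
      comparison with w - w^q.\<close>
    have "cc * e\<^sup>2 * F = (\<integral>x. (1 - q) * e * (indicator S x * f x) + cc * e\<^sup>2 * (indicator S x * (f x)\<^sup>2) \<partial>\<nu>)"
      using int1 int2 mean by (simp add: F_def)
    also have "\<dots> \<le> (\<integral>x. indicator S x * (w x - w x powr (1 - 1 / N)) \<partial>\<nu>)"
    proof (rule integral_mono[OF _ intw])
      fix x
      have "(1 + e * f x) powr q \<le> 1 + q * (e * f x) - cc * (e * f x)\<^sup>2"
        unfolding cc_def using e ef by (intro one_plus_powr_le_quadratic q)
      then have "(1 - q) * e * f x + cc * e\<^sup>2 * (f x)\<^sup>2 \<le> w x - w x powr q"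
        by (simp add: w_def algebra_simps power_mult_distrib)
      then show "(1 - q) * e * (indicator S x * f x) + cc * e\<^sup>2 * (indicator S x * (f x)\<^sup>2)
          \<le> indicator S x * (w x - w x powr (1 - 1 / N))"
        by (cases "x \<in> S") (auto simp: q_def)
    qed (use int1 int2 in auto)
    also note main
    also have "((1 - 1 / N) * (e * l))\<^sup>2 / (4 * (K / (6 * N) * (2 * a + 1))) * (\<integral>x. indicator S x * ((s x)\<^sup>2 * w x) \<partial>\<nu>)
        \<le> ((1 - 1 / N) * (e * l))\<^sup>2 / (4 * (K / (6 * N) * (2 * a + 1))) * ((1 + e * M) * G)"
    proof (rule mult_left_mono)
      have "(\<integral>x. indicator S x * ((s x)\<^sup>2 * w x) \<partial>\<nu>) \<le> (\<integral>x. (1 + e * M) * (indicator S x * (s x)\<^sup>2) \<partial>\<nu>)"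
      proof (rule integral_mono)
        show "integrable \<nu> (\<lambda>x. indicator S x * ((s x)\<^sup>2 * w x))"
        proof (rule int)
          fix x show "\<bar>(s x)\<^sup>2 * w x\<bar> \<le> B\<^sup>2 * (1 + e * M)"
            using s[of x] w[of x] wpos[of x] by (auto simp: abs_mult intro!: mult_mono power_mono)
        qed measurable
        show "indicator S x * ((s x)\<^sup>2 * w x) \<le> (1 + e * M) * (indicator S x * (s x)\<^sup>2)" for x
          using mult_right_mono[OF w(2)[of x], of "(s x)\<^sup>2"] by (auto simp: indicator_def mult.commute)
      qed (use int3 in auto)
      then show "(\<integral>x. indicator S x * ((s x)\<^sup>2 * w x) \<partial>\<nu>) \<le> (1 + e * M) * G" by (simp add: G_def)
      show "0 \<le> ((1 - 1 / N) * (e * l))\<^sup>2 / (4 * (K / (6 * N) * (2 * a + 1)))" using K N a0 by simp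
    qed
    also have "\<dots> = e\<^sup>2 * ((q * l)\<^sup>2 / (4 * (K / (6 * N) * (2 * a + 1))) * (1 + e * M) * G)"
      by (simp add: q_def power_mult_distrib)
    finally have "e\<^sup>2 * (cc * F) \<le> e\<^sup>2 * ((q * l)\<^sup>2 / (4 * (K / (6 * N) * (2 * a + 1))) * (1 + e * M) * G)"
      by (simp add: mult_ac)
    then have "cc * F \<le> (q * l)\<^sup>2 / (4 * (K / (6 * N) * (2 * a + 1))) * (1 + e * M) * G"
      using e by (simp only: mult_le_cancel_left_pos zero_less_power)
    moreover have "cc = q / (2 * N) * (1 + e * M) powr (q - 2)" by (simp add: cc_def q_def)
    ultimately show ?thesis by (simp only: l_def a_def)
  qed
  \<comment> \<open>At e = 0 all powers of 1 disappear and the denominator becomes 4 (K / (6 N)) 3 =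
    2 K / N.\<close>
  have "q / (2 * N) * (1 + 0 * M) powr (q - 2) * F
      \<le> (q * (1 / N * (1 - 0 * M) powr (- 1 / N - 1)))\<^sup>2 / (4 * (K / (6 * N) * (2 * (1 + 0 * M) powr (- 1 / N) + 1))) * (1 + 0 * M) * G"
  proof (rule tendsto_le)
    show "((\<lambda>e. q / (2 * N) * (1 + e * M) powr (q - 2) * F) \<longlongrightarrow> q / (2 * N) * (1 + 0 * M) powr (q - 2) * F) (at_right 0)"
      by (intro tendsto_intros) auto
    show "((\<lambda>e. (q * (1 / N * (1 - e * M) powr (- 1 / N - 1)))\<^sup>2 / (4 * (K / (6 * N) * (2 * (1 + e * M) powr (- 1 / N) + 1))) * (1 + e * M) * G)
      \<longlongrightarrow> (q * (1 / N * (1 - 0 * M) powr (- 1 / N - 1)))\<^sup>2 / (4 * (K / (6 * N) * (2 * (1 + 0 * M) powr (- 1 / N) + 1))) * (1 + 0 * M) * G) (at_right 0)"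
      using K N by (intro tendsto_intros) auto
    show "\<forall>\<^sub>F e in at_right 0. q / (2 * N) * (1 + e * M) powr (q - 2) * F
      \<le> (q * (1 / N * (1 - e * M) powr (- 1 / N - 1)))\<^sup>2 / (4 * (K / (6 * N) * (2 * (1 + e * M) powr (- 1 / N) + 1))) * (1 + e * M) * G"
      unfolding eventually_at_right_field
    proof (intro exI[of _ "1 / (M + 1)"] conjI allI impI ineq)
      fix e assume "0 < e" "e < 1 / (M + 1)"
      then have "e * (M + 1) < 1" using M0 by (simp add: less_divide_eq)
      then show "e * M < 1" using \<open>0 < e\<close> by (simp add: algebra_simps)
    qed (use M0 in auto)
  qed simp
  then have "q / (2 * N) * F \<le> q / (2 * N) * (q / K * G)"
    using K N by (simp add: field_simps power2_eq_square)
  moreover have "0 < q / (2 * N)" using q N by simp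
  ultimately have "F \<le> q / K * G" by (simp only: mult_le_cancel_left_pos)
  moreover have "q / K = (N - 1) / (N * K)" using N K by (simp add: q_def field_simps)
  ultimately show ?thesis by (simp add: F_def G_def)
qed

section \<open>Measurable approximation of the descending slope\<close>

lemma dense_sequence_in_S:
  assumes "p \<in> S"
  obtains u :: "nat \<Rightarrow> 'a" where "range u \<subseteq> S" "\<And>x e. x \<in> S \<Longrightarrow> 0 < e \<Longrightarrow> \<exists>n. sd (u n) x < e"
proof -
  \<comment> \<open>For each dense point and each tolerance, a point of S within the tolerance is
    picked if there is one, and p otherwise.\<close>
  define v where "v n k = (if \<exists>z\<in>S. sd (dense_seq n) z < 1 / real (Suc k)
    then SOME z. z \<in> S \<and> sd (dense_seq n) z < 1 / real (Suc k) else p)" for n k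
  have v: "v n k \<in> S \<and> sd (dense_seq n) (v n k) < 1 / real (Suc k)"
    if "z \<in> S" "sd (dense_seq n) z < 1 / real (Suc k)" for n k z
    using that someI[of "\<lambda>z. z \<in> S \<and> sd (dense_seq n) z < 1 / real (Suc k)" z] unfolding v_def by auto
  have vS: "v n k \<in> S" for n k
    using v[of _ n k] assms by (cases "\<exists>z\<in>S. sd (dense_seq n) z < 1 / real (Suc k)") (auto simp: v_def)
  show ?thesis
  proof (rule that[of "\<lambda>i. v (fst (prod_decode i)) (snd (prod_decode i))"])
    fix x e assume x: "x \<in> S" "0 < (e :: real)"
    obtain k where k: "1 / real (Suc k) < e / 2" using nat_approx_posE[of "e / 2"] x by auto
    obtain n where n: "sd (dense_seq n) x < 1 / real (Suc k)"
      using dense_seq by (metis of_nat_0_less_iff zero_less_Suc zero_less_divide_1_iff)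
    have "sd (v n k) x \<le> sd (v n k) (dense_seq n) + sd (dense_seq n) x" by (rule sd.triangle) auto
    then have "sd (v n k) x < e" using v[OF x(1) n] n k by (simp add: sd.commute)
    then show "\<exists>i. sd (v (fst (prod_decode i)) (snd (prod_decode i))) x < e"
      by (intro exI[of _ "prod_encode (n, k)"]) simp
  qed (use vS in auto)
qed

text \<open>The descending slope is the decreasing limit of measurable functions \<open>s n\<close>, the suprema of the
  difference quotients over points at distance less than \<open>1 / (n + 1)\<close>.\<close>

lemma descending_slope_approximation:
  fixes f :: "'a \<Rightarrow> real"
  assumes p: "p \<in> S" and fM [measurable]: "f \<in> borel_measurable (fwd_borel d)" and C: "0 < C"
    and lip: "\<And>x y. x \<in> S \<Longrightarrow> y \<in> S \<Longrightarrow> f y - f x \<le> C * d x y"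
  obtains s :: "nat \<Rightarrow> 'a \<Rightarrow> real" and B l where "\<And>n. s n \<in> borel_measurable (fwd_borel d)"
    "\<And>n x. 0 \<le> s n x" "\<And>n x. s n x \<le> B"
    "\<And>n x y. x \<in> S \<Longrightarrow> y \<in> S \<Longrightarrow> d x y < 1 / real (Suc n) \<Longrightarrow> f x - f y \<le> s n x * d x y"
    "\<And>x. (\<lambda>n. s n x) \<longlonglongrightarrow> l x" "\<And>x. x \<in> S \<Longrightarrow> ennreal (l x) \<le> descending_slope d S f x"
proof -
  obtain u :: "nat \<Rightarrow> 'a" where u: "range u \<subseteq> S" "\<And>x e. x \<in> S \<Longrightarrow> 0 < e \<Longrightarrow> \<exists>n. sd (u n) x < e"
    using dense_sequence_in_S[OF p] by metis
  have uS: "u k \<in> S" for k using u(1) by blast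
  \<comment> \<open>S is bounded, so one reversibility constant serves all its points. It turns the
    Lipschitz bound by \<open>d (u k) x\<close> into one by \<open>d x (u k)\<close>, the
    denominator of the slope.\<close>
  obtain \<Lambda> where \<Lambda>: "1 \<le> \<Lambda>" "\<And>y z. y \<in> fwd_cball d p (diam_bound K N + 1) \<Longrightarrow>
      z \<in> fwd_cball d p (diam_bound K N + 1) \<Longrightarrow> d y z \<le> \<Lambda> * d z y"
    using reversible_on_cball[of p "diam_bound K N + 1"] by metis
  have "S \<subseteq> fwd_cball d p (diam_bound K N + 1)"
    using diameter_le[OF p] fwd_ball_subset_cball[of p "diam_bound K N + 1"] by (fastforce simp: fwd_ball_def)
  then have rev: "d y x \<le> \<Lambda> * d x y" if "x \<in> S" "y \<in> S" for x y using \<Lambda>(2) that by blast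
  define B where "B = C * \<Lambda>"
  have B0: "0 \<le> B" using C \<Lambda> by (simp add: B_def)
  define T where "T n k x = (if x \<in> S \<and> 0 < d x (u k) \<and> d x (u k) < 1 / real (Suc n)
    then max (f x - f (u k)) 0 / d x (u k) else 0)" for n k x
  have T0: "0 \<le> T n k x" for n k x by (simp add: T_def)
  have TB: "T n k x \<le> B" for n k x
  proof (cases "x \<in> S \<and> 0 < d x (u k) \<and> d x (u k) < 1 / real (Suc n)")
    case True
    then have "f x - f (u k) \<le> C * d (u k) x" using lip uS by blast
    also have "\<dots> \<le> C * (\<Lambda> * d x (u k))" using C rev[of x "u k"] True uS by (intro mult_left_mono) auto
    finally have "max (f x - f (u k)) 0 \<le> B * d x (u k)" using B0 by (simp add: B_def)
    then show ?thesis using True by (simp add: T_def divide_le_eq)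
  qed (use B0 in \<open>auto simp: T_def\<close>)
  have TM [measurable]: "T n k \<in> borel_measurable (fwd_borel d)" for n k unfolding T_def by measurable
  define s where "s n x = (SUP k. T n k x)" for n x
  have bdd: "bdd_above (range (\<lambda>k. T n k x))" for n x by (intro bdd_aboveI2[of _ _ B] TB)
  have Ts: "T n k x \<le> s n x" for n k x unfolding s_def by (intro cSUP_upper bdd) auto
  have s_le: "s n x \<le> A" if "\<And>k. T n k x \<le> A" for n x A unfolding s_def by (intro cSUP_least that) auto
  have s0: "0 \<le> s n x" for n x using T0[of n 0 x] Ts[of n 0 x] by linarith
  have sB: "s n x \<le> B" for n x by (intro s_le TB)
  have dec: "s (Suc n) x \<le> s n x" for n x
  proof (rule s_le)
    fix k
    have "1 / real (Suc (Suc n)) \<le> 1 / real (Suc n)" by (intro divide_left_mono) auto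
    then have "T (Suc n) k x \<le> T n k x" using T0[of n k x] by (auto simp: T_def)
    also have "\<dots> \<le> s n x" by (rule Ts)
    finally show "T (Suc n) k x \<le> s n x" .
  qed
  define l where "l x = (INF n. s n x)" for x
  have lim: "(\<lambda>n. s n x) \<longlonglongrightarrow> l x" for x
    unfolding l_def by (intro LIMSEQ_decseq_INF decseq_SucI dec bdd_belowI2[of _ 0] s0)
  have lle: "l x \<le> s n x" for n x
    unfolding l_def by (intro cINF_lower bdd_belowI2[of _ 0] s0) auto
  have local: "f x - f y \<le> s n x * d x y" if xy: "x \<in> S" "y \<in> S" "d x y < 1 / real (Suc n)" for n x y
  proof (cases "x = y")
    case False
    then have pos: "0 < d x y" by (simp add: less_le)
    show ?thesis
    \<comment> \<open>An arbitrary y is replaced by a nearby \<open>u k\<close> at a cost of at most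
      e. The radius \<open>r\<close> also keeps \<open>u k\<close> away from x and within the
      scale.\<close>
    proof (rule field_le_epsilon)
      fix e :: real assume e: "0 < e"
      define r where "r = min (min (d x y) (1 / real (Suc n) - d x y)) (e / (s n x + C))"
      have sC: "0 < s n x + C" using s0[of n x] C by linarith
      then have r: "0 < r" using pos xy e by (simp add: r_def)
      then obtain k where k: "sd (u k) y < r" using u(2)[OF xy(2)] by blast
      have close: "\<bar>d x (u k) - d x y\<bar> \<le> sd (u k) y" using d_diff_le[of x "u k" x y] by simp
      have "0 < d x (u k)" "d x (u k) < 1 / real (Suc n)" using close k by (auto simp: r_def abs_le_iff)
      then have "f x - f (u k) \<le> T n k x * d x (u k)" using xy by (simp add: T_def)
      also have "\<dots> \<le> s n x * d x (u k)" by (intro mult_right_mono Ts) auto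
      also have "\<dots> \<le> s n x * (d x y + sd (u k) y)" using close s0 by (intro mult_left_mono) (auto simp: abs_le_iff)
      finally have "f x - f (u k) \<le> s n x * d x y + s n x * sd (u k) y" by (simp add: algebra_simps)
      moreover have "f (u k) - f y \<le> C * sd (u k) y"
        using lip[OF xy(2) uS[of k]] d_le_sd(2)[of y "u k"] C mult_left_mono[of "d y (u k)" "sd (u k) y" C] by linarith
      moreover have "s n x * sd (u k) y + C * sd (u k) y \<le> e"
      proof -
        have "(s n x + C) * sd (u k) y \<le> (s n x + C) * (e / (s n x + C))"
          using k sC by (intro mult_left_mono) (auto simp: r_def)
        also have "\<dots> = e" using sC by simp
        finally show ?thesis by (simp add: algebra_simps)
      qed
      ultimately show "f x - f y \<le> s n x * d x y + e" by linarith
    qed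
  qed (simp add: s0)
  have slope: "ennreal (l x) \<le> descending_slope d S f x" if x: "x \<in> S" for x
  \<comment> \<open>A finite v above the slope bounds the quotients on a ball about x, hence bounds
    \<open>s n x\<close> once 1 / (n + 1) is below the radius of that ball.\<close>
  proof (rule dense_ge)
    fix v assume v: "descending_slope d S f x < v"
    show "ennreal (l x) \<le> v"
    proof (cases "v = \<top>")
      case False
      have "\<forall>\<^sub>F y in atin_within (fwd_topology d) x S. ennreal (max (- (f y - f x)) 0 / d x y) < v"
        using v unfolding descending_slope_def by (rule Limsup_lessD)
      then obtain U where U: "openin (fwd_topology d) U" "x \<in> U"
        "\<And>y. y \<in> U \<Longrightarrow> y \<in> S \<Longrightarrow> y \<noteq> x \<Longrightarrow> ennreal (max (- (f y - f x)) 0 / d x y) < v"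
        unfolding eventually_atin_within by auto
      obtain r where r: "0 < r" "fwd_ball d x r \<subseteq> U" using U(1,2) unfolding openin_fwd_iff by blast
      obtain n where n: "1 / real (Suc n) < r" using r nat_approx_posE by metis
      have "T n k x \<le> enn2real v" for k
      proof (cases "x \<in> S \<and> 0 < d x (u k) \<and> d x (u k) < 1 / real (Suc n)")
        case True
        then have "u k \<in> U" "u k \<noteq> x" using r(2) n by (auto simp: fwd_ball_def)
        then have "ennreal (T n k x) \<le> v" using U(3)[of "u k"] uS True by (simp add: T_def less_imp_le)
        then show ?thesis using enn2real_mono[of "ennreal (T n k x)" v] False T0[of n k x] by (simp add: less_top)
      next
        case False
        then show ?thesis by (auto simp: T_def)
      qed
      then have "s n x \<le> enn2real v" by (rule s_le)
      then have "l x \<le> enn2real v" using lle[of x n] by linarith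
      then have "ennreal (l x) \<le> ennreal (enn2real v)" by (rule ennreal_leI)
      also have "\<dots> = v" using False by (simp add: less_top)
      finally show ?thesis .
    qed simp
  qed
  have sM: "s n \<in> borel_measurable (fwd_borel d)" for n
    unfolding s_def by (rule borel_measurable_cSUP) (use bdd in auto)
  show ?thesis by (rule that[OF sM s0 sB local lim slope])
qed

text \<open>Superlevel sets are relatively open in S: by the Lipschitz bound, f stays above c on the
  points of S within \<open>sd\<close> distance (f x - c) / C of x.\<close>

lemma measurable_Lipschitz_on_S:
  assumes lip: "\<And>x y. x \<in> S \<Longrightarrow> y \<in> S \<Longrightarrow> f y - f x \<le> C * d x y" and C: "0 < C"
  shows "(\<lambda>x. indicator S x * f x :: real) \<in> borel_measurable (fwd_borel d)"
  unfolding borel_measurable_iff_greater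
proof
  fix c
  define U where "U = (\<Union>x\<in>{x \<in> S. c < f x}. sd.mball x ((f x - c) / C))"
  have "openin (fwd_topology d) U" unfolding U_def using openin_sd_ball by (intro openin_Union) auto
  then have [measurable]: "U \<in> sets (fwd_borel d)" by (rule sets_fwd_borel_open)
  have U: "x \<in> U \<longleftrightarrow> c < f x" if x: "x \<in> S" for x
  proof
    assume "x \<in> U"
    then obtain z where z: "z \<in> S" "c < f z" "sd z x < (f z - c) / C" by (auto simp: U_def)
    have "f z - f x \<le> C * d x z" by (rule lip[OF x z(1)])
    also have "\<dots> \<le> C * sd z x" using C d_le_sd(2)[of x z] by (intro mult_left_mono) auto
    also have "\<dots> < f z - c" using z(3) C by (simp add: less_divide_eq mult.commute)
    finally show "c < f x" by simp
  next
    assume "c < f x"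
    then show "x \<in> U" using x C by (auto simp: U_def intro!: bexI[of _ x])
  qed
  have "{x \<in> space (fwd_borel d). c < indicator S x * f x}
      = {x \<in> space (fwd_borel d). x \<in> S \<and> x \<in> U \<or> x \<notin> S \<and> c < 0}"
    using U by (auto simp: indicator_def)
  also have "\<dots> \<in> sets (fwd_borel d)" by measurable
  finally show "{x \<in> space (fwd_borel d). c < indicator S x * f x} \<in> sets (fwd_borel d)" .
qed

text \<open>As S has finite diameter, f extended by 0 off S is a bounded Borel function. The
  inequality at scale 1 / (n + 1) passes to the limit by dominated convergence, the quotient bounds
  being at most B on a set of finite mass.\<close>

lemma Lichnerowicz:
  fixes f :: "'a \<Rightarrow> real"
  assumes lipf: "fwd_Lipschitz_on d S f" and mean: "(LINT x:S|\<nu>. f x) = 0"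
  shows "(\<integral>\<^sup>+x\<in>S. ennreal ((f x)\<^sup>2) \<partial>\<nu>)
    \<le> ennreal ((N - 1) / (N * K)) * (\<integral>\<^sup>+x\<in>S. (descending_slope d S f x)\<^sup>2 \<partial>\<nu>)"
proof (cases "S = {}")
  case False
  then obtain p where p: "p \<in> S" by blast
  obtain C where C: "0 < C" and lip: "\<And>x y. x \<in> S \<Longrightarrow> y \<in> S \<Longrightarrow> f y - f x \<le> C * d x y"
    using lipf unfolding fwd_Lipschitz_on_def by blast
  define g where "g x = indicator S x * f x" for x
  have gM [measurable]: "g \<in> borel_measurable (fwd_borel d)"
    unfolding g_def using measurable_Lipschitz_on_S lip C by blast
  have gS: "g x = f x" if "x \<in> S" for x using that by (simp add: g_def)
  have lipg: "g y - g x \<le> C * d x y" if "x \<in> S" "y \<in> S" for x y using lip that by (simp add: gS)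
  define M where "M = \<bar>f p\<bar> + C * diam_bound K N"
  have M0: "0 \<le> M" using C K N by (simp add: M_def diam_bound_def)
  have gM': "\<bar>g x\<bar> \<le> M" for x
  proof (cases "x \<in> S")
    case True
    have "f x - f p \<le> C * diam_bound K N" "f p - f x \<le> C * diam_bound K N"
      using lip[OF p True] lip[OF True p] diameter_le[OF p True] diameter_le[OF True p] C
      by (auto elim!: order_trans intro!: mult_left_mono)
    moreover have "f p \<le> \<bar>f p\<bar>" "- f p \<le> \<bar>f p\<bar>" by simp_all
    ultimately show ?thesis unfolding M_def gS[OF True] abs_le_iff by linarith
  qed (use M0 in \<open>simp add: g_def\<close>)
  have mean': "(\<integral>x. indicator S x * g x \<partial>\<nu>) = 0"
  proof -
    have "(\<integral>x. indicator S x * g x \<partial>\<nu>) = (LINT x:S|\<nu>. f x)"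
      unfolding set_lebesgue_integral_def by (intro Bochner_Integration.integral_cong) (auto simp: g_def indicator_def)
    then show ?thesis using mean by simp
  qed
  obtain s :: "nat \<Rightarrow> 'a \<Rightarrow> real" and B l where sM [measurable]: "\<And>n. s n \<in> borel_measurable (fwd_borel d)"
    and s0: "\<And>n x. 0 \<le> s n x" and sB: "\<And>n x. s n x \<le> B"
    and sl: "\<And>n x y. x \<in> S \<Longrightarrow> y \<in> S \<Longrightarrow> d x y < 1 / real (Suc n) \<Longrightarrow> g x - g y \<le> s n x * d x y"
    and lim: "\<And>x. (\<lambda>n. s n x) \<longlonglongrightarrow> l x" and ls: "\<And>x. x \<in> S \<Longrightarrow> ennreal (l x) \<le> descending_slope d S g x"
    using descending_slope_approximation[OF p gM C lipg] by metis
  \<comment> \<open>The slope at a point of S is a limit over points of S only, where g and f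
    agree.\<close>
  have slope_eq: "descending_slope d S g x = descending_slope d S f x" if "x \<in> S" for x
    unfolding descending_slope_def using that
    by (intro Limsup_eq) (auto simp: eventually_atin_within gS intro!: exI[of _ "topspace (fwd_topology d)"])
  define k where "k = (N - 1) / (N * K)"
  have k0: "0 \<le> k" using N K by (simp add: k_def)
  have sq: "(\<integral>\<^sup>+x. ennreal ((h x)\<^sup>2) * indicator S x \<partial>\<nu>) = ennreal (\<integral>x. indicator S x * (h x)\<^sup>2 \<partial>\<nu>)"
    if [measurable]: "h \<in> borel_measurable (fwd_borel d)" and h: "\<And>x. \<bar>h x\<bar> \<le> A" for h :: "'a \<Rightarrow> real" and A
  proof -
    have "(h x)\<^sup>2 \<le> A\<^sup>2" for x using power_mono[OF h[of x], of 2] by simp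
    then have "integrable \<nu> (\<lambda>x. indicator S x * (h x)\<^sup>2)" by (intro integrable_on_S[OF p, where A = "A\<^sup>2"]) auto
    then have "(\<integral>\<^sup>+x. ennreal (indicator S x * (h x)\<^sup>2) \<partial>\<nu>) = ennreal (\<integral>x. indicator S x * (h x)\<^sup>2 \<partial>\<nu>)"
      by (intro nn_integral_eq_integral) auto
    moreover have "ennreal ((h x)\<^sup>2) * indicator S x = ennreal (indicator S x * (h x)\<^sup>2)" for x
      by (auto simp: indicator_def)
    ultimately show ?thesis by simp
  qed
  have scale: "(\<integral>\<^sup>+x\<in>S. ennreal ((g x)\<^sup>2) \<partial>\<nu>) \<le> ennreal k * (\<integral>\<^sup>+x\<in>S. ennreal ((s n x)\<^sup>2) \<partial>\<nu>)" for n
  proof -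
    have "(\<integral>x. indicator S x * (g x)\<^sup>2 \<partial>\<nu>) \<le> k * (\<integral>x. indicator S x * (s n x)\<^sup>2 \<partial>\<nu>)"
      unfolding k_def by (rule spectral_gap_at_scale[OF p gM gM' mean' sM s0 sB _ sl]) simp_all
    then have "ennreal (\<integral>x. indicator S x * (g x)\<^sup>2 \<partial>\<nu>) \<le> ennreal (k * (\<integral>x. indicator S x * (s n x)\<^sup>2 \<partial>\<nu>))"
      by (rule ennreal_leI)
    moreover have "(\<integral>\<^sup>+x\<in>S. ennreal ((s n x)\<^sup>2) \<partial>\<nu>) = ennreal (\<integral>x. indicator S x * (s n x)\<^sup>2 \<partial>\<nu>)"
      using s0 sB by (intro sq[OF sM, of _ B]) simp
    ultimately show ?thesis unfolding sq[OF gM gM'] using k0 by (simp add: ennreal_mult')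
  qed
  have lM [measurable]: "l \<in> borel_measurable (fwd_borel d)" by (rule borel_measurable_LIMSEQ_real[OF lim sM])
  have snu: "s n \<in> borel_measurable \<nu>" "l \<in> borel_measurable \<nu>" for n by (simp_all add: measurable_nu_iff)
  note [measurable] = snu
  have conv: "(\<lambda>n. \<integral>\<^sup>+x. ennreal ((s n x)\<^sup>2) * indicator S x \<partial>\<nu>) \<longlonglongrightarrow> (\<integral>\<^sup>+x. ennreal ((l x)\<^sup>2) * indicator S x \<partial>\<nu>)"
  proof (rule nn_integral_dominated_convergence[where w = "\<lambda>x. ennreal (B\<^sup>2) * indicator S x"])
    show "AE x in \<nu>. ennreal ((s n x)\<^sup>2) * indicator S x \<le> ennreal (B\<^sup>2) * indicator S x" for n
      using s0 sB by (intro AE_I2 mult_right_mono ennreal_leI power_mono) auto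
    show "(\<integral>\<^sup>+x. ennreal (B\<^sup>2) * indicator S x \<partial>\<nu>) < \<infinity>"
      using emeasure_S(3)[OF p] by (simp add: nn_integral_cmult_indicator ennreal_mult_less_top)
    show "AE x in \<nu>. (\<lambda>n. ennreal ((s n x)\<^sup>2) * indicator S x) \<longlonglongrightarrow> ennreal ((l x)\<^sup>2) * indicator S x"
      by (intro AE_I2 tendsto_mult_ennreal tendsto_ennrealI tendsto_power lim tendsto_const) (auto simp: indicator_def)
  qed measurable
  have "(\<integral>\<^sup>+x\<in>S. ennreal ((g x)\<^sup>2) \<partial>\<nu>) \<le> ennreal k * (\<integral>\<^sup>+x\<in>S. ennreal ((l x)\<^sup>2) \<partial>\<nu>)"
  proof (rule LIMSEQ_le_const)
    show "(\<lambda>n. ennreal k * (\<integral>\<^sup>+x. ennreal ((s n x)\<^sup>2) * indicator S x \<partial>\<nu>))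
        \<longlonglongrightarrow> ennreal k * (\<integral>\<^sup>+x. ennreal ((l x)\<^sup>2) * indicator S x \<partial>\<nu>)"
      by (rule ennreal_tendsto_cmult[OF _ conv]) simp
  qed (use scale in blast)
  also have "\<dots> \<le> ennreal k * (\<integral>\<^sup>+x\<in>S. (descending_slope d S f x)\<^sup>2 \<partial>\<nu>)"
  proof (intro mult_left_mono nn_integral_mono)
    fix x
    have "0 \<le> l x" using lim[of x] s0 by (intro LIMSEQ_le_const[OF lim]) auto
    then have "ennreal ((l x)\<^sup>2) = (ennreal (l x))\<^sup>2" by (simp add: ennreal_power)
    then show "ennreal ((l x)\<^sup>2) * indicator S x \<le> (descending_slope d S f x)\<^sup>2 * indicator S x"
      using power_mono[OF ls[of x], of 2] slope_eq[of x] by (cases "x \<in> S") auto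
  qed simp
  finally have "(\<integral>\<^sup>+x\<in>S. ennreal ((g x)\<^sup>2) \<partial>\<nu>) \<le> ennreal k * (\<integral>\<^sup>+x\<in>S. (descending_slope d S f x)\<^sup>2 \<partial>\<nu>)" .
  moreover have "(\<integral>\<^sup>+x\<in>S. ennreal ((g x)\<^sup>2) \<partial>\<nu>) = (\<integral>\<^sup>+x\<in>S. ennreal ((f x)\<^sup>2) \<partial>\<nu>)"
    by (intro nn_integral_cong) (auto simp: g_def indicator_def)
  ultimately show ?thesis by (simp add: k_def)
qed simp

end

theorem theorem5p33:
  fixes d :: "'a \<Rightarrow> 'a \<Rightarrow> real" and \<nu> :: "'a measure" and K N :: real and f :: "'a \<Rightarrow> real"
  assumes "K > 0" and "N > 1"
    and "weak_CD d \<nu> K N"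
    and "fwd_Lipschitz_on d (msupp d \<nu>) f"
    and "(LINT x:msupp d \<nu>|\<nu>. f x) = 0"
  shows "(\<integral>\<^sup>+x\<in>msupp d \<nu>. ennreal ((f x)\<^sup>2) \<partial>\<nu>)
    \<le> ennreal ((N - 1) / (N * K)) * (\<integral>\<^sup>+x\<in>msupp d \<nu>. (descending_slope d (msupp d \<nu>) f x)\<^sup>2 \<partial>\<nu>)"
proof -
  interpret weak_CD_space d \<nu> K N using assms(1-3) by unfold_locales
  show ?thesis by (rule Lichnerowicz[OF assms(4,5)])
qed

end
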